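(* There is a $k$-algebra isomorphism $\psi:U_q^+\to O_q(N^+)'$ such that $$\psi(E_i)=-\widehat q^{\,-1}X_{i,i+1}X_{i+1,i+1}^{-1}\qquad\text{for } 1\le i\le n.$$
   Context: $k$ is a field, $q\in k^\times$ is not a root of unity, $\widehat q=q-q^{-1}$, and $n\ge 1$. $O_q(\mathrm{SL}_{n+1})$ is the $k$-algebra generated by $X_{ij}$ ($1\le i,j\le n+1$) with relations (1) $X_{ij}X_{im}=qX_{im}X_{ij}$ for $j<m$; (2) $X_{ij}X_{lj}=qX_{lj}X_{ij}$ for $i<l$; (3) $X_{ij}X_{lm}=X_{lm}X_{ij}$ for $i<l$, $j>m$; (4) $X_{ij}X_{lm}-X_{lm}X_{ij}=\widehat q X_{im}X_{lj}$ for $i<l$, $j<m$; (5) $\sum_{\sigma\in \mathrm{Sym}_{n+1}}(-q)^{\ell(\sigma)}X_{1\sigma(1)}\cdots X_{n+1,\sigma(n+1)}=1$, where $\ell$ is the length function. $O_q(B^+)=O_q(\mathrm{SL}_{n+1})/\langle X_{ij}\mid i>j\rangle$; cosets of $X_{ij}$ are again denoted $X_{ij}$. In $O_q(B^+)$ the elements $X_{ii}$ commute and $X_{11}\cdots X_{n+1,n+1}=1$, so each $X_{ii}$ is invertible. $O_q(N^+)'$ is the $k$-subalgebra of $O_q(B^+)$ generated by $\{X_{ij}X_{jj}^{-1}\mid 1\le i<j\le n+1\}$. Let $\Pi=\{\alpha_1,\dots,\alpha_n\}$ be the simple roots of $\mathfrak{sl}_{n+1}$ and $(\cdot,\cdot)$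 the bilinear form on $\mathbb{Q}\Pi$ with $(\alpha_i,\alpha_j)=c_{ij}$, the Cartan matrix. $U_q=U_q(\mathfrak{sl}_{n+1})$ is the $k$-algebra generated by $K_\lambda$ ($\lambda\in\mathbb{Z}\Pi$), $E_i$, $F_i$ ($1\le i\le n$) with relations $K_0=1$, $K_\lambda K_\mu=K_{\lambda+\mu}$, $K_\lambda E_i=q^{(\lambda,\alpha_i)}E_iK_\lambda$, $K_\lambda F_i=q^{-(\lambda,\alpha_i)}F_iK_\lambda$, $E_iF_j-F_jE_i=\delta_{ij}\,(K_{\alpha_i}-K_{-\alpha_i})/(q-q^{-1})$, $E_iE_j=E_jE_i$ and $F_iF_j=F_jF_i$ for $|i-j|\ge2$, and, for $|i-j|=1$, $E_i^2E_j-(q+q^{-1})E_iE_jE_i+E_jE_i^2=0$ and $F_i^2F_j-(q+q^{-1})F_iF_jF_i+F_jF_i^2=0$. $U_q^+$ is the subalgebra of $U_q$ generated by $E_1,\dots,E_n$. *)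

theory Defs
  imports
    "HOL-Algebra.Subrings"
    "HOL-Algebra.Module"
    "HOL-Library.Poly_Mapping"
    "HOL-Combinatorics.Permutations"
begin

section \<open>Associative algebras over a field\<close>

text \<open>
  The ground field is a type \<open>'k\<close> of class \<^class>\<open>field\<close>; algebras over it are \<^type>\<open>module\<close>
  records. The library locales \<^locale>\<open>module\<close> and \<open>algebra\<close> take the scalars from a ring record,
  and \<open>algebra\<close> is commutative, hence the following locale.
\<close>

locale k_algebra = ring A for A :: "('k::field, 'a, 'm) module_scheme" (structure) +
  assumes smult_closed [simp, intro]: "x \<in> carrier A \<Longrightarrow> c \<odot> x \<in> carrier A"
    and smult_l_distr: "x \<in> carrier A \<Longrightarrow> (c + d) \<odot> x = c \<odot> x \<oplus> d \<odot> x"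
    and smult_r_distr: "x \<in> carrier A \<Longrightarrow> y \<in> carrier A \<Longrightarrow> c \<odot> (x \<oplus> y) = c \<odot> x \<oplus> c \<odot> y"
    and smult_smult: "x \<in> carrier A \<Longrightarrow> c \<odot> (d \<odot> x) = (c * d) \<odot> x"
    and smult_one [simp]: "x \<in> carrier A \<Longrightarrow> 1 \<odot> x = x"
    and smult_mult_left: "x \<in> carrier A \<Longrightarrow> y \<in> carrier A \<Longrightarrow> (c \<odot> x) \<otimes> y = c \<odot> (x \<otimes> y)"
    and smult_mult_right: "x \<in> carrier A \<Longrightarrow> y \<in> carrier A \<Longrightarrow> x \<otimes> (c \<odot> y) = c \<odot> (x \<otimes> y)"

definition k_algebra_iso ::
    "('k, 'a, 'm) module_scheme \<Rightarrow> ('k, 'b, 'n) module_scheme \<Rightarrow> ('a \<Rightarrow> 'b) set"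
  where "k_algebra_iso A B =
    {h \<in> ring_iso A B. \<forall>c. \<forall>x\<in>carrier A. h (c \<odot>\<^bsub>A\<^esub> x) = c \<odot>\<^bsub>B\<^esub> h x}"

definition k_subalgebra :: "('k, 'a, 'm) module_scheme \<Rightarrow> 'a set \<Rightarrow> bool"
  where "k_subalgebra A B \<longleftrightarrow> subring B A \<and> (\<forall>c. \<forall>x\<in>B. c \<odot>\<^bsub>A\<^esub> x \<in> B)"

definition generated_algebra ::
    "('k, 'a, 'm) module_scheme \<Rightarrow> 'a set \<Rightarrow> ('k, 'a, 'm) module_scheme"
  where "generated_algebra A S = A\<lparr>carrier := \<Inter>{B. k_subalgebra A B \<and> S \<subseteq> B}\<rparr>"

text \<open>
  The quotient by a two-sided ideal. The scalar action follows the pattern of \<^const>\<open>rcoset_mult\<close>;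
  lemma \<open>(in k_algebra) quotient_smult\<close> below shows that it is the expected one.
\<close>

definition quotient_algebra ::
    "('k, 'a, 'm) module_scheme \<Rightarrow> 'a set \<Rightarrow> ('k, 'a set) module"
  where "quotient_algebra A I =
    ring.extend (A Quot I) \<lparr>smult = (\<lambda>c X. \<Union>x\<in>X. I +>\<^bsub>A\<^esub> (c \<odot>\<^bsub>A\<^esub> x))\<rparr>"

lemma quotient_algebra_simps [simp]:
  "carrier (quotient_algebra A I) = a_rcosets\<^bsub>A\<^esub> I"
  "X \<otimes>\<^bsub>quotient_algebra A I\<^esub> Y = rcoset_mult A I X Y"
  "\<one>\<^bsub>quotient_algebra A I\<^esub> = I +>\<^bsub>A\<^esub> \<one>\<^bsub>A\<^esub>"
  "\<zero>\<^bsub>quotient_algebra A I\<^esub> = I"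
  "X \<oplus>\<^bsub>quotient_algebra A I\<^esub> Y = X <+>\<^bsub>A\<^esub> Y"
  "c \<odot>\<^bsub>quotient_algebra A I\<^esub> X = (\<Union>x\<in>X. I +>\<^bsub>A\<^esub> (c \<odot>\<^bsub>A\<^esub> x))"
  by (simp_all add: quotient_algebra_def FactRing_def ring.defs)

section \<open>Free algebras and presentations\<close>

datatype 'x free_monoid = Word (letters: "'x list")

instantiation free_monoid :: (type) monoid_add
begin

definition "0 = Word []"
definition "u + v = Word (letters u @ letters v)"

instance
  by standard (simp_all add: zero_free_monoid_def plus_free_monoid_def)

end

text \<open>
  By the instances of \<^typ>\<open>'a \<Rightarrow>\<^sub>0 'b\<close>, the following is the free associative unital algebra on
  the type \<open>'x\<close>, and \<open>*\<close> on it is the convolution product, that is, concatenation of words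
  extended bilinearly.
\<close>

type_synonym ('x, 'k) free_alg = "'x free_monoid \<Rightarrow>\<^sub>0 'k"

definition gen :: "'x \<Rightarrow> ('x, 'k::field) free_alg"
  where "gen x = Poly_Mapping.single (Word [x]) 1"

definition scal :: "'k \<Rightarrow> ('x, 'k::field) free_alg"
  where "scal c = Poly_Mapping.single 0 c"

definition free_algebra :: "'x set \<Rightarrow> ('k::field, ('x, 'k) free_alg) module"
  where "free_algebra S =
    \<lparr>carrier = {p. \<forall>w\<in>Poly_Mapping.keys p. set (letters w) \<subseteq> S},
     monoid.mult = (*), one = 1, zero = 0, add = (+), smult = (\<lambda>c p. scal c * p)\<rparr>"

definition presented_algebra ::
    "'x set \<Rightarrow> ('x, 'k::field) free_alg set \<Rightarrow> ('k, ('x, 'k) free_alg set) module"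
  where "presented_algebra S rels =
    quotient_algebra (free_algebra S) (genideal (free_algebra S) rels)"

definition presented_gen ::
    "'x set \<Rightarrow> ('x, 'k::field) free_alg set \<Rightarrow> 'x \<Rightarrow> ('x, 'k) free_alg set"
  where "presented_gen S rels x =
    genideal (free_algebra S) rels +>\<^bsub>free_algebra S\<^esub> gen x"

section \<open>The quantized coordinate rings\<close>

text \<open>The Coxeter length on the symmetric group of \<open>{1..N}\<close>.\<close>

definition perm_length :: "nat \<Rightarrow> (nat \<Rightarrow> nat) \<Rightarrow> nat"
  where "perm_length N \<sigma> =
    (LEAST r. \<exists>is. length is = r \<and> set is \<subseteq> {1..<N} \<and>
       \<sigma> = foldr (\<circ>) (map (\<lambda>i. transpose i (Suc i)) is) id)"

text \<open>The generator \<open>X\<^sub>i\<^sub>j\<close> is indexed by the pair \<open>(i, j)\<close>.\<close>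

definition O_gens :: "nat \<Rightarrow> (nat \<times> nat) set"
  where "O_gens n = {1..n+1} \<times> {1..n+1}"

abbreviation fX :: "nat \<Rightarrow> nat \<Rightarrow> (nat \<times> nat, 'k::field) free_alg"
  where "fX i j \<equiv> gen (i, j)"

definition O_SL_rels :: "nat \<Rightarrow> 'k::field \<Rightarrow> (nat \<times> nat, 'k) free_alg set"
  where "O_SL_rels n q =
      {fX i j * fX i m - scal q * fX i m * fX i j | i j m.
         i \<in> {1..n+1} \<and> j \<in> {1..n+1} \<and> m \<in> {1..n+1} \<and> j < m}
    \<union> {fX i j * fX l j - scal q * fX l j * fX i j | i j l.
         i \<in> {1..n+1} \<and> j \<in> {1..n+1} \<and> l \<in> {1..n+1} \<and> i < l}
    \<union> {fX i j * fX l m - fX l m * fX i j | i j l m.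
         i \<in> {1..n+1} \<and> j \<in> {1..n+1} \<and> l \<in> {1..n+1} \<and> m \<in> {1..n+1} \<and> i < l \<and> j > m}
    \<union> {fX i j * fX l m - fX l m * fX i j - scal (q - inverse q) * fX i m * fX l j | i j l m.
         i \<in> {1..n+1} \<and> j \<in> {1..n+1} \<and> l \<in> {1..n+1} \<and> m \<in> {1..n+1} \<and> i < l \<and> j < m}
    \<union> {(\<Sum>\<sigma> | \<sigma> permutes {1..n+1}.
           scal ((- q) ^ perm_length (n+1) \<sigma>) * prod_list (map (\<lambda>i. fX i (\<sigma> i)) [1..<n+2])) - 1}"

definition O_SL :: "nat \<Rightarrow> 'k::field \<Rightarrow> ('k, (nat \<times> nat, 'k) free_alg set) module"
  where "O_SL n q = presented_algebra (O_gens n) (O_SL_rels n q)"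

definition X_SL :: "nat \<Rightarrow> 'k::field \<Rightarrow> nat \<Rightarrow> nat \<Rightarrow> (nat \<times> nat, 'k) free_alg set"
  where "X_SL n q i j = presented_gen (O_gens n) (O_SL_rels n q) (i, j)"

definition B_ideal :: "nat \<Rightarrow> 'k::field \<Rightarrow> (nat \<times> nat, 'k) free_alg set set"
  where "B_ideal n q =
    genideal (O_SL n q) {X_SL n q i j | i j. i \<in> {1..n+1} \<and> j \<in> {1..n+1} \<and> i > j}"

definition O_B :: "nat \<Rightarrow> 'k::field \<Rightarrow> ('k, (nat \<times> nat, 'k) free_alg set set) module"
  where "O_B n q = quotient_algebra (O_SL n q) (B_ideal n q)"

definition X_B :: "nat \<Rightarrow> 'k::field \<Rightarrow> nat \<Rightarrow> nat \<Rightarrow> (nat \<times> nat, 'k) free_alg set set"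
  where "X_B n q i j = B_ideal n q +>\<^bsub>O_SL n q\<^esub> X_SL n q i j"

definition O_N' :: "nat \<Rightarrow> 'k::field \<Rightarrow> ('k, (nat \<times> nat, 'k) free_alg set set) module"
  where "O_N' n q = generated_algebra (O_B n q)
    {X_B n q i j \<otimes>\<^bsub>O_B n q\<^esub> inv\<^bsub>O_B n q\<^esub> (X_B n q j j) | i j. 1 \<le> i \<and> i < j \<and> j \<le> n+1}"

section \<open>The quantized enveloping algebra\<close>

definition cartan :: "nat \<Rightarrow> nat \<Rightarrow> int"
  where "cartan i j = (if i = j then 2 else if i = j + 1 \<or> j = i + 1 then -1 else 0)"

text \<open>
  An element of \<open>\<int>\<Pi>\<close> is given by its coefficients with respect to \<open>\<alpha>\<^sub>1, \<dots>, \<alpha>\<^sub>n\<close>, extended by zero.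
  The bilinear form is only needed, and only defined, on this lattice.
\<close>

definition root_lattice :: "nat \<Rightarrow> (nat \<Rightarrow> int) set"
  where "root_lattice n = {l. \<forall>i. i \<notin> {1..n} \<longrightarrow> l i = 0}"

definition simple_root :: "nat \<Rightarrow> nat \<Rightarrow> int"
  where "simple_root i = (\<lambda>j. if j = i then 1 else 0)"

definition root_form :: "nat \<Rightarrow> (nat \<Rightarrow> int) \<Rightarrow> (nat \<Rightarrow> int) \<Rightarrow> int"
  where "root_form n l m = (\<Sum>i=1..n. \<Sum>j=1..n. l i * m j * cartan i j)"

datatype U_gen = K "nat \<Rightarrow> int" | E nat | F nat

definition U_gens :: "nat \<Rightarrow> U_gen set"
  where "U_gens n = K ` root_lattice n \<union> E ` {1..n} \<union> F ` {1..n}"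

abbreviation fK :: "(nat \<Rightarrow> int) \<Rightarrow> (U_gen, 'k::field) free_alg" where "fK l \<equiv> gen (K l)"
abbreviation fE :: "nat \<Rightarrow> (U_gen, 'k::field) free_alg" where "fE i \<equiv> gen (E i)"
abbreviation fF :: "nat \<Rightarrow> (U_gen, 'k::field) free_alg" where "fF i \<equiv> gen (F i)"

definition U_rels :: "nat \<Rightarrow> 'k::field \<Rightarrow> (U_gen, 'k) free_alg set"
  where "U_rels n q =
      {fK (\<lambda>_. 0) - 1}
    \<union> {fK l * fK m - fK (\<lambda>i. l i + m i) | l m. l \<in> root_lattice n \<and> m \<in> root_lattice n}
    \<union> {fK l * fE i - scal (q powi root_form n l (simple_root i)) * fE i * fK l | l i.
         l \<in> root_lattice n \<and> i \<in> {1..n}}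
    \<union> {fK l * fF i - scal (q powi (- root_form n l (simple_root i))) * fF i * fK l | l i.
         l \<in> root_lattice n \<and> i \<in> {1..n}}
    \<union> {fE i * fF j - fF j * fE i -
         (if i = j
          then scal (inverse (q - inverse q)) * (fK (simple_root i) - fK (\<lambda>t. - simple_root i t))
          else 0) | i j. i \<in> {1..n} \<and> j \<in> {1..n}}
    \<union> {fE i * fE j - fE j * fE i | i j. i \<in> {1..n} \<and> j \<in> {1..n} \<and> \<bar>int i - int j\<bar> \<ge> 2}
    \<union> {fF i * fF j - fF j * fF i | i j. i \<in> {1..n} \<and> j \<in> {1..n} \<and> \<bar>int i - int j\<bar> \<ge> 2}
    \<union> {fE i ^ 2 * fE j - scal (q + inverse q) * fE i * fE j * fE i + fE j * fE i ^ 2 | i j.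
         i \<in> {1..n} \<and> j \<in> {1..n} \<and> \<bar>int i - int j\<bar> = 1}
    \<union> {fF i ^ 2 * fF j - scal (q + inverse q) * fF i * fF j * fF i + fF j * fF i ^ 2 | i j.
         i \<in> {1..n} \<and> j \<in> {1..n} \<and> \<bar>int i - int j\<bar> = 1}"

definition U_alg :: "nat \<Rightarrow> 'k::field \<Rightarrow> ('k, (U_gen, 'k) free_alg set) module"
  where "U_alg n q = presented_algebra (U_gens n) (U_rels n q)"

definition E_U :: "nat \<Rightarrow> 'k::field \<Rightarrow> nat \<Rightarrow> (U_gen, 'k) free_alg set"
  where "E_U n q i = presented_gen (U_gens n) (U_rels n q) (E i)"

definition U_plus :: "nat \<Rightarrow> 'k::field \<Rightarrow> ('k, (U_gen, 'k) free_alg set) module"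
  where "U_plus n q = generated_algebra (U_alg n q) (E_U n q ` {1..n})"

section \<open>Well-definedness\<close>

lemma (in k_algebra) ideal_smult_closed:
  assumes "ideal I A" "x \<in> I"
  shows "c \<odot> x \<in> I"
proof -
  interpret ideal I A by fact
  have x: "x \<in> carrier A" using assms(2) by (rule a_Hcarr)
  have "(c \<odot> \<one>) \<otimes> x \<in> I" using assms(2) by (simp add: I_l_closed)
  then show ?thesis using x by (simp add: smult_mult_left)
qed

lemma (in k_algebra) quotient_smult:
  assumes I: "ideal I A" and x: "x \<in> carrier A"
  shows "c \<odot>\<^bsub>quotient_algebra A I\<^esub> (I +> x) = I +> (c \<odot> x)"
proof -
  interpret ideal I A by fact
  have "I +> (c \<odot> y) = I +> (c \<odot> x)" if y: "y \<in> I +> x" for y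
  proof -
    obtain h where h: "h \<in> I" "y = h \<oplus> x" using y by (auto simp: a_r_coset_def')
    have "c \<odot> y = c \<odot> h \<oplus> c \<odot> x" using h x by (simp add: smult_r_distr)
    then have "c \<odot> y \<in> I +> (c \<odot> x)"
      using ideal_smult_closed[OF I h(1)] by (auto simp: a_r_coset_def')
    then show ?thesis using a_repr_independence[of "c \<odot> y" I "c \<odot> x"] x
      by (simp add: is_additive_subgroup additive_subgroup.a_subgroup)
  qed
  moreover have "I +> x \<noteq> {}" using a_rcos_self[OF x] by blast
  ultimately show ?thesis unfolding quotient_algebra_simps by (intro SUP_eq_const)
qed

lemma ring_extend:
  assumes "ring R"
  shows "ring (ring.extend R x)"
proof -
  interpret R: ring R by fact
  have [simp]:
    "carrier (ring.extend R x) = carrier R" "monoid.mult (ring.extend R x) = monoid.mult R"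
    "one (ring.extend R x) = one R" "zero (ring.extend R x) = zero R"
    "add (ring.extend R x) = add R"
    by (simp_all add: ring.defs)
  show ?thesis
  proof (rule ringI)
    show "abelian_group (ring.extend R x)"
    proof (rule abelian_groupI)
      fix y assume "y \<in> carrier (ring.extend R x)"
      then show "\<exists>z\<in>carrier (ring.extend R x). z \<oplus>\<^bsub>ring.extend R x\<^esub> y = \<zero>\<^bsub>ring.extend R x\<^esub>"
        using R.l_neg by (auto intro!: bexI[of _ "\<ominus>\<^bsub>R\<^esub> y"])
    qed (simp_all add: R.a_ac)
    show "monoid (ring.extend R x)"
      by (rule monoidI) (simp_all add: R.m_assoc)
  qed (simp_all add: R.l_distr R.r_distr)
qed

lemma (in k_algebra) quotient_k_algebra:
  assumes I: "ideal I A"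
  shows "k_algebra (quotient_algebra A I)"
proof -
  note A_closed = a_closed m_closed
  interpret ideal I A by fact
  interpret Q: ring "A Quot I" by (rule quotient_is_ring)
  let ?Q = "quotient_algebra A I"
  have "ring ?Q"
    unfolding quotient_algebra_def by (rule ring_extend) (rule quotient_is_ring)
  then interpret Q': ring ?Q .
  have rep: "\<exists>x\<in>carrier A. X = I +> x" if "X \<in> carrier ?Q" for X
    using that by (auto simp: A_RCOSETS_def')
  have cls: "I +> x \<in> carrier ?Q" if "x \<in> carrier A" for x
    using that by (auto simp: A_RCOSETS_def')
  have ops:
    "x \<in> carrier A \<Longrightarrow> c \<odot>\<^bsub>?Q\<^esub> (I +> x) = I +> (c \<odot> x)"
    "x \<in> carrier A \<Longrightarrow> y \<in> carrier A \<Longrightarrow> (I +> x) \<oplus>\<^bsub>?Q\<^esub> (I +> y) = I +> (x \<oplus> y)"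
    "x \<in> carrier A \<Longrightarrow> y \<in> carrier A \<Longrightarrow> (I +> x) \<otimes>\<^bsub>?Q\<^esub> (I +> y) = I +> (x \<otimes> y)" for x y c
    using quotient_smult[OF I] by (simp_all only: quotient_algebra_simps(2,5) a_rcos_sum rcoset_mult_add)
  show ?thesis
  proof unfold_locales
    fix X c assume "X \<in> carrier ?Q"
    then obtain x where "x \<in> carrier A" "X = I +> x" using rep by blast
    then show "c \<odot>\<^bsub>?Q\<^esub> X \<in> carrier ?Q"
      by (simp only: ops cls smult_closed)
  next
    fix X c d assume "X \<in> carrier ?Q"
    then obtain x where "x \<in> carrier A" "X = I +> x" using rep by blast
    then show "(c + d) \<odot>\<^bsub>?Q\<^esub> X = c \<odot>\<^bsub>?Q\<^esub> X \<oplus>\<^bsub>?Q\<^esub> d \<odot>\<^bsub>?Q\<^esub> X"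
      and "c \<odot>\<^bsub>?Q\<^esub> (d \<odot>\<^bsub>?Q\<^esub> X) = (c * d) \<odot>\<^bsub>?Q\<^esub> X" and "1 \<odot>\<^bsub>?Q\<^esub> X = X"
      by (simp_all only: ops smult_l_distr smult_smult smult_one smult_closed)
  next
    fix X Y c assume "X \<in> carrier ?Q" "Y \<in> carrier ?Q"
    then obtain x y where "x \<in> carrier A" "X = I +> x" "y \<in> carrier A" "Y = I +> y"
      using rep by metis
    then show "c \<odot>\<^bsub>?Q\<^esub> (X \<oplus>\<^bsub>?Q\<^esub> Y) = c \<odot>\<^bsub>?Q\<^esub> X \<oplus>\<^bsub>?Q\<^esub> c \<odot>\<^bsub>?Q\<^esub> Y"
      and "(c \<odot>\<^bsub>?Q\<^esub> X) \<otimes>\<^bsub>?Q\<^esub> Y = c \<odot>\<^bsub>?Q\<^esub> (X \<otimes>\<^bsub>?Q\<^esub> Y)"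
      and "X \<otimes>\<^bsub>?Q\<^esub> (c \<odot>\<^bsub>?Q\<^esub> Y) = c \<odot>\<^bsub>?Q\<^esub> (X \<otimes>\<^bsub>?Q\<^esub> Y)"
      by (simp_all only: ops smult_r_distr smult_mult_left smult_mult_right smult_closed
          A_closed)
  qed
qed

lemma scal_commute: "scal c * p = p * scal c"
proof (induction p rule: update_induct)
  case const
  then show ?case by simp
next
  case (update f w v)
  have "Poly_Mapping.update w v f = f + Poly_Mapping.single w v"
    using update(1) by (intro poly_mapping_eqI)
      (auto simp: lookup_update lookup_add lookup_single in_keys_iff when_def)
  with update(3) show ?case
    by (simp add: distrib_left distrib_right scal_def mult_single mult.commute)
qed

lemma free_algebra_k_algebra:
  fixes S :: "'x set"
  shows "k_algebra (free_algebra S :: ('k::field, ('x, 'k) free_alg) module)"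
proof -
  let ?A = "free_algebra S :: ('k, ('x, 'k) free_alg) module"
  let ?C = "{p :: ('x, 'k) free_alg. \<forall>w\<in>Poly_Mapping.keys p. set (letters w) \<subseteq> S}"
  have add: "p + r \<in> ?C" if "p \<in> ?C" "r \<in> ?C" for p r :: "('x, 'k) free_alg"
    using that Poly_Mapping.keys_add[of p r] by auto
  have mult: "p * r \<in> ?C" if "p \<in> ?C" "r \<in> ?C" for p r :: "('x, 'k) free_alg"
  proof -
    have "set (letters w) \<subseteq> S" if w: "w \<in> Poly_Mapping.keys (p * r)" for w
    proof -
      from w keys_mult[of p r] obtain u v where
        "u \<in> Poly_Mapping.keys p" "v \<in> Poly_Mapping.keys r" "w = u + v" by blast
      then show ?thesis using \<open>p \<in> ?C\<close> \<open>r \<in> ?C\<close> by (auto simp: plus_free_monoid_def)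
    qed
    then show ?thesis by blast
  qed
  have scal: "scal c \<in> ?C" for c :: 'k
    by (simp add: scal_def zero_free_monoid_def)
  have one: "1 \<in> ?C"
    using scal[of 1] by (simp add: scal_def)
  have minus: "- p \<in> ?C" if "p \<in> ?C" for p :: "('x, 'k) free_alg"
    using that by simp
  have scal_add: "scal (c + d) = scal c + scal d" and scal_mult: "scal (c * d) = scal c * scal d"
    and scal_one: "scal 1 = 1" for c d :: 'k
    by (simp_all add: scal_def single_add mult_single)
  have C: "carrier ?A = ?C" by (simp add: free_algebra_def)
  note closed = add[folded C] mult[folded C] scal[folded C] one[folded C] minus[folded C]
  have zero: "0 \<in> carrier ?A" by (simp add: free_algebra_def)
  have ops:
    "monoid.mult ?A = (*)" "one ?A = 1" "ring.zero ?A = 0" "ring.add ?A = (+)"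
    "smult ?A = (\<lambda>c p. scal c * p)"
    by (simp_all add: free_algebra_def)
  have "ring ?A"
  proof (rule ringI)
    show "abelian_group ?A"
    proof (rule abelian_groupI)
      fix p assume "p \<in> carrier ?A"
      then show "\<exists>r\<in>carrier ?A. r \<oplus>\<^bsub>?A\<^esub> p = \<zero>\<^bsub>?A\<^esub>"
        by (intro bexI[of _ "- p"]) (simp_all only: ops closed left_minus)
    qed (simp_all only: ops closed zero ac_simps add_0_left add_0_right)
    show "monoid ?A"
      by (rule monoidI) (simp_all only: ops closed mult.assoc mult_1_left mult_1_right)
  qed (simp_all only: ops distrib_left distrib_right)
  then interpret ring ?A .
  show ?thesis
  proof unfold_locales
    fix p r :: "('x, 'k) free_alg" and c :: 'k
    show "p \<otimes>\<^bsub>?A\<^esub> (c \<odot>\<^bsub>?A\<^esub> r) = c \<odot>\<^bsub>?A\<^esub> (p \<otimes>\<^bsub>?A\<^esub> r)"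
      by (simp only: ops mult.assoc[symmetric] scal_commute[of c p])
  qed (simp_all only: ops closed distrib_left distrib_right scal_add scal_mult scal_one mult.assoc
      mult_1_left)
qed

lemma presented_algebra_k_algebra:
  assumes "rels \<subseteq> carrier (free_algebra S)"
  shows "k_algebra (presented_algebra S rels)"
proof -
  interpret k_algebra "free_algebra S" by (rule free_algebra_k_algebra)
  show ?thesis unfolding presented_algebra_def
    by (rule quotient_k_algebra, rule genideal_ideal, rule assms)
qed

lemma free_algebra_closed:
  shows "x \<in> S \<Longrightarrow> gen x \<in> carrier (free_algebra S)"
    and "scal c \<in> carrier (free_algebra S)"
    and "0 \<in> carrier (free_algebra S)" and "1 \<in> carrier (free_algebra S)"
    and "p \<in> carrier (free_algebra S) \<Longrightarrow> r \<in> carrier (free_algebra S) \<Longrightarrow> p + r \<in> carrier (free_algebra S)"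
    and "p \<in> carrier (free_algebra S) \<Longrightarrow> r \<in> carrier (free_algebra S) \<Longrightarrow> p - r \<in> carrier (free_algebra S)"
    and "p \<in> carrier (free_algebra S) \<Longrightarrow> r \<in> carrier (free_algebra S) \<Longrightarrow> p * r \<in> carrier (free_algebra S)"
    and "p \<in> carrier (free_algebra S) \<Longrightarrow> p ^ k \<in> carrier (free_algebra S)"
proof -
  interpret k_algebra "free_algebra S" by (rule free_algebra_k_algebra)
  show "x \<in> S \<Longrightarrow> gen x \<in> carrier (free_algebra S)"
    and scal: "scal c \<in> carrier (free_algebra S)" for c
    by (simp_all add: free_algebra_def gen_def scal_def zero_free_monoid_def)
  show "0 \<in> carrier (free_algebra S)" and one: "1 \<in> carrier (free_algebra S)"
    using zero_closed one_closed by (simp_all add: free_algebra_def del: zero_closed one_closed)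
  show add: "p + r \<in> carrier (free_algebra S)"
    if "p \<in> carrier (free_algebra S)" "r \<in> carrier (free_algebra S)" for p r
    using a_closed[OF that] by (simp add: free_algebra_def)
  show mult: "p * r \<in> carrier (free_algebra S)"
    if "p \<in> carrier (free_algebra S)" "r \<in> carrier (free_algebra S)" for p r
    using m_closed[OF that] by (simp add: free_algebra_def)
  have "- r \<in> carrier (free_algebra S)" if "r \<in> carrier (free_algebra S)"
    using that by (simp add: free_algebra_def)
  then show "p - r \<in> carrier (free_algebra S)"
    if "p \<in> carrier (free_algebra S)" "r \<in> carrier (free_algebra S)"
    using add[of p "- r"] that by simp
  show "p ^ k \<in> carrier (free_algebra S)" if "p \<in> carrier (free_algebra S)"
    by (induction k) (simp_all only: power_0 power_Suc one mult that)
qed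

lemma U_alg_k_algebra:
  fixes q :: "'k::field"
  shows "k_algebra (U_alg n q)"
proof -
  have gens: "l \<in> root_lattice n \<Longrightarrow> K l \<in> U_gens n"
    "i \<in> {1..n} \<Longrightarrow> E i \<in> U_gens n" "i \<in> {1..n} \<Longrightarrow> F i \<in> U_gens n" for l i
    by (simp_all add: U_gens_def)
  have lattice: "(\<lambda>_. 0) \<in> root_lattice n"
    "l \<in> root_lattice n \<Longrightarrow> m \<in> root_lattice n \<Longrightarrow> (\<lambda>i. l i + m i) \<in> root_lattice n"
    "i \<in> {1..n} \<Longrightarrow> simple_root i \<in> root_lattice n"
    "i \<in> {1..n} \<Longrightarrow> (\<lambda>t. - simple_root i t) \<in> root_lattice n" for l m i
    by (auto simp: root_lattice_def simple_root_def)
  have "U_rels n q \<subseteq> carrier (free_algebra (U_gens n))"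
    unfolding U_rels_def
    by (intro Un_least subsetI; elim CollectE exE conjE insertE emptyE; hypsubst;
        simp only: free_algebra_closed gens lattice simp_thms split: if_split)
  then show ?thesis unfolding U_alg_def by (rule presented_algebra_k_algebra)
qed

lemma O_SL_k_algebra:
  fixes q :: "'k::field"
  shows "k_algebra (O_SL n q)"
proof -
  let ?C = "carrier (free_algebra (O_gens n)) :: (nat \<times> nat, 'k) free_alg set"
  have gens: "i \<in> {1..n+1} \<Longrightarrow> j \<in> {1..n+1} \<Longrightarrow> (i, j) \<in> O_gens n" for i j
    by (simp add: O_gens_def)
  have prods: "prod_list xs \<in> ?C" if "set xs \<subseteq> ?C" for xs
    using that by (induction xs) (simp_all add: free_algebra_closed)
  have sums: "(\<Sum>x\<in>M. f x) \<in> ?C" if "\<And>x. x \<in> M \<Longrightarrow> f x \<in> ?C"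
    for M :: "(nat \<Rightarrow> nat) set" and f :: "_ \<Rightarrow> (nat \<times> nat, 'k) free_alg"
    using that by (induction M rule: infinite_finite_induct) (simp_all add: free_algebra_closed)
  have "prod_list (map (\<lambda>i. fX i (\<sigma> i)) [1..<n+2]) \<in> ?C" if \<sigma>: "\<sigma> permutes {1..n+1}" for \<sigma>
  proof (rule prods, rule subsetI)
    fix x :: "(nat \<times> nat, 'k) free_alg"
    assume "x \<in> set (map (\<lambda>i. fX i (\<sigma> i)) [1..<n+2])"
    then have "x \<in> (\<lambda>i. fX i (\<sigma> i)) ` {1..<n+2}" by (simp only: set_map set_upt)
    moreover have "{1..<n+2} = {1..n+1}" by auto
    ultimately obtain i where i: "i \<in> {1..n+1}" "x = fX i (\<sigma> i)" by blast
    moreover have "\<sigma> i \<in> {1..n+1}" using i(1) permutes_in_image[OF \<sigma>] by blast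
    ultimately show "x \<in> ?C" by (simp only: free_algebra_closed gens)
  qed
  then have det: "(\<Sum>\<sigma> | \<sigma> permutes {1..n+1}.
      scal ((- q) ^ perm_length (n+1) \<sigma>) * prod_list (map (\<lambda>i. fX i (\<sigma> i)) [1..<n+2])) - 1 \<in> ?C"
    by (intro free_algebra_closed(4,6) sums) (simp only: mem_Collect_eq free_algebra_closed)
  have "O_SL_rels n q \<subseteq> ?C"
    unfolding O_SL_rels_def
  proof (intro Un_least)
    show "{(\<Sum>\<sigma> | \<sigma> permutes {1..n+1}.
      scal ((- q) ^ perm_length (n+1) \<sigma>) * prod_list (map (\<lambda>i. fX i (\<sigma> i)) [1..<n+2])) - 1} \<subseteq> ?C"
      using det by (simp only: insert_subset empty_subsetI simp_thms)
  qed ((rule subsetI; elim CollectE exE conjE; hypsubst;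
      intro free_algebra_closed(1,2,6,7) gens; assumption)+)
  then show ?thesis unfolding O_SL_def by (rule presented_algebra_k_algebra)
qed

lemma O_B_k_algebra:
  fixes q :: "'k::field"
  shows "k_algebra (O_B n q)"
proof -
  interpret k_algebra "O_SL n q" by (rule O_SL_k_algebra)
  have "X_SL n q i j \<in> carrier (O_SL n q)" if "i \<in> {1..n+1}" "j \<in> {1..n+1}" for i j
  proof -
    have "(i, j) \<in> O_gens n" using that by (simp add: O_gens_def)
    then have "fX i j \<in> carrier (free_algebra (O_gens n))" by (rule free_algebra_closed)
    then show ?thesis
      by (auto simp: O_SL_def X_SL_def presented_algebra_def presented_gen_def A_RCOSETS_def')
  qed
  then show ?thesis unfolding O_B_def B_ideal_def
    by (intro quotient_k_algebra genideal_ideal) blast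
qed

end

theory Submission
  imports Defs
begin

text \<open>
  Both algebras are quotients of the free algebra on \<open>x\<^sub>1, \<dots>, x\<^sub>n\<close>, via \<open>x\<^sub>i \<mapsto> E\<^sub>i\<close> and via
  \<open>x\<^sub>i\<close> to the element prescribed for \<open>\<psi>(E\<^sub>i)\<close>, and each kernel is the ideal \<open>J\<close> of the
  quantum Serre relations; no PBW basis is needed.

  Both kernels contain \<open>J\<close>: for \<open>O\<^sub>q(N\<^sup>+)'\<close>, the element \<open>Y\<^sub>i\<^sub>j = X\<^sub>i\<^sub>j X\<^sub>j\<^sub>j\<^sup>-\<^sup>1\<close> is up to a
  scalar an iterated \<open>q\<close>-commutator of the \<open>Y\<^sub>k\<^sub>,\<^sub>k\<^sub>+\<^sub>1\<close>, which gives the Serre relations and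
  surjectivity at once.

  Both kernels are contained in \<open>J\<close> because each algebra acts on the free algebra modulo \<open>J\<close>
  in such a way that the image of \<open>x\<^sub>i\<close> acts as left multiplication by \<open>x\<^sub>i\<close>: an element of the kernel
  then maps \<open>1\<close> into \<open>J\<close>. For \<open>U\<^sub>q\<close> this is the Verma module. For \<open>O\<^sub>q(B\<^sup>+)\<close>, \<open>X\<^sub>j\<^sub>j\<close> acts by a
  diagonal automorphism and \<open>X\<^sub>i\<^sub>j\<close> by that automorphism followed by left multiplication by a
  multiple of the root vector \<open>z\<^sub>i\<^sub>j\<close>; the relations of quantum matrices become the commutation
  relations between root vectors.
\<close>

section \<open>Rings with central scalars\<close>

text \<open>Checking relations only bounds the kernels from below by \<open>J\<close>; the
  difficulty is to see that nothing beyond \<open>J\<close> vanishes. A module detects this, but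
  there is no basis of the free algebra modulo \<open>J\<close> on which operators could be
  prescribed. Hence all operators live on the whole free algebra, where a linear map may be
  prescribed freely on words, and are then shown to map \<open>J\<close> into itself. The scalar
  \<open>- inverse qhat\<close> normalises a recursion: the elements Y_ij = X_ij X_jj^-1 satisfy
  Y_jm Y_ij - q Y_ij Y_jm = - qhat Y_im, and e = \<open>- inverse qhat\<close> is the nonzero
  solution of e * e * (- qhat) = e. So the multiples e Y_ij obey the recursion of the root vectors
  without any constant. Arithmetic takes place in type class rings (free algebras and rings of
  linear operators), with congruences modulo an ideal instead of quotients. Carriers and cosets
  enter only at the end, through homomorphisms from free algebras whose kernels are
  compared.\<close>

locale central_scalars =
  fixes s :: "'k::field \<Rightarrow> 'r::ring_1"
  assumes s_add: "s (c + d) = s c + s d"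
    and s_mult: "s (c * d) = s c * s d"
    and s_one: "s 1 = 1"
    and s_central: "s c * a = a * s c"
begin

lemma s_zero: "s 0 = 0"
  using s_add[of 0 0] by simp

lemma s_minus: "s (- c) = - s c"
  using s_add[of c "- c"] s_zero by (simp add: minus_unique)

definition scale :: "'k \<Rightarrow> 'r \<Rightarrow> 'r"
  where "scale c a = s c * a"

lemma scale_left: "scale c a * b = scale c (a * b)"
  by (simp add: scale_def mult.assoc)

lemma scale_right: "a * scale c b = scale c (a * b)"
  by (metis scale_def mult.assoc s_central)

lemma scale_scale: "scale c (scale d a) = scale (c * d) a"
  by (simp add: scale_def mult.assoc s_mult)

lemma scale_distrib:
  "scale c (a + b) = scale c a + scale c b"
  "scale c (a - b) = scale c a - scale c b"
  "scale c (- a) = - scale c a"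
  "scale c 0 = 0"
  by (simp_all add: scale_def algebra_simps)

lemma scale_add: "scale (c + d) a = scale c a + scale d a"
  by (simp add: scale_def s_add algebra_simps)

lemma scale_minus: "scale (- c) a = - scale c a"
  by (simp add: scale_def s_minus)

lemma scale_diff: "scale (c - d) a = scale c a - scale d a"
  using scale_add[of c "- d" a] by (simp add: scale_minus)

lemma scale_one: "scale 1 a = a"
  by (simp add: scale_def s_one)

lemma scale_inverse_cancel: "c \<noteq> 0 \<Longrightarrow> scale (inverse c) (scale c a) = a"
  by (simp add: scale_scale scale_one)

lemmas scale_expand = scale_left scale_right scale_scale scale_distrib scale_add scale_diff scale_one

section \<open>q-commutators and Serre expressions\<close>

definition qbr :: "'k \<Rightarrow> 'r \<Rightarrow> 'r \<Rightarrow> 'r"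
  where "qbr c a b = a * b - scale c (b * a)"

definition serre :: "'k \<Rightarrow> 'r \<Rightarrow> 'r \<Rightarrow> 'r"
  where "serre c a b = a\<^sup>2 * b - s c * a * b * a + b * a\<^sup>2"

lemma serre_alt: "serre c a b = a * a * b - scale c (a * b * a) + b * a * a"
  by (simp add: serre_def scale_def power2_eq_square mult.assoc)

lemma qbr_qbr_serre:
  assumes "q \<noteq> 0"
  shows "qbr q a (qbr q b a) = scale (- q) (serre (q + inverse q) a b)"
    and "qbr q (qbr q b a) b = scale (- q) (serre (q + inverse q) b a)"
  using assms
  by (simp_all add: qbr_def serre_alt scale_expand scale_minus algebra_simps power2_eq_square)

text \<open>
  Below, \<open>(a, b, d)\<close> is \<open>(E\<^sub>i, E\<^sub>j, F)\<close> or \<open>(F\<^sub>i, F\<^sub>j, E)\<close>, where the index of \<open>d\<close> is that of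
  \<open>a\<close> or of \<open>b\<close>, and \<open>k - k'\<close> is the Cartan part of the commutator.
\<close>

lemma serre_commute_first:
  assumes q: "q \<noteq> 0"
    and ad: "a * d = d * a + (k - k')" and bd: "b * d = d * b"
    and ka: "k * a = scale (q\<^sup>2) (a * k)" and kb: "k * b = scale (inverse q) (b * k)"
    and ka': "k' * a = scale ((inverse q)\<^sup>2) (a * k')" and kb': "k' * b = scale q (b * k')"
  shows "serre (q + inverse q) a b * d = d * serre (q + inverse q) a b"
proof -
  have cancel: "q * (inverse q * c) = c" for c
    using q by (simp flip: mult.assoc)
  have swap: "a * (d * y) = d * (a * y) + (k * y - k' * y)" "b * (d * y) = d * (b * y)"
    "k * (a * y) = scale (q\<^sup>2) (a * (k * y))" "k * (b * y) = scale (inverse q) (b * (k * y))"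
    "k' * (a * y) = scale ((inverse q)\<^sup>2) (a * (k' * y))" "k' * (b * y) = scale q (b * (k' * y))"
    for y
    using arg_cong[OF ad, of "\<lambda>x. x * y"] arg_cong[OF bd, of "\<lambda>x. x * y"]
      arg_cong[OF ka, of "\<lambda>x. x * y"] arg_cong[OF kb, of "\<lambda>x. x * y"]
      arg_cong[OF ka', of "\<lambda>x. x * y"] arg_cong[OF kb', of "\<lambda>x. x * y"]
    by (simp_all add: mult.assoc distrib_right left_diff_distrib scale_left)
  \<comment> \<open>With \<open>d\<close> moved to the left and \<open>k\<close> to the right, the
    terms in \<open>k\<close> are \<open>a * b * k\<close> with coefficient (q + 1/q) - (q + 1/q)
    and \<open>b * a * k\<close> with coefficient 1 + q^2 - (q + 1/q) q; both vanish. For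
    \<open>k'\<close> exchange q and 1/q.\<close>
  show ?thesis
    by (simp add: serre_alt swap ad bd ka kb ka' kb' scale_expand distrib_left distrib_right left_diff_distrib
        right_diff_distrib mult.assoc)
      (use q in \<open>simp add: algebra_simps power2_eq_square cancel scale_one\<close>)
qed

lemma serre_commute_second:
  assumes q: "q \<noteq> 0"
    and ad: "a * d = d * a" and bd: "b * d = d * b + (k - k')"
    and ka: "k * a = scale (inverse q) (a * k)" and ka': "k' * a = scale q (a * k')"
  shows "serre (q + inverse q) a b * d = d * serre (q + inverse q) a b"
proof -
  have cancel: "q * (inverse q * c) = c" for c
    using q by (simp flip: mult.assoc)
  have swap: "a * (d * y) = d * (a * y)" "b * (d * y) = d * (b * y) + (k * y - k' * y)"
    "k * (a * y) = scale (inverse q) (a * (k * y))" "k' * (a * y) = scale q (a * (k' * y))"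
    for y
    using arg_cong[OF ad, of "\<lambda>x. x * y"] arg_cong[OF bd, of "\<lambda>x. x * y"]
      arg_cong[OF ka, of "\<lambda>x. x * y"] arg_cong[OF ka', of "\<lambda>x. x * y"]
    by (simp_all add: mult.assoc distrib_right left_diff_distrib scale_left)
  \<comment> \<open>All terms in \<open>k\<close> become multiples of \<open>a * a * k\<close>, with
    total coefficient 1 - (q + 1/q)/q + 1/q^2 = 0. For \<open>k'\<close> exchange q and 1/q.\<close>
  show ?thesis
    by (simp add: serre_alt swap ad bd ka ka' scale_expand distrib_left distrib_right left_diff_distrib
        right_diff_distrib mult.assoc)
      (use q in \<open>simp add: algebra_simps power2_eq_square cancel scale_one\<close>)
qed

lemma commutator_commute:
  fixes a b d k k' :: 'r
  assumes ad: "a * d = d * a + (k - k')" and bd: "b * d = d * b"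
    and kb: "k * b = b * k" and kb': "k' * b = b * k'"
  shows "(a * b - b * a) * d = d * (a * b - b * a)"
proof -
  have "a * b * d = (d * a + (k - k')) * b"
    by (simp add: bd mult.assoc flip: ad)
  moreover have "b * a * d = b * (d * a + (k - k'))"
    by (simp add: mult.assoc flip: ad)
  ultimately have "(a * b - b * a) * d = (d * a + (k - k')) * b - b * (d * a + (k - k'))"
    by (simp add: left_diff_distrib)
  also have "\<dots> = d * a * b - (b * d) * a"
    by (simp add: distrib_left distrib_right left_diff_distrib right_diff_distrib kb kb' mult.assoc)
  finally show ?thesis
    by (simp add: bd right_diff_distrib mult.assoc)
qed

end

section \<open>Congruences modulo a two-sided ideal\<close>

locale scalar_ideal = central_scalars s for s :: "'k::field \<Rightarrow> 'r::ring_1" +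
  fixes N :: "'r set"
  assumes zero_mem: "0 \<in> N"
    and add_mem: "a \<in> N \<Longrightarrow> b \<in> N \<Longrightarrow> a + b \<in> N"
    and mult_left_mem: "a \<in> N \<Longrightarrow> b * a \<in> N"
    and mult_right_mem: "a \<in> N \<Longrightarrow> a * b \<in> N"
begin

lemma minus_mem: "a \<in> N \<Longrightarrow> - a \<in> N"
  using mult_left_mem[of a "- 1"] by simp

lemma diff_mem: "a \<in> N \<Longrightarrow> b \<in> N \<Longrightarrow> a - b \<in> N"
  using add_mem[of a "- b"] minus_mem[of b] by simp

lemma scale_mem: "a \<in> N \<Longrightarrow> scale c a \<in> N"
  by (simp add: scale_def mult_left_mem)

lemma scale_mem_cancel: "scale c a \<in> N \<Longrightarrow> c \<noteq> 0 \<Longrightarrow> a \<in> N"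
  by (metis scale_inverse_cancel scale_mem)

lemmas ideal_intros = zero_mem add_mem diff_mem minus_mem scale_mem mult_left_mem mult_right_mem

definition cong :: "'r \<Rightarrow> 'r \<Rightarrow> bool"  (infix \<open>\<approx>\<close> 50)
  where "a \<approx> b \<longleftrightarrow> a - b \<in> N"

lemma cong_refl: "a \<approx> a"
  by (simp add: cong_def zero_mem)

lemma cong_sym: "a \<approx> b \<Longrightarrow> b \<approx> a"
  unfolding cong_def using minus_mem by fastforce

lemma cong_trans [trans]: "a \<approx> b \<Longrightarrow> b \<approx> c \<Longrightarrow> a \<approx> c"
  unfolding cong_def using add_mem[of "a - b" "b - c"] by simp

lemma cong_mem: "a \<approx> b \<Longrightarrow> a \<in> N \<longleftrightarrow> b \<in> N"
  unfolding cong_def using add_mem[of "a - b" b] diff_mem[of a "a - b"] by auto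

lemma cong_add: "a \<approx> b \<Longrightarrow> c \<approx> d \<Longrightarrow> a + c \<approx> b + d"
  unfolding cong_def by (drule (1) add_mem) (simp add: algebra_simps)

lemma cong_diff: "a \<approx> b \<Longrightarrow> c \<approx> d \<Longrightarrow> a - c \<approx> b - d"
  unfolding cong_def by (drule (1) diff_mem) (simp add: algebra_simps)

lemma cong_mult: "a \<approx> b \<Longrightarrow> c \<approx> d \<Longrightarrow> a * c \<approx> b * d"
  unfolding cong_def
  using add_mem[OF mult_right_mem[of "a - b" c] mult_left_mem[of "c - d" b]]
  by (simp add: algebra_simps)

lemma cong_scale: "a \<approx> b \<Longrightarrow> scale c a \<approx> scale c b"
  unfolding cong_def using scale_mem[of "a - b" c] by (simp add: scale_distrib)

lemma cong_qbr: "a \<approx> b \<Longrightarrow> c \<approx> d \<Longrightarrow> qbr e a c \<approx> qbr e b d"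
  by (simp add: qbr_def cong_diff cong_mult cong_scale)

lemma qbr_cong: "qbr c a b \<in> N \<longleftrightarrow> a * b \<approx> scale c (b * a)"
  by (simp add: qbr_def cong_def)

lemma qbr_mult_left:
  assumes "qbr c a x \<in> N" "qbr d b x \<in> N"
  shows "qbr (c * d) (a * b) x \<in> N"
proof -
  have "qbr (c * d) (a * b) x = a * qbr d b x + scale d (qbr c a x * b)"
    by (simp add: qbr_def scale_expand algebra_simps)
  with assms show ?thesis by (simp add: ideal_intros)
qed

lemma qbr_mult_right:
  assumes "qbr c x a \<in> N" "qbr d x b \<in> N"
  shows "qbr (c * d) x (a * b) \<in> N"
proof -
  have "qbr (c * d) x (a * b) = qbr c x a * b + scale c (a * qbr d x b)"
    by (simp add: qbr_def scale_expand algebra_simps)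
  with assms show ?thesis by (simp add: ideal_intros)
qed

lemma qbr_scale_left: "qbr c a x \<in> N \<Longrightarrow> qbr c (scale e a) x \<in> N"
  and qbr_scale_right: "qbr c x a \<in> N \<Longrightarrow> qbr c x (scale e a) \<in> N"
  using scale_mem[of "qbr c a x" e] scale_mem[of "qbr c x a" e]
  by (simp_all add: qbr_def scale_expand algebra_simps)

text \<open>The scalar \<open>c * d\<close> does not depend on the order of the factors, so
  \<open>a * b\<close> and \<open>b * a\<close> pass \<open>x\<close> alike, and so does every
  combination of them.\<close>

lemma qbr_qbr_left:
  assumes "qbr c a x \<in> N" "qbr d b x \<in> N"
  shows "qbr (c * d) (qbr e a b) x \<in> N"
proof -
  have "qbr (c * d) (qbr e a b) x = qbr (c * d) (a * b) x - scale e (qbr (d * c) (b * a) x)"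
    by (simp add: qbr_def scale_expand algebra_simps)
  with qbr_mult_left[OF assms] qbr_mult_left[OF assms(2,1)] show ?thesis by (simp add: ideal_intros)
qed

lemma qbr_qbr_right:
  assumes "qbr c x a \<in> N" "qbr d x b \<in> N"
  shows "qbr (c * d) x (qbr e a b) \<in> N"
proof -
  have "qbr (c * d) x (qbr e a b) = qbr (c * d) x (a * b) - scale e (qbr (d * c) x (b * a))"
    by (simp add: qbr_def scale_expand algebra_simps)
  with qbr_mult_right[OF assms] qbr_mult_right[OF assms(2,1)] show ?thesis by (simp add: ideal_intros)
qed

lemma qbr_swap:
  assumes "qbr c a b \<in> N" "c \<noteq> 0"
  shows "qbr (inverse c) b a \<in> N"
proof -
  have "qbr (inverse c) b a = scale (- inverse c) (qbr c a b)"
    using assms(2) by (simp add: qbr_def scale_expand scale_minus algebra_simps)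
  with assms show ?thesis by (simp add: ideal_intros)
qed

lemma qbr_one_sym: "qbr 1 a b \<in> N \<Longrightarrow> qbr 1 b a \<in> N"
  using qbr_swap[of 1 a b] by simp

lemma qbr_mem_cong: "qbr c a b \<in> N \<Longrightarrow> a \<approx> a' \<Longrightarrow> b \<approx> b' \<Longrightarrow> qbr c a' b' \<in> N"
  using cong_mem[OF cong_qbr] by blast

text \<open>The two bracketings differ by multiples of the commutator of \<open>w\<close> and
  \<open>a\<close>. This is what allows a root vector to be split at any place.\<close>

lemma qbr_assoc:
  assumes "qbr 1 w a \<in> N"
  shows "qbr q w (qbr q b a) \<approx> qbr q (qbr q w b) a"
proof -
  have "qbr q w (qbr q b a) - qbr q (qbr q w b) a =
      scale q (b * qbr 1 w a) - scale q (qbr 1 w a * b)"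
    by (simp add: qbr_def scale_expand algebra_simps)
  with assms show ?thesis by (simp add: cong_def ideal_intros)
qed

text \<open>
  Both ways of writing the root vector \<open>z\<close> of \<open>a, b, c\<close> give \<open>b * z - q\<^sup>2 * z * b\<close> and
  \<open>z * b - q\<^sup>2 * b * z\<close> the same value \<open>q * (v * u - u * v)\<close>; subtract.
\<close>
lemma middle_root_commutes:
  assumes q: "1 + q\<^sup>2 \<noteq> 0"
    and ac: "qbr 1 a c \<in> N"
    and bv: "qbr q b (qbr q c b) \<in> N" and ub: "qbr q (qbr q b a) b \<in> N"
  shows "qbr 1 b (qbr q (qbr q c b) a) \<in> N"
proof -
  let ?z = "qbr q (qbr q c b) a"
  \<comment> \<open>\<open>?e\<close> is \<open>qbr q c (qbr q b a) - ?z\<close>, the difference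
    between the two ways of writing the root vector; it lies in \<open>N\<close> because
    \<open>a\<close> and \<open>c\<close> commute modulo \<open>N\<close>.\<close>
  let ?e = "scale (- q) (b * qbr 1 a c - qbr 1 a c * b)"
  have "scale (1 + q\<^sup>2) (qbr 1 b ?z) =
      qbr q b (qbr q c b) * a - scale (q\<^sup>2) (a * qbr q b (qbr q c b))
      - c * qbr q (qbr q b a) b + scale (q\<^sup>2) (qbr q (qbr q b a) b * c)
      + ?e * b - scale (q\<^sup>2) (b * ?e)"
    by (simp add: qbr_def scale_expand scale_minus algebra_simps power2_eq_square)
  also have "\<dots> \<in> N"
    using ac bv ub by (simp add: ideal_intros)
  finally show ?thesis using q by (rule scale_mem_cancel)
qed

end

section \<open>Evaluation on free algebras\<close>

lemma scal_add: "scal (c + d) = scal c + scal d"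
  by (simp add: scal_def single_add)

lemma scal_mult: "scal (c * d) = scal c * scal d"
  by (simp add: scal_def mult_single)

lemma scal_one: "scal 1 = 1"
  by (simp add: scal_def)

interpretation free: central_scalars "scal :: 'k::field \<Rightarrow> ('x, 'k) free_alg"
  by unfold_locales (rule scal_add scal_mult scal_one scal_commute)+

lemma lookup_scale: "Poly_Mapping.lookup (free.scale c p) w = c * Poly_Mapping.lookup p w"
  by (simp add: free.scale_def scal_def Poly_Mapping.map.rep_eq when_def flip: mult_map_scale_conv_mult)

lemma single_Word_Cons:
  "Poly_Mapping.single (Word (x # xs)) 1 = gen x * Poly_Mapping.single (Word xs) (1 :: 'k::field)"
  by (simp add: gen_def mult_single plus_free_monoid_def)

lemma single_Word_Nil: "Poly_Mapping.single (Word []) 1 = 1"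
  by (simp flip: zero_free_monoid_def)

lemma single_scale: "Poly_Mapping.single w c = free.scale c (Poly_Mapping.single w 1)"
  by (simp add: free.scale_def scal_def mult_single)

lemma word_induct [case_names word add scale]:
  fixes p :: "('x, 'k::field) free_alg"
  assumes word: "\<And>xs. P (Poly_Mapping.single (Word xs) 1)"
    and add: "\<And>p r. P p \<Longrightarrow> P r \<Longrightarrow> P (p + r)"
    and scale: "\<And>c p. P p \<Longrightarrow> P (free.scale c p)"
  shows "P p"
proof -
  have single: "P (Poly_Mapping.single w c)" for w c
    using scale[OF word[of "letters w"]] by (simp flip: single_scale)
  show ?thesis
  proof (induction p rule: update_induct)
    case const
    then show ?case using single[of 0 0] by simp
  next
    case (update f w v)
    have "Poly_Mapping.update w v f = f + Poly_Mapping.single w v"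
      using update(1) by (intro poly_mapping_eqI)
        (auto simp: lookup_update lookup_add lookup_single in_keys_iff when_def)
    with update(3) single show ?case by (simp add: add)
  qed
qed

lemma free_alg_induct [case_names one gen add scale]:
  fixes p :: "('x, 'k::field) free_alg"
  assumes one: "P 1"
    and gen: "\<And>x p. P p \<Longrightarrow> P (gen x * p)"
    and add: "\<And>p r. P p \<Longrightarrow> P r \<Longrightarrow> P (p + r)"
    and scale: "\<And>c p. P p \<Longrightarrow> P (free.scale c p)"
  shows "P p"
proof (induction p rule: word_induct)
  case (word xs)
  show ?case
    by (induction xs) (simp_all add: single_Word_Nil single_Word_Cons one gen)
qed (simp_all add: add scale)

context central_scalars
begin

text \<open>Kept apart from \<open>lift\<close> because the operators of the F_i on the Verma module
  are linear extensions of functions on words that are not multiplicative.\<close>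

definition linext :: "('x list \<Rightarrow> 'r) \<Rightarrow> ('x, 'k) free_alg \<Rightarrow> 'r"
  where "linext g p = (\<Sum>w\<in>Poly_Mapping.keys p. scale (Poly_Mapping.lookup p w) (g (letters w)))"

definition lift :: "('x \<Rightarrow> 'r) \<Rightarrow> ('x, 'k) free_alg \<Rightarrow> 'r"
  where "lift \<phi> = linext (\<lambda>xs. prod_list (map \<phi> xs))"

lemma linext_superset:
  assumes "finite A" "Poly_Mapping.keys p \<subseteq> A"
  shows "linext g p = (\<Sum>w\<in>A. scale (Poly_Mapping.lookup p w) (g (letters w)))"
  unfolding linext_def
  by (rule sum.mono_neutral_left) (use assms in \<open>auto simp: in_keys_iff scale_def s_zero\<close>)

lemma linext_add: "linext g (p + r) = linext g p + linext g r"
proof -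
  have "finite (Poly_Mapping.keys p \<union> Poly_Mapping.keys r)" by simp
  note ss = linext_superset[OF this, of _ g]
  show ?thesis
    using Poly_Mapping.keys_add[of p r] by (simp add: ss lookup_add scale_add sum.distrib)
qed

lemma linext_scale: "linext g (free.scale c p) = scale c (linext g p)"
proof -
  have "Poly_Mapping.keys (free.scale c p) \<subseteq> Poly_Mapping.keys p"
    by (auto simp: in_keys_iff lookup_scale)
  then have "linext g (free.scale c p) = (\<Sum>w\<in>Poly_Mapping.keys p. scale (c * Poly_Mapping.lookup p w) (g (letters w)))"
    by (subst linext_superset[of "Poly_Mapping.keys p"]) (simp_all add: lookup_scale)
  then show ?thesis
    by (simp add: linext_def scale_def s_mult sum_distrib_left mult.assoc)
qed

lemma linext_word: "linext g (Poly_Mapping.single (Word xs) 1) = g xs"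
  by (simp add: linext_def scale_one)

lemma lift_add: "lift \<phi> (p + r) = lift \<phi> p + lift \<phi> r"
  and lift_scale: "lift \<phi> (free.scale c p) = scale c (lift \<phi> p)"
  by (simp_all add: lift_def linext_add linext_scale)

lemma lift_one: "lift \<phi> 1 = 1"
  using linext_word[of "\<lambda>xs. prod_list (map \<phi> xs)" "[]"] by (simp add: lift_def single_Word_Nil)

lemma lift_gen_mult: "lift \<phi> (gen x * p) = \<phi> x * lift \<phi> p"
proof (induction p rule: word_induct)
  case (word xs)
  show ?case unfolding lift_def by (simp add: linext_word flip: single_Word_Cons)
qed (simp_all add: distrib_left lift_add free.scale_right lift_scale scale_right)

lemma lift_gen: "lift \<phi> (gen x) = \<phi> x"
  using lift_gen_mult[of \<phi> x 1] by (simp add: lift_one)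

lemma lift_mult: "lift \<phi> (p * r) = lift \<phi> p * lift \<phi> r"
  by (induction p rule: free_alg_induct)
    (simp_all add: lift_one lift_gen_mult mult.assoc distrib_right lift_add free.scale_left
      lift_scale scale_left)

lemma lift_scal: "lift \<phi> (scal c) = s c"
  using lift_scale[of \<phi> c 1] by (simp add: free.scale_def scale_def lift_one)

lemma lift_zero: "lift \<phi> 0 = 0"
  using lift_scal[of \<phi> 0] by (simp add: s_zero free.s_zero)

lemma lift_minus: "lift \<phi> (- p) = - lift \<phi> p"
  using lift_add[of \<phi> p "- p"] by (simp add: lift_zero add_eq_0_iff)

lemma lift_diff: "lift \<phi> (p - r) = lift \<phi> p - lift \<phi> r"
  using lift_add[of \<phi> p "- r"] by (simp add: lift_minus)

lemma lift_power: "lift \<phi> (p ^ m) = lift \<phi> p ^ m"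
  by (induction m) (simp_all add: lift_one lift_mult)

lemma lift_prod_list: "lift \<phi> (prod_list ps) = prod_list (map (lift \<phi>) ps)"
  by (induction ps) (simp_all add: lift_one lift_mult)

lemma lift_qbr: "lift \<phi> (free.qbr c p r) = qbr c (lift \<phi> p) (lift \<phi> r)"
  by (simp add: free.qbr_def qbr_def lift_diff lift_mult lift_scale)

lemma lift_serre: "lift \<phi> (free.serre c p r) = serre c (lift \<phi> p) (lift \<phi> r)"
  by (simp add: free.serre_def serre_def lift_add lift_diff lift_mult lift_power lift_scal)

lemmas lift_simps = lift_add lift_diff lift_minus lift_zero lift_one lift_gen lift_mult lift_scal
  lift_scale lift_power lift_prod_list lift_qbr lift_serre

end

section \<open>Linear operators on a free algebra\<close>

text \<open>As an instance of \<open>ring_1\<close> with composition as product, the linear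
  endomorphisms admit \<open>lift\<close>, which then yields representations of a free algebra from
  the images of its letters.\<close>

typedef (overloaded) ('x, 'k::field) op =
  "{T :: ('x, 'k) free_alg \<Rightarrow> ('x, 'k) free_alg.
      (\<forall>p r. T (p + r) = T p + T r) \<and> (\<forall>c p. T (free.scale c p) = free.scale c (T p))}"
  morphisms app Op
  by (rule exI[of _ "\<lambda>p. p"]) simp

lifting_forget poly_mapping.lifting
setup_lifting type_definition_op

instantiation op :: (type, field) ring_1
begin

lift_definition zero_op :: "('a, 'b) op" is "\<lambda>p. 0"
  by (simp add: free.scale_distrib)

lift_definition one_op :: "('a, 'b) op" is "\<lambda>p. p"
  by simp

lift_definition plus_op :: "('a, 'b) op \<Rightarrow> ('a, 'b) op \<Rightarrow> ('a, 'b) op" is "\<lambda>S T p. S p + T p"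
  by (simp add: free.scale_distrib algebra_simps)

lift_definition uminus_op :: "('a, 'b) op \<Rightarrow> ('a, 'b) op" is "\<lambda>T p. - T p"
  by (simp add: free.scale_distrib)

lift_definition minus_op :: "('a, 'b) op \<Rightarrow> ('a, 'b) op \<Rightarrow> ('a, 'b) op" is "\<lambda>S T p. S p - T p"
  by (simp add: free.scale_distrib algebra_simps)

lift_definition times_op :: "('a, 'b) op \<Rightarrow> ('a, 'b) op \<Rightarrow> ('a, 'b) op" is "\<lambda>S T p. S (T p)"
  by simp

instance
proof
  show "(0 :: ('a, 'b) op) \<noteq> 1"
    by transfer (meson zero_neq_one)
qed (transfer; force simp: algebra_simps)+

end

lemma app_add: "app T (p + r) = app T p + app T r"
  and app_scale: "app T (free.scale c p) = free.scale c (app T p)"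
  by (transfer, simp)+

lemma app_zero: "app T 0 = 0"
  using app_scale[of T 0 0] by (simp add: free.scale_def free.s_zero)

lemma op_eqI: "(\<And>p. app S p = app T p) \<Longrightarrow> S = T"
  by transfer blast

lemmas app_ops = zero_op.rep_eq one_op.rep_eq plus_op.rep_eq uminus_op.rep_eq minus_op.rep_eq
  times_op.rep_eq

lift_definition sop :: "'k::field \<Rightarrow> ('x, 'k) op" is "free.scale"
  by (simp add: free.scale_distrib free.scale_scale mult.commute)

interpretation op: central_scalars "sop :: 'k::field \<Rightarrow> ('x, 'k) op"
  by unfold_locales (transfer; auto simp: free.scale_add free.scale_scale free.scale_one)+

lemma app_op_scale: "app (op.scale c T) p = free.scale c (app T p)"
  by (simp add: op.scale_def app_ops sop.rep_eq)

lift_definition lmul :: "('x, 'k::field) free_alg \<Rightarrow> ('x, 'k) op" is "\<lambda>p r. p * r"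
  by (simp add: distrib_left free.scale_right)

lemma lmul_simps:
  "lmul (p + r) = lmul p + lmul r" "lmul (p - r) = lmul p - lmul r" "lmul 1 = 1"
  "lmul (p * r) = lmul p * lmul r" "lmul (free.scale c p) = op.scale c (lmul p)"
  by (rule op_eqI; simp add: lmul.rep_eq app_ops app_op_scale algebra_simps free.scale_left)+

lemma lmul_zero: "lmul 0 = 0"
  by (rule op_eqI) (simp add: lmul.rep_eq app_ops)

lift_definition lin_op :: "('x list \<Rightarrow> ('x, 'k::field) free_alg) \<Rightarrow> ('x, 'k) op" is "free.linext"
  by (simp add: free.linext_add free.linext_scale)

text \<open>
  Identities among the operators of the Verma module are proved by commuting them past the
  left multiplications, so that only their values at \<open>1\<close> have to be compared.
\<close>
lemma op_eq_zeroI: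
  fixes T :: "('x, 'k::field) op"
  assumes "app T 1 = 0" "\<And>x. T * lmul (gen x) = op.scale (c x) (lmul (gen x) * T)"
  shows "T = 0"
proof (rule op_eqI)
  fix p
  have step: "app T (gen x * r) = free.scale (c x) (gen x * app T r)" for x r
    using arg_cong[OF assms(2)[of x], of "\<lambda>S. app S r"]
    by (simp add: app_ops app_op_scale lmul.rep_eq)
  show "app T p = app 0 p"
    by (induction p rule: free_alg_induct)
      (simp_all add: assms(1) app_add app_scale step app_ops free.scale_distrib)
qed

subsection \<open>Diagonal operators\<close>

lift_definition diag :: "('x \<Rightarrow> 'k::field) \<Rightarrow> ('x, 'k) op"
  is "\<lambda>\<chi>. free.lift (\<lambda>x. free.scale (\<chi> x) (gen x))"
  by (simp add: free.lift_simps)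

lemma diag_mult: "app (diag \<chi>) (p * r) = app (diag \<chi>) p * app (diag \<chi>) r"
  by (simp add: diag.rep_eq free.lift_simps)

lemma diag_one: "app (diag \<chi>) 1 = 1"
  by (simp add: diag.rep_eq free.lift_simps)

lemma diag_gen: "app (diag \<chi>) (gen x) = free.scale (\<chi> x) (gen x)"
  by (simp add: diag.rep_eq free.lift_simps)

lemma diag_lmul: "diag \<chi> * lmul p = lmul (app (diag \<chi>) p) * diag \<chi>"
  by (rule op_eqI) (simp add: app_ops lmul.rep_eq diag_mult)

lemma diag_lmul_gen: "diag \<chi> * lmul (gen x) = op.scale (\<chi> x) (lmul (gen x) * diag \<chi>)"
  by (simp add: diag_lmul diag_gen lmul_simps op.scale_left)

lemma diag_diag: "diag \<chi> * diag \<chi>' = diag (\<lambda>x. \<chi> x * \<chi>' x)"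
proof (rule op_eqI)
  fix p
  show "app (diag \<chi> * diag \<chi>') p = app (diag (\<lambda>x. \<chi> x * \<chi>' x)) p"
    by (induction p rule: free_alg_induct)
      (simp_all add: app_ops app_add app_scale diag_one diag_mult diag_gen free.scale_left
        free.scale_scale mult.commute)
qed

lemma diag_const: "diag (\<lambda>x. 1) = 1"
proof (rule op_eqI)
  fix p
  show "app (diag (\<lambda>x. 1)) p = app 1 p"
    by (induction p rule: free_alg_induct)
      (simp_all add: app_ops app_add app_scale diag_one diag_mult diag_gen free.scale_one)
qed

section \<open>Root vectors\<close>

locale serre_family = scalar_ideal s N for s :: "'k::field \<Rightarrow> 'r::ring_1" and N +
  fixes q :: 'k and x :: "nat \<Rightarrow> 'r"
  assumes q_nonzero: "q \<noteq> 0" and q_square: "1 + q\<^sup>2 \<noteq> 0"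
    and serre_mem: "\<bar>int i - int j\<bar> = 1 \<Longrightarrow> serre (q + inverse q) (x i) (x j) \<in> N"
    and far_mem: "\<bar>int i - int j\<bar> \<ge> 2 \<Longrightarrow> x i * x j - x j * x i \<in> N"
begin

primrec root_chain :: "nat \<Rightarrow> nat \<Rightarrow> 'r"
  where
    "root_chain i 0 = x i"
  | "root_chain i (Suc m) = qbr q (x (i + Suc m)) (root_chain i m)"

text \<open>The root vector of \<open>\<alpha>\<^sub>i + \<dots> + \<alpha>\<^sub>j\<^sub>-\<^sub>1\<close>, for \<open>i < j\<close>.\<close>
definition z :: "nat \<Rightarrow> nat \<Rightarrow> 'r"
  where "z i j = root_chain i (j - Suc i)"

lemma z_simple: "z i (Suc i) = x i"
  by (simp add: z_def)

lemma z_Suc: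
  assumes "i < j"
  shows "z i (Suc j) = qbr q (x j) (z i j)"
proof -
  obtain d where "j = Suc (i + d)" using less_imp_Suc_add[OF assms] by blast
  then show ?thesis by (simp add: z_def)
qed

lemma qbr_one_far: "Suc i < j \<or> Suc j < i \<Longrightarrow> qbr 1 (x i) (x j) \<in> N"
  using far_mem[of i j] by (auto simp: qbr_def scale_one)

lemma z_commute:
  assumes "i < j" "\<And>k. i \<le> k \<Longrightarrow> k < j \<Longrightarrow> qbr 1 (x k) w \<in> N"
  shows "qbr 1 (z i j) w \<in> N"
proof -
  from assms(1) have "Suc i \<le> j" by simp
  then show ?thesis
    using assms(2)
  proof (induction rule: dec_induct)
    case base
    then show ?case by (simp add: z_simple)
  next
    case (step m)
    then have "qbr (1 * 1) (qbr q (x m) (z i m)) w \<in> N"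
      by (intro qbr_qbr_left) simp_all
    then show ?case using step by (simp add: z_Suc)
  qed
qed

text \<open>The letters of \<open>z i j\<close> are \<open>x i\<close>, ...,
  \<open>x (j - 1)\<close>; the condition keeps \<open>k\<close> at distance at least two from all
  of them.\<close>

lemma z_commute_x:
  assumes "i < j" "j < k \<or> Suc k < i"
  shows "qbr 1 (z i j) (x k) \<in> N"
  using assms by (intro z_commute) (auto intro: qbr_one_far)

lemma z_commute_disjoint:
  assumes "i < j" "j < l" "l < m"
  shows "qbr 1 (z i j) (z l m) \<in> N"
  using assms by (intro z_commute qbr_one_sym[OF z_commute_x]) auto

lemma z_split:
  assumes "i < j" "j < m"
  shows "z i m \<approx> qbr q (z j m) (z i j)"
proof -
  from assms(2) have "Suc j \<le> m" by simp
  then show ?thesis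
  proof (induction rule: dec_induct)
    case base
    show ?case using assms(1) by (simp add: z_simple z_Suc cong_refl)
  next
    case (step m)
    have "z i (Suc m) = qbr q (x m) (z i m)"
      using step assms by (simp add: z_Suc)
    also have "\<dots> \<approx> qbr q (x m) (qbr q (z j m) (z i j))"
      using step by (intro cong_qbr cong_refl)
    also have "\<dots> \<approx> qbr q (qbr q (x m) (z j m)) (z i j)"
      using step assms(1) by (intro qbr_assoc qbr_one_sym[OF z_commute_x]) auto
    also have "qbr q (x m) (z j m) = z j (Suc m)"
      using step by (simp add: z_Suc)
    finally show ?case .
  qed
qed

lemma z_split_cong: "i < j \<Longrightarrow> j < m \<Longrightarrow> qbr q (z j m) (z i j) \<approx> z i m"
  by (rule cong_sym[OF z_split])

lemma qbr_z_left:
  assumes "i < j" "j < m" "qbr c (z j m) w \<in> N" "qbr d (z i j) w \<in> N"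
  shows "qbr (c * d) (z i m) w \<in> N"
  by (rule qbr_mem_cong[OF qbr_qbr_left[OF assms(3,4)] z_split_cong[OF assms(1,2)] cong_refl])

lemma qbr_z_right:
  assumes "i < j" "j < m" "qbr c w (z j m) \<in> N" "qbr d w (z i j) \<in> N"
  shows "qbr (c * d) w (z i m) \<in> N"
  by (rule qbr_mem_cong[OF qbr_qbr_right[OF assms(3,4)] cong_refl z_split_cong[OF assms(1,2)]])

text \<open>For \<open>m = i + 2\<close> this is a Serre relation in the form
  \<open>qbr_qbr_serre\<close>. For larger \<open>m\<close>, split off \<open>z (i + 2) m\<close>,
  which commutes with \<open>x i\<close>. The mirror image is \<open>x_z_last\<close>.\<close>

lemma x_z_first:
  assumes "Suc i < m"
  shows "qbr q (x i) (z i m) \<in> N"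
proof -
  have base: "qbr q (x i) (z i (Suc (Suc i))) \<in> N"
    using serre_mem[of i "Suc i"] q_nonzero
    by (simp add: z_simple z_Suc qbr_qbr_serre scale_mem)
  show ?thesis
  proof (cases "m = Suc (Suc i)")
    case False
    with assms have m: "Suc (Suc i) < m" by simp
    then have "qbr (1 * q) (x i) (z i m) \<in> N"
      by (intro qbr_z_right[OF _ m] base qbr_one_sym[OF z_commute_x]) auto
    then show ?thesis by simp
  qed (use base in simp)
qed

lemma x_z_last:
  assumes "i < j"
  shows "qbr q (z i (Suc j)) (x j) \<in> N"
proof -
  have base: "qbr q (z l (Suc (Suc l))) (x (Suc l)) \<in> N" for l
    using serre_mem[of "Suc l" l] q_nonzero
    by (simp add: z_simple z_Suc qbr_qbr_serre scale_mem)
  show ?thesis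
  proof (cases "j = Suc i")
    case False
    with assms obtain l where l: "j = Suc l" "i < l" by (cases j) auto
    then have "qbr (q * 1) (z i (Suc j)) (x j) \<in> N"
      using base[of l] by (intro qbr_z_left[OF l(2)] z_commute_x) auto
    then show ?thesis by simp
  qed (use base in simp)
qed

text \<open>The essential case is the middle letter of a chain of three, settled by
  \<open>middle_root_commutes\<close>. The chain is then prolonged to the left and to the right by
  root vectors that commute with \<open>x l\<close>.\<close>

lemma x_z_inner:
  assumes "i < l" "Suc l < j"
  shows "qbr 1 (x l) (z i j) \<in> N"
proof -
  obtain k where k: "l = Suc k" "i \<le> k" using assms(1) by (cases l) auto
  have base: "qbr 1 (x l) (z k (Suc (Suc l))) \<in> N"
  proof -
    have "qbr 1 (x l) (qbr q (qbr q (x (Suc l)) (x l)) (x k)) \<in> N"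
      using k q_square q_nonzero serre_mem[of l "Suc l"] serre_mem[of l k]
      by (intro middle_root_commutes) (auto simp: qbr_qbr_serre scale_mem intro: qbr_one_far)
    moreover have "qbr q (qbr q (x (Suc l)) (x l)) (x k) \<approx> z k (Suc (Suc l))"
      using z_split_cong[of k l "Suc (Suc l)"] k by (simp add: z_simple z_Suc)
    ultimately show ?thesis by (rule qbr_mem_cong[OF _ cong_refl])
  qed
  have left: "qbr 1 (x l) (z i (Suc (Suc l))) \<in> N"
  proof (cases "i = k")
    case False
    with k have "i < k" by simp
    then have "qbr (1 * 1) (x l) (z i (Suc (Suc l))) \<in> N"
      using k by (intro qbr_z_right[OF \<open>i < k\<close>] base qbr_one_sym[OF z_commute_x]) auto
    then show ?thesis by simp
  qed (use base in simp)
  show ?thesis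
  proof (cases "j = Suc (Suc l)")
    case False
    with assms have j: "Suc (Suc l) < j" by simp
    with assms(1) have "qbr (1 * 1) (x l) (z i j) \<in> N"
      by (intro qbr_z_right[OF _ j] left qbr_one_sym[OF z_commute_x]) auto
    then show ?thesis by simp
  qed (use left in simp)
qed

lemma z_commute_nested:
  assumes "i < l" "l < m" "m < j"
  shows "qbr 1 (z l m) (z i j) \<in> N"
  using assms by (intro z_commute x_z_inner) auto

text \<open>Split \<open>z i j\<close> into \<open>z (Suc i) j\<close>, which is nested strictly
  inside \<open>z i m\<close> and contributes the factor 1, and \<open>x i\<close>, which
  contributes \<open>q\<close>.\<close>

lemma z_same_row:
  assumes "i < j" "j < m"
  shows "qbr q (z i j) (z i m) \<in> N"
proof (cases "j = Suc i")
  case True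
  then show ?thesis using x_z_first[of i m] assms by (simp add: z_simple)
next
  case False
  with assms have j: "Suc i < j" by simp
  have "qbr 1 (z (Suc i) j) (z i m) \<in> N"
    using j assms by (intro z_commute_nested) simp_all
  moreover have "qbr q (z i (Suc i)) (z i m) \<in> N"
    using j assms x_z_first[of i m] by (simp add: z_simple)
  ultimately show ?thesis
    using qbr_z_left[OF lessI j, of 1 "z i m" q] by simp
qed

lemma z_same_column:
  assumes "i < l" "l < j"
  shows "qbr q (z i j) (z l j) \<in> N"
proof -
  obtain k where k: "j = Suc k" "l \<le> k" using assms by (cases j) auto
  have x: "qbr q (z i j) (x k) \<in> N"
    using x_z_last[of i k] k assms by simp
  show ?thesis
  proof (cases "l = k")
    case True
    then show ?thesis using k x by (simp add: z_simple)
  next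
    case False
    with k have "l < k" by simp
    then have "qbr 1 (z i j) (z l k) \<in> N"
      using k assms by (intro qbr_one_sym[OF z_commute_nested]) simp_all
    from qbr_qbr_right[OF x this, of q] show ?thesis using k \<open>l < k\<close> by (simp add: z_Suc)
  qed
qed

text \<open>Splitting \<open>z i j\<close> and \<open>z i m\<close> at \<open>l\<close> expresses
  everything by \<open>z i l\<close>, \<open>z l j\<close> and \<open>z l m\<close>. The identity
  then follows from two known relations: \<open>z l j\<close> and \<open>z l m\<close> lie in the
  same row, and \<open>z l j\<close> is nested in \<open>z i m\<close>.\<close>

lemma z_crossing:
  assumes "i < l" "l < j" "j < m"
  shows "z i j * z l m - z l m * z i j \<approx> scale (q - inverse q) (z i m * z l j)"
proof -
  let ?D = "qbr q (z l m) (z i l)"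
  let ?P = "qbr q (z l j) (z i l)"
  note mem = z_same_row[OF assms(2,3)] z_commute_nested[OF assms] z_split[OF assms(1)]
  have D: "qbr 1 (z l j) ?D \<in> N"
    by (rule qbr_mem_cong[OF mem(2) cong_refl z_split]) (use assms in auto)
  have "?P * z l m - z l m * ?P - scale (q - inverse q) (?D * z l j) =
      scale (inverse q) (qbr q (z l j) (z l m) * z i l) - scale q (z i l * qbr q (z l j) (z l m))
      - scale (inverse q) (qbr 1 (z l j) ?D)"
    using q_nonzero by (simp add: qbr_def scale_expand algebra_simps)
  then have "?P * z l m - z l m * ?P \<approx> scale (q - inverse q) (?D * z l j)"
    using mem D by (simp add: cong_def ideal_intros)
  moreover have "z i j * z l m - z l m * z i j \<approx> ?P * z l m - z l m * ?P"
    using assms by (intro cong_diff cong_mult cong_refl z_split) auto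
  moreover have "scale (q - inverse q) (?D * z l j) \<approx> scale (q - inverse q) (z i m * z l j)"
    using assms by (intro cong_scale cong_mult cong_refl z_split_cong) auto
  ultimately show ?thesis
    using cong_trans by blast
qed

end

section \<open>The ideal of Serre relations\<close>

inductive_set ideal_gen :: "'r::ring_1 set \<Rightarrow> 'r set" for R
  where
    zero: "0 \<in> ideal_gen R"
  | gen: "r \<in> R \<Longrightarrow> a * r * b \<in> ideal_gen R"
  | add: "p \<in> ideal_gen R \<Longrightarrow> p' \<in> ideal_gen R \<Longrightarrow> p + p' \<in> ideal_gen R"

lemma ideal_gen_mem: "r \<in> R \<Longrightarrow> r \<in> ideal_gen R"
  using ideal_gen.gen[of r R 1 1] by simp

lemma (in central_scalars) ideal_gen_scalar_ideal: "scalar_ideal s (ideal_gen R)"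
proof unfold_locales
  fix a b assume a: "a \<in> ideal_gen R"
  then show "b * a \<in> ideal_gen R"
  proof induction
    case (gen r c d)
    then show ?case using ideal_gen.gen[of r R "b * c" d] by (simp add: mult.assoc)
  qed (simp_all add: distrib_left ideal_gen.zero ideal_gen.add)
  from a show "a * b \<in> ideal_gen R"
  proof induction
    case (gen r c d)
    then show ?case using ideal_gen.gen[of r R c "d * b"] by (simp add: mult.assoc)
  qed (simp_all add: distrib_right ideal_gen.zero ideal_gen.add)
qed (simp_all add: ideal_gen.zero ideal_gen.add)

lemma (in scalar_ideal) ideal_gen_subset: "R \<subseteq> N \<Longrightarrow> ideal_gen R \<subseteq> N"
proof
  fix p assume "R \<subseteq> N" "p \<in> ideal_gen R"
  from this(2,1) show "p \<in> N"
    by induction (auto intro: ideal_intros)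
qed

text \<open>
  The letters outside \<open>{1..n}\<close> are among the relators, so that the Serre relations hold
  modulo the ideal for all pairs of letters.
\<close>
definition serre_relators :: "nat \<Rightarrow> 'k::field \<Rightarrow> (nat, 'k) free_alg set"
  where "serre_relators n q =
      {free.serre (q + inverse q) (gen i) (gen j) | i j.
         i \<in> {1..n} \<and> j \<in> {1..n} \<and> \<bar>int i - int j\<bar> = 1}
    \<union> {gen i * gen j - gen j * gen i | i j.
         i \<in> {1..n} \<and> j \<in> {1..n} \<and> \<bar>int i - int j\<bar> \<ge> 2}
    \<union> {gen i | i. i \<notin> {1..n}}"

text \<open>\<open>q2\<close> makes \<open>q - inverse q\<close> invertible, and \<open>q4\<close>
  permits the division by \<open>1 + q\<^sup>2\<close> in \<open>middle_root_commutes\<close>. Both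
  follow from \<open>q\<close> not being a root of unity.\<close>

locale quantum_sl =
  fixes n :: nat and q :: "'k::field"
  assumes q0: "q \<noteq> 0" and q2: "q\<^sup>2 \<noteq> 1" and q4: "1 + q\<^sup>2 \<noteq> 0"
begin

definition J :: "(nat, 'k) free_alg set"
  where "J = ideal_gen (serre_relators n q)"

sublocale J: scalar_ideal scal J
  unfolding J_def by (rule free.ideal_gen_scalar_ideal)

lemma relator_mem: "r \<in> serre_relators n q \<Longrightarrow> r \<in> J"
  unfolding J_def by (rule ideal_gen_mem)

lemma outer_mem: "i \<notin> {1..n} \<Longrightarrow> gen i \<in> J"
  by (rule relator_mem) (auto simp: serre_relators_def)

sublocale J: serre_family scal J q gen
proof
  show "free.serre (q + inverse q) (gen i) (gen j) \<in> J" if "\<bar>int i - int j\<bar> = 1" for i j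
  proof (cases "i \<in> {1..n} \<and> j \<in> {1..n}")
    case True
    then show ?thesis
      using that by (intro relator_mem) (auto simp: serre_relators_def)
  next
    case False
    then have "gen i \<in> J \<or> gen j \<in> J" using outer_mem by blast
    then show ?thesis
      by (elim disjE) (simp_all add: free.serre_alt J.ideal_intros)
  qed
  show "gen i * gen j - gen j * gen i \<in> J" if "\<bar>int i - int j\<bar> \<ge> 2" for i j
  proof (cases "i \<in> {1..n} \<and> j \<in> {1..n}")
    case True
    then show ?thesis
      using that by (intro relator_mem) (auto simp: serre_relators_def)
  next
    case False
    then have "gen i \<in> J \<or> gen j \<in> J" using outer_mem by blast
    then show ?thesis
      by (elim disjE) (simp_all add: J.ideal_intros)
  qed
qed (fact q0 q4)+

section \<open>Operators that descend to the free algebra modulo \<open>J\<close>\<close>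

definition preserves_J :: "(nat, 'k) op \<Rightarrow> bool"
  where "preserves_J T \<longleftrightarrow> (\<forall>p\<in>J. app T p \<in> J)"

lemma preserves_J_intros:
  "preserves_J 0" "preserves_J 1" "preserves_J (lmul p)"
  "preserves_J S \<Longrightarrow> preserves_J T \<Longrightarrow> preserves_J (S + T)"
  "preserves_J S \<Longrightarrow> preserves_J T \<Longrightarrow> preserves_J (S - T)"
  "preserves_J S \<Longrightarrow> preserves_J T \<Longrightarrow> preserves_J (S * T)"
  "preserves_J S \<Longrightarrow> preserves_J (op.scale c S)"
  by (auto simp: preserves_J_def app_ops app_op_scale lmul.rep_eq intro: J.ideal_intros)

text \<open>Each relator is homogeneous in every letter, hence an eigenvector of any rescaling of
  the letters.\<close>

lemma relator_diag:
  assumes "r \<in> serre_relators n q"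
  shows "\<exists>c. app (diag \<chi>) r = free.scale c r"
proof -
  have serre: "app (diag \<chi>) (free.serre c (gen i) (gen j)) =
      free.scale (\<chi> i * \<chi> i * \<chi> j) (free.serre c (gen i) (gen j))" for c i j
    by (simp add: diag.rep_eq free.lift_simps) (simp add: free.serre_alt free.scale_expand mult_ac)
  have comm: "app (diag \<chi>) (gen i * gen j - gen j * gen i) =
      free.scale (\<chi> i * \<chi> j) (gen i * gen j - gen j * gen i)" for i j
    by (simp add: diag.rep_eq free.lift_simps) (simp add: free.scale_expand mult.commute)
  from assms show ?thesis
    unfolding serre_relators_def
    by (elim UnE CollectE exE conjE; hypsubst) (rule exI, rule serre comm diag_gen)+
qed

lemma preserves_J_diag: "preserves_J (diag \<chi>)"
  unfolding preserves_J_def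
proof
  fix p assume "p \<in> J"
  then show "app (diag \<chi>) p \<in> J"
    unfolding J_def
  proof induction
    case zero
    show ?case by (simp add: app_zero ideal_gen.zero)
  next
    case (gen r a b)
    obtain c where "app (diag \<chi>) r = free.scale c r" using relator_diag[OF gen] by blast
    then have "app (diag \<chi>) (a * r * b) =
        free.scale c (app (diag \<chi>) a) * r * app (diag \<chi>) b"
      by (simp add: diag_mult free.scale_expand)
    then show ?case using ideal_gen.gen[OF gen] by simp
  qed (simp add: app_add ideal_gen.add)
qed

text \<open>An element of \<open>J\<close> is a sum of terms \<open>a * r * b\<close>. By
  \<open>gens\<close>, \<open>T\<close> passes the letters of \<open>a\<close> one by one, and the
  corrections stay in \<open>J\<close>; by \<open>relators\<close>, it then passes
  \<open>r\<close>.\<close>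

lemma preserves_J_I:
  assumes relators: "\<And>r. r \<in> serre_relators n q \<Longrightarrow> T * lmul r = lmul r * T"
    and gens: "\<And>k. \<exists>S. preserves_J S \<and> T * lmul (gen k) = lmul (gen k) * T + S"
  shows "preserves_J T"
  unfolding preserves_J_def
proof
  fix p assume "p \<in> J"
  then show "app T p \<in> J"
    unfolding J_def
  proof induction
    case zero
    show ?case by (simp add: app_zero ideal_gen.zero)
  next
    case (gen r a b)
    have "app T (a * (r * b)) \<in> J"
    proof (induction a rule: free_alg_induct)
      case one
      have "app T (r * b) = r * app T b"
        using arg_cong[OF relators[OF gen], of "\<lambda>S. app S b"] by (simp add: app_ops lmul.rep_eq)
      then show ?case using relator_mem[OF gen] by (simp add: J.mult_right_mem)
    next
      case (gen k a)
      obtain S where S: "preserves_J S" "T * lmul (gen k) = lmul (gen k) * T + S"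
        using gens by blast
      have "app T (gen k * (a * (r * b))) =
          gen k * app T (a * (r * b)) + app S (a * (r * b))"
        using arg_cong[OF S(2), of "\<lambda>S. app S (a * (r * b))"] by (simp add: app_ops lmul.rep_eq)
      moreover have "a * (r * b) \<in> J"
        using relator_mem[OF \<open>r \<in> _\<close>] by (intro J.ideal_intros)
      ultimately show ?case
        using gen S(1) by (simp add: mult.assoc preserves_J_def J.ideal_intros)
    qed (simp_all add: distrib_right app_add J.add_mem free.scale_left app_scale J.scale_mem)
    then show ?case by (simp add: J_def mult.assoc)
  qed (simp add: app_add ideal_gen.add)
qed

lemma lift_preserves_J:
  assumes "\<And>x. preserves_J (\<phi> x)"
  shows "preserves_J (op.lift \<phi> P)"
  by (induction P rule: free_alg_induct)
    (simp_all add: op.lift_simps preserves_J_intros assms)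

definition annihilator :: "('x \<Rightarrow> (nat, 'k) op) \<Rightarrow> ('x, 'k) free_alg set"
  where "annihilator \<phi> = {P. \<forall>f. app (op.lift \<phi> P) f \<in> J}"

text \<open>Closure under multiplication from the left is the place where the operators have to
  preserve \<open>J\<close>.\<close>

lemma annihilator_scalar_ideal:
  assumes "\<And>x. preserves_J (\<phi> x)"
  shows "scalar_ideal scal (annihilator \<phi>)"
proof unfold_locales
  fix P Q assume P: "P \<in> annihilator \<phi>"
  show "Q * P \<in> annihilator \<phi>"
    using P lift_preserves_J[of \<phi> Q] assms
    by (simp add: annihilator_def op.lift_simps app_ops preserves_J_def)
  show "P * Q \<in> annihilator \<phi>"
    using P by (simp add: annihilator_def op.lift_simps app_ops)
qed (auto simp: annihilator_def op.lift_simps app_ops intro: J.ideal_intros)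

section \<open>The Verma module\<close>

definition chi :: "(nat \<Rightarrow> int) \<Rightarrow> nat \<Rightarrow> 'k"
  where "chi l k = q powi root_form n l (simple_root k)"

definition Kop :: "(nat \<Rightarrow> int) \<Rightarrow> (nat, 'k) op"
  where "Kop l = diag (chi l)"

text \<open>The two halves of the commutator of E_i and F_i are kept apart because they q-commute
  with the E_k and F_k by mutually inverse scalars.\<close>

definition Hplus :: "nat \<Rightarrow> (nat, 'k) op"
  where "Hplus i = op.scale (inverse (q - inverse q)) (Kop (simple_root i))"

definition Hminus :: "nat \<Rightarrow> (nat, 'k) op"
  where "Hminus i = op.scale (inverse (q - inverse q)) (Kop (\<lambda>t. - simple_root i t))"

text \<open>F_i on the Verma module generated by a vector that is killed by all F_i and fixed by all
  K: the commutation relation pushes F_i through the word towards that vector, which is represented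
  by the empty word.\<close>

primrec F_word :: "nat \<Rightarrow> nat list \<Rightarrow> (nat, 'k) free_alg"
  where
    "F_word i [] = 0"
  | "F_word i (k # ks) = gen k * F_word i ks -
      (if k = i then app (Hplus i - Hminus i) (Poly_Mapping.single (Word ks) 1) else 0)"

definition Fop :: "nat \<Rightarrow> (nat, 'k) op"
  where "Fop i = lin_op (F_word i)"

lemma Fop_one: "app (Fop i) 1 = 0"
  using free.linext_word[of "F_word i" "[]"]
  by (simp add: Fop_def lin_op.rep_eq single_Word_Nil)

lemma Fop_E:
  "Fop i * lmul (gen k) = lmul (gen k) * Fop i + (if k = i then Hminus i - Hplus i else 0)"
proof (rule op_eqI)
  fix p
  show "app (Fop i * lmul (gen k)) p =
      app (lmul (gen k) * Fop i + (if k = i then Hminus i - Hplus i else 0)) p"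
  proof (induction p rule: word_induct)
    case (word xs)
    show ?case
      by (simp add: app_ops lmul.rep_eq Fop_def lin_op.rep_eq free.linext_word
          flip: single_Word_Cons)
  qed (simp_all add: app_add app_scale free.scale_distrib)
qed

lemma root_form_add:
  "root_form n (\<lambda>i. l i + l' i) m = root_form n l m + root_form n l' m"
  by (simp add: root_form_def distrib_right sum.distrib)

lemma root_form_minus: "root_form n (\<lambda>i. - l i) m = - root_form n l m"
  by (simp add: root_form_def sum_negf)

lemma root_form_simple:
  assumes "i \<in> {1..n}" "k \<in> {1..n}"
  shows "root_form n (simple_root i) (simple_root k) = cartan i k"
proof -
  have "root_form n (simple_root i) (simple_root k) =
      (\<Sum>a=1..n. \<Sum>b=1..n. if a = i then (if b = k then cartan i k else 0) else 0)"
    unfolding root_form_def by (intro sum.cong refl) (simp add: simple_root_def)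
  also have "\<dots> = (\<Sum>a=1..n. if a = i then (\<Sum>b=1..n. if b = k then cartan i k else 0) else 0)"
    by (intro sum.cong refl) simp
  finally show ?thesis using assms by simp
qed

lemma chi_simple:
  assumes "i \<in> {1..n}" "k \<in> {1..n}"
  shows "chi (simple_root i) k = q powi cartan i k"
    and "chi (\<lambda>t. - simple_root i t) k = q powi (- cartan i k)"
  using assms by (simp_all add: chi_def root_form_minus root_form_simple)

lemma chi_nonzero: "chi l k \<noteq> 0"
  using q0 by (simp add: chi_def)

lemma Kop_zero: "Kop (\<lambda>_. 0) = 1"
  by (simp add: Kop_def chi_def[abs_def] root_form_def diag_const)

lemma Kop_add: "Kop l * Kop m = Kop (\<lambda>i. l i + m i)"
  using q0 by (simp add: Kop_def chi_def[abs_def] root_form_add diag_diag power_int_add)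

lemma Kop_E: "Kop l * lmul (gen k) = op.scale (chi l k) (lmul (gen k) * Kop l)"
  by (simp add: Kop_def diag_lmul_gen)

lemma Kop_F: "Kop l * Fop i = op.scale (inverse (chi l i)) (Fop i * Kop l)"
proof -
  let ?T = "Kop l * Fop i - op.scale (inverse (chi l i)) (Fop i * Kop l)"
  have comm: "Kop l * Kop m = Kop m * Kop l" for m
    by (simp add: Kop_add add.commute)
  have H: "Kop l * (Hminus i - Hplus i) = (Hminus i - Hplus i) * Kop l"
    by (simp add: Hminus_def Hplus_def op.scale_expand right_diff_distrib left_diff_distrib comm)
  have "?T = 0"
  proof (rule op_eq_zeroI)
    show "app ?T 1 = 0"
    by (simp add: app_zero app_ops app_op_scale Kop_def diag_one Fop_one free.scale_distrib)
    fix k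
    let ?H = "if k = i then Hminus i - Hplus i else 0"
    have 1: "Kop l * (Fop i * lmul (gen k)) =
        op.scale (chi l k) (lmul (gen k) * (Kop l * Fop i)) + Kop l * ?H"
      by (simp only: Fop_E distrib_left Kop_E op.scale_left flip: mult.assoc)
    have 2: "Fop i * (Kop l * lmul (gen k)) =
        op.scale (chi l k) (lmul (gen k) * (Fop i * Kop l) + ?H * Kop l)"
      by (simp only: Fop_E distrib_right Kop_E op.scale_right flip: mult.assoc)
    have "?T * lmul (gen k) = Kop l * (Fop i * lmul (gen k))
        - op.scale (inverse (chi l i)) (Fop i * (Kop l * lmul (gen k)))"
      by (simp add: left_diff_distrib op.scale_left mult.assoc)
    also have "\<dots> = op.scale (chi l k) (lmul (gen k) * ?T)
        + (Kop l * ?H - op.scale (inverse (chi l i) * chi l k) (?H * Kop l))"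
      unfolding 1 2 by (simp add: right_diff_distrib op.scale_expand mult.commute)
    \<comment> \<open>Only \<open>k = i\<close> matters, and there the two weights cancel.\<close>
    also have "Kop l * ?H - op.scale (inverse (chi l i) * chi l k) (?H * Kop l) = 0"
      using chi_nonzero[of l i] by (simp add: H op.scale_one op.scale_distrib)
    finally show "?T * lmul (gen k) = op.scale (chi l k) (lmul (gen k) * ?T)" by simp
  qed
  then show ?thesis by simp
qed

lemma H_E:
  "Hplus i * lmul (gen k) = op.scale (chi (simple_root i) k) (lmul (gen k) * Hplus i)"
  "Hminus i * lmul (gen k) = op.scale (chi (\<lambda>t. - simple_root i t) k) (lmul (gen k) * Hminus i)"
  by (simp_all add: Hplus_def Hminus_def op.scale_expand Kop_E mult.commute)

lemma H_F:
  "Hplus i * Fop k = op.scale (inverse (chi (simple_root i) k)) (Fop k * Hplus i)"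
  "Hminus i * Fop k = op.scale (inverse (chi (\<lambda>t. - simple_root i t) k)) (Fop k * Hminus i)"
  by (simp_all add: Hplus_def Hminus_def op.scale_expand Kop_F mult.commute)

lemma E_F:
  "lmul (gen k) * Fop i = Fop i * lmul (gen k) + (if k = i then Hplus i - Hminus i else 0)"
  by (simp add: Fop_E)

section \<open>Serre relations for the operators and stability of \<open>J\<close>\<close>

lemma cartan_values:
  "cartan i i = 2" "\<bar>int i - int j\<bar> = 1 \<Longrightarrow> cartan i j = - 1" "\<bar>int i - int j\<bar> \<ge> 2 \<Longrightarrow> cartan i j = 0"
  by (auto simp: cartan_def)

lemmas weights = chi_simple cartan_values power_int_minus

text \<open>The relations among the F_i hold on the free algebra itself, not merely modulo
  \<open>J\<close>: the expression kills 1 and commutes with left multiplication by every letter.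
  \<open>F_serre\<close> is proved in the same way.\<close>

lemma F_far:
  assumes "i \<in> {1..n}" "j \<in> {1..n}" "\<bar>int i - int j\<bar> \<ge> 2"
  shows "Fop i * Fop j - Fop j * Fop i = 0"
proof (rule op_eq_zeroI)
  show "app (Fop i * Fop j - Fop j * Fop i) 1 = 0"
    by (simp add: app_ops app_zero Fop_one)
  fix k
  have ji: "\<bar>int j - int i\<bar> \<ge> 2" and ne: "i \<noteq> j" using assms(3) by auto
  have wt: "Hplus i * Fop j = Fop j * Hplus i" "Hminus i * Fop j = Fop j * Hminus i"
    "Hplus j * Fop i = Fop i * Hplus j" "Hminus j * Fop i = Fop i * Hminus j"
    using assms ji by (simp_all add: H_F weights op.scale_one)
  consider "k = i" | "k = j" | "k \<noteq> i" "k \<noteq> j" by blast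
  then have "(Fop i * Fop j - Fop j * Fop i) * lmul (gen k) =
      lmul (gen k) * (Fop i * Fop j - Fop j * Fop i)"
  proof cases
    case 1
    then show ?thesis using ne wt
      by (intro op.commutator_commute[of _ _ "Hminus i" "Hplus i"]) (simp_all add: Fop_E)
  next
    case 2
    then have "(Fop j * Fop i - Fop i * Fop j) * lmul (gen k) =
        lmul (gen k) * (Fop j * Fop i - Fop i * Fop j)"
      using ne wt
      by (intro op.commutator_commute[of _ _ "Hminus j" "Hplus j"]) (simp_all add: Fop_E)
    then show ?thesis by (simp add: algebra_simps)
  next
    case 3
    then show ?thesis
      by (intro op.commutator_commute[of _ _ 0 0]) (simp_all add: Fop_E)
  qed
  then show "(Fop i * Fop j - Fop j * Fop i) * lmul (gen k) =
      op.scale 1 (lmul (gen k) * (Fop i * Fop j - Fop j * Fop i))"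
    by (simp add: op.scale_one)
qed

lemma F_serre:
  assumes "i \<in> {1..n}" "j \<in> {1..n}" "\<bar>int i - int j\<bar> = 1"
  shows "op.serre (q + inverse q) (Fop i) (Fop j) = 0"
proof (rule op_eq_zeroI)
  show "app (op.serre (q + inverse q) (Fop i) (Fop j)) 1 = 0"
    by (simp add: app_zero op.serre_alt app_ops app_op_scale Fop_one free.scale_distrib)
  fix k
  have ji: "\<bar>int j - int i\<bar> = 1" and ne: "i \<noteq> j" using assms(3) by auto
  consider "k = i" | "k = j" | "k \<noteq> i" "k \<noteq> j" by blast
  then have "op.serre (q + inverse q) (Fop i) (Fop j) * lmul (gen k) =
      lmul (gen k) * op.serre (q + inverse q) (Fop i) (Fop j)"
  proof cases
    \<comment> \<open>With F in the role of \<open>a\<close> and E in that of \<open>d\<close>, the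
      Cartan part changes sign, so \<open>Hminus\<close> takes the place of
      \<open>k\<close>.\<close>
    case 1
    then show ?thesis using ne assms ji
      by (intro op.serre_commute_first[of _ _ _ "Hminus i" "Hplus i"])
        (simp_all add: Fop_E H_F weights q0 power_inverse)
  next
    case 2
    then show ?thesis using ne assms ji
      by (intro op.serre_commute_second[of _ _ _ _ "Hminus j" "Hplus j"])
        (simp_all add: Fop_E H_F weights q0)
  next
    case 3
    then have "Fop i * lmul (gen k) = lmul (gen k) * Fop i" "Fop j * lmul (gen k) = lmul (gen k) * Fop j"
      by (simp_all add: Fop_E)
    then show ?thesis using q0
      by (intro op.serre_commute_first[of _ _ _ 0 0]) (simp_all add: op.scale_distrib)
  qed
  then show "op.serre (q + inverse q) (Fop i) (Fop j) * lmul (gen k) =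
      op.scale 1 (lmul (gen k) * op.serre (q + inverse q) (Fop i) (Fop j))"
    by (simp add: op.scale_one)
qed

lemma lmul_serre: "lmul (free.serre c p r) = op.serre c (lmul p) (lmul r)"
  by (simp add: free.serre_alt op.serre_alt lmul_simps)

text \<open>The counterpart of \<open>F_serre\<close> with E and F exchanged; it makes
  \<open>J\<close> stable under F_k. Letters outside \<open>{1..n}\<close> differ from
  \<open>k\<close> and commute with \<open>Fop k\<close> anyway.\<close>

lemma F_relator:
  assumes k: "k \<in> {1..n}" and r: "r \<in> serre_relators n q"
  shows "Fop k * lmul r = lmul r * Fop k"
proof -
  have serre: "op.serre (q + inverse q) (lmul (gen i)) (lmul (gen j)) * Fop k =
      Fop k * op.serre (q + inverse q) (lmul (gen i)) (lmul (gen j))"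
    if ij: "i \<in> {1..n}" "j \<in> {1..n}" "\<bar>int i - int j\<bar> = 1" for i j
  proof -
    have ji: "\<bar>int j - int i\<bar> = 1" and ne: "i \<noteq> j" using ij(3) by auto
    consider "k = i" | "k = j" | "k \<noteq> i" "k \<noteq> j" by blast
    then show ?thesis
    proof cases
      case 1
      then show ?thesis using ne ij ji
        by (intro op.serre_commute_first[of _ _ _ "Hplus i" "Hminus i"])
          (simp_all add: E_F H_E weights q0 power_inverse)
    next
      case 2
      then show ?thesis using ne ij ji
        by (intro op.serre_commute_second[of _ _ _ _ "Hplus j" "Hminus j"])
          (simp_all add: E_F H_E weights q0)
    next
      case 3
      then have "lmul (gen i) * Fop k = Fop k * lmul (gen i)" "lmul (gen j) * Fop k = Fop k * lmul (gen j)"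
        by (simp_all add: E_F)
      then show ?thesis using q0
        by (intro op.serre_commute_first[of _ _ _ 0 0]) (simp_all add: op.scale_distrib)
    qed
  qed
  have far: "(lmul (gen i) * lmul (gen j) - lmul (gen j) * lmul (gen i)) * Fop k =
      Fop k * (lmul (gen i) * lmul (gen j) - lmul (gen j) * lmul (gen i))"
    if ij: "i \<in> {1..n}" "j \<in> {1..n}" "\<bar>int i - int j\<bar> \<ge> 2" for i j
  proof -
    have ji: "\<bar>int j - int i\<bar> \<ge> 2" and ne: "i \<noteq> j" using ij(3) by auto
    have wt: "Hplus i * lmul (gen j) = lmul (gen j) * Hplus i"
      "Hminus i * lmul (gen j) = lmul (gen j) * Hminus i"
      "Hplus j * lmul (gen i) = lmul (gen i) * Hplus j"
      "Hminus j * lmul (gen i) = lmul (gen i) * Hminus j"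
      using ij ji by (simp_all add: H_E weights op.scale_one)
    consider "k = i" | "k = j" | "k \<noteq> i" "k \<noteq> j" by blast
    then show ?thesis
    proof cases
      case 1
      then show ?thesis using ne wt
        by (intro op.commutator_commute[of _ _ "Hplus i" "Hminus i"]) (simp_all add: E_F)
    next
      case 2
      then have "(lmul (gen j) * lmul (gen i) - lmul (gen i) * lmul (gen j)) * Fop k =
          Fop k * (lmul (gen j) * lmul (gen i) - lmul (gen i) * lmul (gen j))"
        using ne wt
        by (intro op.commutator_commute[of _ _ "Hplus j" "Hminus j"]) (simp_all add: E_F)
      then show ?thesis by (simp add: algebra_simps)
    next
      case 3
      then show ?thesis
        by (intro op.commutator_commute[of _ _ 0 0]) (simp_all add: E_F)
    qed
  qed
  have outer: "Fop k * lmul (gen i) = lmul (gen i) * Fop k" if "i \<notin> {1..n}" for i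
    using that k by (auto simp: Fop_E)
  from r serre far outer show ?thesis
    unfolding serre_relators_def by (auto simp: lmul_serre lmul_simps)
qed

lemma preserves_J_Fop:
  assumes "i \<in> {1..n}"
  shows "preserves_J (Fop i)"
proof (rule preserves_J_I)
  show "Fop i * lmul r = lmul r * Fop i" if "r \<in> serre_relators n q" for r
    using F_relator[OF assms that] .
  fix k
  have "preserves_J (if k = i then Hminus i - Hplus i else 0)"
    by (simp add: Hminus_def Hplus_def Kop_def preserves_J_intros preserves_J_diag)
  then show "\<exists>S. preserves_J S \<and> Fop i * lmul (gen k) = lmul (gen k) * Fop i + S"
    using Fop_E by blast
qed

text \<open>\<open>lift\<close> evaluates words in all letters of the type; the value 0 puts those
  that are not generators into the annihilator.\<close>

definition rep_U :: "U_gen \<Rightarrow> (nat, 'k) op"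
  where "rep_U g = (if g \<in> U_gens n
    then case g of K l \<Rightarrow> Kop l | E i \<Rightarrow> lmul (gen i) | F i \<Rightarrow> Fop i else 0)"

lemma rep_U_simps:
  "l \<in> root_lattice n \<Longrightarrow> rep_U (K l) = Kop l"
  "i \<in> {1..n} \<Longrightarrow> rep_U (E i) = lmul (gen i)"
  "i \<in> {1..n} \<Longrightarrow> rep_U (F i) = Fop i"
  by (simp_all add: rep_U_def U_gens_def)

lemma preserves_J_rep_U: "preserves_J (rep_U g)"
  by (auto simp: rep_U_def U_gens_def Kop_def preserves_J_intros preserves_J_diag preserves_J_Fop)

lemma annihilator_I:
  "op.lift \<phi> P = 0 \<Longrightarrow> P \<in> annihilator \<phi>" "op.lift \<phi> P = lmul p \<Longrightarrow> p \<in> J \<Longrightarrow> P \<in> annihilator \<phi>"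
  by (simp_all add: annihilator_def app_ops lmul.rep_eq J.ideal_intros)

text \<open>Only the relations among the E_i need \<open>J\<close>; all others are identities of
  operators on the free algebra.\<close>

lemma U_rels_annihilator: "U_rels n q \<subseteq> annihilator rep_U"
proof -
  note simps = op.lift_simps rep_U_simps
  have lattice: "(\<lambda>_. 0) \<in> root_lattice n"
    "l \<in> root_lattice n \<Longrightarrow> m \<in> root_lattice n \<Longrightarrow> (\<lambda>i. l i + m i) \<in> root_lattice n"
    "i \<in> {1..n} \<Longrightarrow> simple_root i \<in> root_lattice n"
    "i \<in> {1..n} \<Longrightarrow> (\<lambda>t. - simple_root i t) \<in> root_lattice n" for l m i
    by (auto simp: root_lattice_def simple_root_def)
  have 1: "fK (\<lambda>_. 0) - 1 \<in> annihilator rep_U"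
    by (intro annihilator_I(1)) (simp add: simps lattice Kop_zero)
  have 2: "fK l * fK m - fK (\<lambda>i. l i + m i) \<in> annihilator rep_U"
    if "l \<in> root_lattice n" "m \<in> root_lattice n" for l m
    using that by (intro annihilator_I(1)) (simp add: simps lattice Kop_add)
  have 3: "fK l * fE i - scal (q powi root_form n l (simple_root i)) * fE i * fK l \<in> annihilator rep_U"
    if "l \<in> root_lattice n" "i \<in> {1..n}" for l i
    using that by (intro annihilator_I(1))
      (simp add: simps Kop_E chi_def op.scale_def mult.assoc del: atLeastAtMost_iff)
  have 4: "fK l * fF i - scal (q powi (- root_form n l (simple_root i))) * fF i * fK l \<in> annihilator rep_U"
    if "l \<in> root_lattice n" "i \<in> {1..n}" for l i
    using that by (intro annihilator_I(1))
      (simp add: simps Kop_F chi_def op.scale_def mult.assoc power_int_minus del: atLeastAtMost_iff)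
  have 5: "fE i * fF j - fF j * fE i -
         (if i = j
          then scal (inverse (q - inverse q)) * (fK (simple_root i) - fK (\<lambda>t. - simple_root i t))
          else 0) \<in> annihilator rep_U" if "i \<in> {1..n}" "j \<in> {1..n}" for i j
    using that by (intro annihilator_I(1))
      (simp add: simps lattice E_F Hplus_def Hminus_def op.scale_def right_diff_distrib
        del: atLeastAtMost_iff)
  have 6: "fE i * fE j - fE j * fE i \<in> annihilator rep_U"
    if "i \<in> {1..n}" "j \<in> {1..n}" "\<bar>int i - int j\<bar> \<ge> 2" for i j
    using that by (intro annihilator_I(2)[OF _ J.far_mem])
      (simp_all add: simps lmul_simps del: atLeastAtMost_iff)
  have 7: "fF i * fF j - fF j * fF i \<in> annihilator rep_U"
    if "i \<in> {1..n}" "j \<in> {1..n}" "\<bar>int i - int j\<bar> \<ge> 2" for i j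
    using that by (intro annihilator_I(1)) (simp add: simps F_far del: atLeastAtMost_iff)
  have 8: "free.serre (q + inverse q) (fE i) (fE j) \<in> annihilator rep_U"
    if "i \<in> {1..n}" "j \<in> {1..n}" "\<bar>int i - int j\<bar> = 1" for i j
    using that by (intro annihilator_I(2)[OF _ J.serre_mem])
      (simp_all add: simps lmul_serre del: atLeastAtMost_iff)
  have 9: "free.serre (q + inverse q) (fF i) (fF j) \<in> annihilator rep_U"
    if "i \<in> {1..n}" "j \<in> {1..n}" "\<bar>int i - int j\<bar> = 1" for i j
    using that by (intro annihilator_I(1)) (simp add: simps F_serre del: atLeastAtMost_iff)
  show ?thesis
  proof
    fix P assume "P \<in> U_rels n q"
    then show "P \<in> annihilator rep_U"
      unfolding U_rels_def free.serre_def[symmetric]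
      by (elim UnE CollectE exE conjE insertE emptyE; hypsubst)
        (rule 1 | erule (1) 2 3 4 5 | erule (2) 6 7 8 9)+
  qed
qed

end

section \<open>The action of the quantized coordinate ring\<close>

lemma perm_length_id: "perm_length N id = 0"
  unfolding perm_length_def by (rule Least_eq_0) simp

lemma (in scalar_ideal) prod_list_mem: "x \<in> set xs \<Longrightarrow> x \<in> N \<Longrightarrow> prod_list xs \<in> N"
  by (induction xs) (auto intro: ideal_intros)

lemma (in scalar_ideal) sum_mem: "(\<And>x. x \<in> A \<Longrightarrow> f x \<in> N) \<Longrightarrow> sum f A \<in> N"
  by (induction A rule: infinite_finite_induct) (auto intro: ideal_intros)

text \<open>A permutation other than the identity has some \<open>i\<close> with
  \<open>\<sigma> i < i\<close>, so its monomial contains a factor below the diagonal.\<close>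

lemma det_triangular:
  fixes N :: "(nat \<times> nat, 'k::field) free_alg set"
  assumes "scalar_ideal scal N"
    and lower: "\<And>i j. i \<in> {1..n+1} \<Longrightarrow> j \<in> {1..n+1} \<Longrightarrow> j < i \<Longrightarrow> fX i j \<in> N"
  shows "(\<Sum>\<sigma> | \<sigma> permutes {1..n+1}.
      scal ((- q) ^ perm_length (n+1) \<sigma>) * prod_list (map (\<lambda>i. fX i (\<sigma> i)) [1..<n+2]))
    - prod_list (map (\<lambda>i. fX i i) [1..<n+2]) \<in> N"
proof -
  interpret scalar_ideal scal N by fact
  let ?t = "\<lambda>\<sigma>. scal ((- q) ^ perm_length (n+1) \<sigma>) * prod_list (map (\<lambda>i. fX i (\<sigma> i)) [1..<n+2])"
  let ?S = "{\<sigma>. \<sigma> permutes {1..n+1}}"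
  have "?t \<sigma> \<in> N" if "\<sigma> \<in> ?S - {id}" for \<sigma>
  proof -
    have \<sigma>: "\<sigma> permutes {1..n+1}" "\<sigma> \<noteq> id" using that by auto
    then obtain i where i: "i \<in> {1..n+1}" "\<sigma> i < i"
      using permutes_natset_ge[of \<sigma> "{1..n+1}"] by (meson not_le)
    moreover have "\<sigma> i \<in> {1..n+1}" using i(1) permutes_in_image[OF \<sigma>(1)] by blast
    ultimately have "fX i (\<sigma> i) \<in> N" using lower by blast
    with i show ?thesis
      by (intro mult_left_mem prod_list_mem[of "fX i (\<sigma> i)"]) (auto simp del: upt_Suc)
  qed
  then have "sum ?t (?S - {id}) \<in> N" by (rule sum_mem)
  moreover have "sum ?t ?S = ?t id + sum ?t (?S - {id})"
    by (rule sum.remove) (simp_all add: finite_permutations permutes_id)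
  moreover have "?t id = prod_list (map (\<lambda>i. fX i i) [1..<n+2])"
    by (simp add: perm_length_id scal_one del: upt_Suc)
  ultimately show ?thesis by simp
qed

text \<open>The product of all \<open>X\<^sub>l\<^sub>l\<close> but \<open>X\<^sub>j\<^sub>j\<close> represents \<open>X\<^sub>j\<^sub>j\<^sup>-\<^sup>1\<close>, by the determinant relation.\<close>
definition dinv :: "nat \<Rightarrow> nat \<Rightarrow> (nat \<times> nat, 'k::field) free_alg"
  where "dinv n j = prod_list (map (\<lambda>l. fX l l) (filter (\<lambda>l. l \<noteq> j) [1..<n+2]))"

context quantum_sl
begin

definition qhat :: 'k
  where "qhat = q - inverse q"

lemma qhat_nonzero: "qhat \<noteq> 0"
  using q0 q2 by (auto simp: qhat_def power2_eq_square field_simps)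

text \<open>
  \<open>diag (eps l)\<close> is conjugation by \<open>X\<^sub>l\<^sub>l\<close>, and \<open>weight l i j\<close> is its eigenvalue on the span
  of \<open>X\<^sub>i\<^sub>j\<close>.
\<close>
definition eps :: "nat \<Rightarrow> nat \<Rightarrow> 'k"
  where "eps l k = (if k \<in> {1..n}
    then (if l = k then q else 1) * (if l = Suc k then inverse q else 1) else 1)"

definition weight :: "nat \<Rightarrow> nat \<Rightarrow> nat \<Rightarrow> 'k"
  where "weight l i j = (if l = i then q else 1) * (if l = j then inverse q else 1)"

lemma app_diag_qbr: "app (diag \<chi>) (free.qbr c p r) = free.qbr c (app (diag \<chi>) p) (app (diag \<chi>) r)"
  by (simp add: diag.rep_eq free.lift_qbr)

text \<open>The weights telescope: for \<open>l = m\<close>, the factor \<open>inverse q\<close> of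
  \<open>z i m\<close> cancels the factor \<open>q\<close> of the next letter
  \<open>gen m\<close>.\<close>

lemma diag_eps_z:
  assumes "1 \<le> i" "i < j" "j \<le> n + 1"
  shows "app (diag (eps l)) (J.z i j) = free.scale (weight l i j) (J.z i j)"
proof -
  from assms(2) have "Suc i \<le> j" by simp
  then show ?thesis
    using assms(3)
  proof (induction rule: dec_induct)
    case base
    then show ?case using assms(1) by (simp add: J.z_simple diag_gen eps_def weight_def)
  next
    case (step m)
    then have "app (diag (eps l)) (J.z i (Suc m)) =
        free.qbr q (free.scale (eps l m) (gen m)) (free.scale (weight l i m) (J.z i m))"
      by (simp add: J.z_Suc app_diag_qbr diag_gen)
    also have "\<dots> = free.scale (eps l m * weight l i m) (J.z i (Suc m))"
      using step by (simp add: J.z_Suc free.qbr_def free.scale_expand mult.commute mult.left_commute)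
    also have "eps l m * weight l i m = weight l i (Suc m)"
      using step assms(1) q0 by (auto simp: eps_def weight_def)
    finally show ?case .
  qed
qed

text \<open>
  The cases \<open>i = j\<close> and \<open>i > j\<close> are chosen such that \<open>X\<^sub>i\<^sub>j\<close> always acts as \<open>diag (eps j)\<close>
  followed by left multiplication by \<open>y i j\<close>; the factor makes the relation between \<open>X\<^sub>i\<^sub>j\<close> and
  \<open>X\<^sub>j\<^sub>m\<close> agree with the recursion for root vectors.
\<close>
definition y :: "nat \<Rightarrow> nat \<Rightarrow> (nat, 'k) free_alg"
  where "y i j = (if i = j then 1 else if i < j then free.scale (- qhat) (J.z i j) else 0)"

definition rep_O :: "nat \<times> nat \<Rightarrow> (nat, 'k) op"
  where "rep_O = (\<lambda>(i, j). if (i, j) \<in> O_gens n then lmul (y i j) * diag (eps j) else 0)"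

lemma rep_O_simp:
  "i \<in> {1..n+1} \<Longrightarrow> j \<in> {1..n+1} \<Longrightarrow> rep_O (i, j) = lmul (y i j) * diag (eps j)"
  by (simp add: rep_O_def O_gens_def)

lemma preserves_J_rep_O: "preserves_J (rep_O g)"
  by (auto simp: rep_O_def preserves_J_intros preserves_J_diag split: prod.split)

sublocale annO: scalar_ideal scal "annihilator rep_O"
  by (rule annihilator_scalar_ideal[OF preserves_J_rep_O])

lemma diag_eps_y:
  assumes "i \<in> {1..n+1}" "j \<in> {1..n+1}"
  shows "diag (eps l) * lmul (y i j) = op.scale (weight l i j) (lmul (y i j) * diag (eps l))"
proof -
  have "app (diag (eps l)) (y i j) = free.scale (weight l i j) (y i j)"
    using assms q0
    by (auto simp: y_def diag_one app_zero app_scale diag_eps_z weight_def free.scale_expand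
        free.scale_scale free.scale_one mult.commute)
  then show ?thesis by (simp add: diag_lmul lmul_simps op.scale_left)
qed

lemma diag_commute: "diag \<chi> * diag \<chi>' = diag \<chi>' * diag \<chi>"
  by (simp add: diag_diag mult.commute)

lemma rep_O_mult:
  assumes "i \<in> {1..n+1}" "j \<in> {1..n+1}" "l \<in> {1..n+1}" "m \<in> {1..n+1}"
  shows "rep_O (i, j) * rep_O (l, m) =
    lmul (free.scale (weight j l m) (y i j * y l m)) * (diag (eps j) * diag (eps m))"
proof -
  have "rep_O (i, j) * rep_O (l, m) = lmul (y i j) * (diag (eps j) * lmul (y l m)) * diag (eps m)"
    using assms by (simp add: rep_O_simp mult.assoc)
  also have "\<dots> = op.scale (weight j l m)
      (lmul (y i j) * (lmul (y l m) * diag (eps j))) * diag (eps m)"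
    using assms by (simp only: diag_eps_y op.scale_right)
  finally show ?thesis
    by (simp add: lmul_simps op.scale_left mult.assoc)
qed

text \<open>All three products involve the same two columns, hence end in the same operator
  \<open>diag (eps j) * diag (eps m)\<close>. What remains in front is left multiplication by one
  element, and this element has to lie in \<open>J\<close>.\<close>

lemma exchange_mem:
  assumes ij: "i \<in> {1..n+1}" "j \<in> {1..n+1}" "l \<in> {1..n+1}" "m \<in> {1..n+1}"
    and mem: "free.scale (weight j l m) (y i j * y l m) - free.scale (c * weight m i j) (y l m * y i j)
      - free.scale (d * weight m l j) (y i m * y l j) \<in> J"
  shows "fX i j * fX l m - scal c * fX l m * fX i j - scal d * fX i m * fX l j \<in> annihilator rep_O"
proof -
  let ?R = "free.scale (weight j l m) (y i j * y l m) - free.scale (c * weight m i j) (y l m * y i j)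
      - free.scale (d * weight m l j) (y i m * y l j)"
  have "op.lift rep_O (fX i j * fX l m - scal c * fX l m * fX i j - scal d * fX i m * fX l j) =
      rep_O (i, j) * rep_O (l, m) - op.scale c (rep_O (l, m) * rep_O (i, j))
      - op.scale d (rep_O (i, m) * rep_O (l, j))"
    by (simp add: op.lift_simps op.scale_def mult.assoc)
  also have "\<dots> = lmul ?R * (diag (eps j) * diag (eps m))"
    using ij by (simp add: rep_O_mult lmul_simps op.scale_expand diag_commute[of "eps m"]
        left_diff_distrib)
  finally show ?thesis
    using mem by (simp add: annihilator_def app_ops lmul.rep_eq J.mult_right_mem)
qed

lemma exchange_mem_2:
  assumes ij: "i \<in> {1..n+1}" "j \<in> {1..n+1}" "l \<in> {1..n+1}" "m \<in> {1..n+1}"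
    and mem: "free.scale (weight j l m) (y i j * y l m) - free.scale (c * weight m i j) (y l m * y i j) \<in> J"
  shows "fX i j * fX l m - scal c * fX l m * fX i j \<in> annihilator rep_O"
  using exchange_mem[OF ij, of c 0] mem
  by (simp add: free.s_zero free.scale_def)

lemma y_scaled: "i < j \<Longrightarrow> y i j = free.scale (- qhat) (J.z i j)"
  by (simp add: y_def)

lemma y_qbr:
  assumes "i < j" "l < m" "free.qbr c (J.z i j) (J.z l m) \<in> J"
  shows "y i j * y l m - free.scale c (y l m * y i j) \<in> J"
proof -
  have "y i j * y l m - free.scale c (y l m * y i j) =
      free.scale (qhat * qhat) (free.qbr c (J.z i j) (J.z l m))"
    using assms by (simp add: y_scaled free.qbr_def free.scale_left free.scale_right
        free.scale_scale free.scale_distrib mult_ac)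
  with assms(3) show ?thesis by (simp add: J.scale_mem)
qed

section \<open>Relations of quantum matrices, by position relative to the diagonal\<close>

lemma O_row:
  assumes "i \<in> {1..n+1}" "j \<in> {1..n+1}" "m \<in> {1..n+1}" "j < m"
  shows "fX i j * fX i m - scal q * fX i m * fX i j \<in> annihilator rep_O"
proof (rule exchange_mem_2)
  consider "j < i" | "j = i" | "i < j" by linarith
  then show "free.scale (weight j i m) (y i j * y i m) - free.scale (q * weight m i j) (y i m * y i j) \<in> J"
  proof cases
    case 3
    then show ?thesis
      using assms y_qbr[OF 3 _ J.z_same_row[OF 3, of m]] by (simp add: weight_def free.scale_one)
  qed (use assms in \<open>auto simp: y_def weight_def free.scale_distrib J.zero_mem\<close>)
qed (use assms in auto)

lemma O_column:
  assumes "i \<in> {1..n+1}" "j \<in> {1..n+1}" "l \<in> {1..n+1}" "i < l"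
  shows "fX i j * fX l j - scal q * fX l j * fX i j \<in> annihilator rep_O"
proof (rule exchange_mem_2)
  consider "j < l" | "j = l" | "l < j" by linarith
  then show "free.scale (weight j l j) (y i j * y l j) - free.scale (q * weight j i j) (y l j * y i j) \<in> J"
  proof cases
    case 3
    then have "y i j * y l j - free.scale q (y l j * y i j) \<in> J"
      using assms by (intro y_qbr J.z_same_column) auto
    \<comment> \<open>Both weights equal \<open>inverse q\<close>, since both entries lie above the
      diagonal in the column \<open>j\<close> of the conjugating diagonal entry.\<close>
    from J.scale_mem[OF this, of "inverse q"] show ?thesis
      using assms 3 q0 by (simp add: weight_def free.scale_distrib free.scale_scale)
  qed (use assms q0 in \<open>auto simp: y_def weight_def free.scale_distrib free.scale_one J.zero_mem\<close>)
qed (use assms in auto)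

lemma O_commute:
  assumes "i \<in> {1..n+1}" "j \<in> {1..n+1}" "l \<in> {1..n+1}" "m \<in> {1..n+1}" "i < l" "m < j"
  shows "fX i j * fX l m - fX l m * fX i j \<in> annihilator rep_O"
proof -
  have "fX i j * fX l m - scal 1 * fX l m * fX i j \<in> annihilator rep_O"
  proof (rule exchange_mem_2)
    consider "m < l" | "m = l" | "l < m" by linarith
    then show "free.scale (weight j l m) (y i j * y l m) - free.scale (1 * weight m i j) (y l m * y i j) \<in> J"
    proof cases
      case 3
      then have "y i j * y l m - free.scale 1 (y l m * y i j) \<in> J"
        using assms by (intro y_qbr J.qbr_one_sym[OF J.z_commute_nested]) auto
      then show ?thesis
        using assms 3 by (simp add: weight_def free.scale_one)
    qed (use assms in \<open>auto simp: y_def weight_def free.scale_distrib free.scale_one J.zero_mem\<close>)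
  qed (use assms in auto)
  then show ?thesis by (simp add: scal_one)
qed

lemma O_exchange:
  assumes ij: "i \<in> {1..n+1}" "j \<in> {1..n+1}" "l \<in> {1..n+1}" "m \<in> {1..n+1}" and lt: "i < l" "j < m"
  shows "fX i j * fX l m - fX l m * fX i j - scal (q - inverse q) * fX i m * fX l j \<in> annihilator rep_O"
proof -
  have "free.scale (weight j l m) (y i j * y l m) - free.scale (1 * weight m i j) (y l m * y i j)
      - free.scale (qhat * weight m l j) (y i m * y l j) \<in> J"
  proof (cases "i \<le> j \<and> l \<le> m")
    \<comment> \<open>If \<open>i > j\<close> or \<open>l > m\<close>, then also
      \<open>l > j\<close>, so each of the three products has a factor below the diagonal.\<close>
    case False
    then show ?thesis using lt by (auto simp: y_def free.scale_distrib J.zero_mem)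
  next
    case le: True
    then have "(j < l \<and> (i = j \<or> l = m)) \<or> (i < j \<and> j < l \<and> l < m) \<or> j = l \<or> l < j"
      by auto
    then consider "j < l" "i = j \<or> l = m" | "i < j" "j < l" "l < m" | "j = l" | "l < j"
      by blast
    then show ?thesis
    proof cases
      case 1
      then show ?thesis
        using lt le by (auto simp: y_def weight_def free.scale_distrib free.scale_one J.zero_mem)
    next
      case 2
      then have "y i j * y l m - free.scale 1 (y l m * y i j) \<in> J"
        by (intro y_qbr J.z_commute_disjoint) auto
      with 2 lt show ?thesis
        by (simp add: weight_def free.scale_one) (simp add: y_def free.scale_distrib)
    next
      \<comment> \<open>Here \<open>y l j = 1\<close>, and the relation becomes the splitting of
        \<open>z i m\<close> at \<open>j\<close>. With \<open>y\<close> equal to e times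
        \<open>z\<close>, comparison of both sides gives - e^2 = qhat * e, the origin of the factor
        \<open>- qhat\<close>.\<close>
      case 3
      then have "J.z i m - free.qbr q (J.z j m) (J.z i j) \<in> J"
        using lt J.z_split[of i j m] by (simp add: J.cong_def)
      from J.scale_mem[OF this, of "qhat * qhat"] show ?thesis
        using 3 lt by (simp add: weight_def y_def free.qbr_def)
          (simp add: free.scale_left free.scale_right free.scale_scale free.scale_distrib
            free.scale_one free.scale_minus algebra_simps)
    next
      case 4
      then have "J.z i j * J.z l m - J.z l m * J.z i j - free.scale qhat (J.z i m * J.z l j) \<in> J"
        using lt J.z_crossing[of i l j m] by (simp add: J.cong_def qhat_def)
      from J.scale_mem[OF this, of "qhat * qhat"] show ?thesis
        using 4 lt by (simp add: weight_def y_def free.scale_left free.scale_right free.scale_scale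
            free.scale_distrib mult_ac)
    qed
  qed
  from exchange_mem[OF ij this] show ?thesis by (simp add: scal_one qhat_def)
qed

lemma O_lower:
  assumes "i \<in> {1..n+1}" "j \<in> {1..n+1}" "j < i"
  shows "fX i j \<in> annihilator rep_O"
  using assms by (simp add: annihilator_def op.lift_simps rep_O_simp y_def app_ops lmul.rep_eq J.zero_mem)

lemma prod_list_diag:
  "prod_list (map (\<lambda>l. diag (\<chi> l)) ls) = diag (\<lambda>k. prod_list (map (\<lambda>l. \<chi> l k) ls))"
  by (induction ls) (simp_all add: diag_const diag_diag)

lemma rep_O_diagonal:
  assumes "set ls \<subseteq> {1..n+1}" "distinct ls"
  shows "op.lift rep_O (prod_list (map (\<lambda>l. fX l l) ls)) = diag (\<lambda>k. \<Prod>l\<in>set ls. eps l k)"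
proof -
  have lift: "map (op.lift rep_O) (map (\<lambda>l. fX l l) ls) = map (\<lambda>l. diag (eps l)) ls"
    using assms(1) by (auto simp: op.lift_simps rep_O_simp y_def lmul_simps)
  show ?thesis
    unfolding op.lift_prod_list lift prod_list_diag
    using assms(2) by (simp add: prod.distinct_set_conv_list)
qed

text \<open>The factors at \<open>l = k\<close> and \<open>l = Suc k\<close> cancel. For
  \<open>k = 0\<close> and \<open>k = n + 1\<close> only one of them would occur, which is why
  \<open>eps\<close> is 1 on letters outside \<open>{1..n}\<close>.\<close>

lemma prod_eps: "(\<Prod>l\<in>{1..n+1}. eps l k) = 1"
proof (cases "k \<in> {1..n}")
  case True
  then show ?thesis
    using q0 by (simp add: eps_def prod.distrib)
next
  case False
  then have "eps l k = 1" for l unfolding eps_def by (rule if_not_P)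
  then show ?thesis by simp
qed

lemma O_rels_annihilator: "O_SL_rels n q \<subseteq> annihilator rep_O"
proof -
  have "prod_list (map (\<lambda>i. fX i i) [1..<n+2]) - 1 \<in> annihilator rep_O"
  proof (rule annihilator_I(1))
    have "set [1..<n+2] = {1..n+1}" by auto
    then have "op.lift rep_O (prod_list (map (\<lambda>i. fX i i) [1..<n+2])) = diag (\<lambda>k. 1)"
      using rep_O_diagonal[of "[1..<n+2]"] by (simp only: prod_eps distinct_upt simp_thms subset_refl)
    then show "op.lift rep_O (prod_list (map (\<lambda>i. fX i i) [1..<n+2]) - 1) = 0"
      by (simp add: op.lift_diff op.lift_one diag_const del: upt_Suc)
  qed
  from annO.add_mem[OF det_triangular[OF annO.scalar_ideal_axioms, of n q] this] O_lower
  have det: "(\<Sum>\<sigma> | \<sigma> permutes {1..n+1}.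
      scal ((- q) ^ perm_length (n+1) \<sigma>) * prod_list (map (\<lambda>i. fX i (\<sigma> i)) [1..<n+2])) - 1
      \<in> annihilator rep_O"
    by (simp del: upt_Suc)
  show ?thesis
  proof
    fix P assume "P \<in> O_SL_rels n q"
    then show "P \<in> annihilator rep_O"
      unfolding O_SL_rels_def
      by (elim UnE CollectE exE conjE insertE emptyE; hypsubst)
        (rule det | rule O_row O_column O_commute O_exchange; assumption)+
  qed
qed

lemma diag_dinv:
  assumes "j \<in> {1..n+1}"
  shows "diag (eps j) * op.lift rep_O (dinv n j) = 1"
proof -
  have set: "set (filter (\<lambda>l. l \<noteq> j) [1..<n+2]) = {1..n+1} - {j}" by auto
  have "op.lift rep_O (dinv n j) = diag (\<lambda>k. \<Prod>l\<in>{1..n+1} - {j}. eps l k)"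
    unfolding dinv_def by (subst rep_O_diagonal) (auto simp only: set distinct_upt distinct_filter)
  moreover have "eps j k * (\<Prod>l\<in>{1..n+1} - {j}. eps l k) = 1" for k
    using prod.remove[of "{1..n+1}" j "\<lambda>l. eps l k"] assms prod_eps[of k] by simp
  ultimately show ?thesis by (simp add: diag_diag diag_const)
qed

section \<open>The two images of the free algebra\<close>

text \<open>Both substitutions \<open>sub_U\<close> and \<open>sub_O\<close> kill the letters
  outside \<open>{1..n}\<close>, so the operators see an element only through its restriction;
  modulo \<open>J\<close> nothing is lost.\<close>

definition restrict :: "(nat, 'k) free_alg \<Rightarrow> (nat, 'k) free_alg"
  where "restrict = free.lift (\<lambda>i. if i \<in> {1..n} then gen i else 0)"

definition sub_U :: "(nat, 'k) free_alg \<Rightarrow> (U_gen, 'k) free_alg"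
  where "sub_U = free.lift (\<lambda>i. if i \<in> {1..n} then fE i else 0)"

definition sub_O :: "(nat, 'k) free_alg \<Rightarrow> (nat \<times> nat, 'k) free_alg"
  where "sub_O = free.lift (\<lambda>i. if i \<in> {1..n}
    then free.scale (- inverse qhat) (fX i (i+1) * dinv n (i+1)) else 0)"

lemma restrict_cong: "J.cong (restrict p) p"
proof (induction p rule: free_alg_induct)
  case (gen x p)
  have "J.cong (restrict (gen x)) (gen x)"
    using outer_mem[of x] J.minus_mem[of "gen x"]
    by (auto simp: restrict_def free.lift_gen J.cong_def J.zero_mem)
  from J.cong_mult[OF this gen] show ?case by (simp add: restrict_def free.lift_simps)
qed (auto simp: restrict_def free.lift_simps intro: J.cong_refl J.cong_add J.cong_scale)

lemma rep_U_sub_U: "op.lift rep_U (sub_U p) = lmul (restrict p)"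
  by (induction p rule: free_alg_induct)
    (simp_all add: sub_U_def restrict_def free.lift_simps op.lift_simps lmul_simps rep_U_simps
      lmul_zero del: atLeastAtMost_iff)

lemma rep_O_sub_O: "op.lift rep_O (sub_O p) = lmul (restrict p)"
proof (induction p rule: free_alg_induct)
  case (gen x p)
  have "op.lift rep_O (sub_O (gen x)) = lmul (restrict (gen x))"
  proof (cases "x \<in> {1..n}")
    case True
    then have x: "x \<in> {1..n+1}" "x + 1 \<in> {1..n+1}" by auto
    \<comment> \<open>The diagonal part of the entry in column \<open>x + 1\<close> cancels against
      \<open>dinv n (x + 1)\<close>, and \<open>- inverse qhat\<close> against the factor in
      \<open>y\<close>.\<close>
    have "op.lift rep_O (sub_O (gen x)) = op.scale (- inverse qhat)
        (lmul (y x (x+1)) * (diag (eps (x+1)) * op.lift rep_O (dinv n (x+1))))"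
      using True x by (simp add: sub_O_def free.lift_gen op.lift_simps rep_O_simp mult.assoc del: atLeastAtMost_iff)
    also have "\<dots> = lmul (gen x)"
      unfolding diag_dinv[OF x(2)] using qhat_nonzero
      by (simp add: y_def J.z_simple lmul_simps op.scale_scale op.scale_one)
    finally show ?thesis using True by (simp add: restrict_def free.lift_gen)
  qed (simp add: sub_O_def restrict_def free.lift_gen op.lift_zero lmul_zero del: atLeastAtMost_iff)
  with gen show ?case by (simp add: sub_O_def restrict_def free.lift_simps op.lift_simps lmul_simps)
qed (simp_all add: sub_O_def restrict_def free.lift_simps op.lift_simps lmul_simps)

lemma annihilator_restrict:
  assumes "op.lift \<phi> P = lmul (restrict p)" "P \<in> annihilator \<phi>"
  shows "p \<in> J"
proof -
  have "app (lmul (restrict p)) 1 \<in> J" using assms by (simp add: annihilator_def)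
  then show ?thesis using J.cong_mem[OF restrict_cong] by (simp add: lmul.rep_eq)
qed

lemmas sub_U_annihilator = annihilator_restrict[OF rep_U_sub_U]
lemmas sub_O_annihilator = annihilator_restrict[OF rep_O_sub_O]

end

section \<open>Serre relations in the quantized coordinate ring\<close>

text \<open>To be instantiated with the kernel of the map from the free algebra on the X_ij onto
  O_q(B^+), so that the relations there become congruences in the free algebra.\<close>

locale borel_ideal = quantum_sl n q + scalar_ideal scal N
  for n :: nat and q :: "'k::field" and N :: "(nat \<times> nat, 'k) free_alg set" +
  assumes O_rels: "O_SL_rels n q \<subseteq> N"
    and lower: "i \<in> {1..n+1} \<Longrightarrow> j \<in> {1..n+1} \<Longrightarrow> j < i \<Longrightarrow> fX i j \<in> N"
begin

lemma row:
  assumes "i \<in> {1..n+1}" "j \<in> {1..n+1}" "m \<in> {1..n+1}" "j < m"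
  shows "free.qbr q (fX i j) (fX i m) \<in> N"
proof -
  have "fX i j * fX i m - scal q * fX i m * fX i j \<in> O_SL_rels n q"
    unfolding O_SL_rels_def using assms by blast
  then show ?thesis using O_rels by (auto simp: free.qbr_def free.scale_def mult.assoc)
qed

lemma column:
  assumes "i \<in> {1..n+1}" "j \<in> {1..n+1}" "l \<in> {1..n+1}" "i < l"
  shows "free.qbr q (fX i j) (fX l j) \<in> N"
proof -
  have "fX i j * fX l j - scal q * fX l j * fX i j \<in> O_SL_rels n q"
    unfolding O_SL_rels_def using assms by blast
  then show ?thesis using O_rels by (auto simp: free.qbr_def free.scale_def mult.assoc)
qed

lemma commute:
  assumes "i \<in> {1..n+1}" "j \<in> {1..n+1}" "l \<in> {1..n+1}" "m \<in> {1..n+1}" "i < l" "m < j"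
  shows "free.qbr 1 (fX i j) (fX l m) \<in> N"
proof -
  have "fX i j * fX l m - fX l m * fX i j \<in> O_SL_rels n q"
    unfolding O_SL_rels_def using assms by blast
  then show ?thesis using O_rels by (auto simp: free.qbr_def free.scale_one)
qed

lemma exchange:
  assumes "i \<in> {1..n+1}" "j \<in> {1..n+1}" "l \<in> {1..n+1}" "m \<in> {1..n+1}" "i < l" "j < m"
  shows "fX i j * fX l m - fX l m * fX i j - free.scale qhat (fX i m * fX l j) \<in> N"
proof -
  have "fX i j * fX l m - fX l m * fX i j - scal (q - inverse q) * fX i m * fX l j \<in> O_SL_rels n q"
    unfolding O_SL_rels_def using assms by blast
  then show ?thesis using O_rels by (auto simp: qhat_def free.scale_def mult.assoc)
qed

text \<open>The correction term of the exchange relation has a factor below the diagonal.\<close>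

lemma exchange_lower:
  assumes ij: "i \<in> {1..n+1}" "j \<in> {1..n+1}" "l \<in> {1..n+1}" "m \<in> {1..n+1}" "i < l" "j < m"
    and "m < i \<or> j < l"
  shows "free.qbr 1 (fX i j) (fX l m) \<in> N"
proof -
  have "fX i m * fX l j \<in> N"
    using assms lower[of i m] lower[of l j] by (auto intro: ideal_intros)
  from add_mem[OF exchange[OF ij] scale_mem[OF this, of qhat]] show ?thesis
    by (simp add: free.qbr_def free.scale_one)
qed

lemma diagonal_commute:
  assumes "i \<in> {1..n+1}" "j \<in> {1..n+1}"
  shows "free.qbr 1 (fX i i) (fX j j) \<in> N"
proof -
  consider "i < j" | "i = j" | "j < i" by linarith
  then show ?thesis
  proof cases
    case 2
    then show ?thesis by (simp add: free.qbr_def free.scale_one zero_mem)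
  qed (use assms in \<open>auto intro: exchange_lower qbr_one_sym[OF exchange_lower]\<close>)
qed

lemma qbr_prod_list:
  assumes "\<And>l. l \<in> set ls \<Longrightarrow> free.qbr 1 w (f l) \<in> N"
  shows "free.qbr 1 w (prod_list (map f ls)) \<in> N"
  using assms
proof (induction ls)
  case Nil
  then show ?case by (simp add: free.qbr_def free.scale_one zero_mem)
next
  case (Cons l ls)
  then show ?case using qbr_mult_right[of 1 w "f l" 1] by simp
qed

lemma diagonal_dinv:
  assumes "i \<in> {1..n+1}"
  shows "free.qbr 1 (fX i i) (dinv n j) \<in> N"
  unfolding dinv_def using assms by (intro qbr_prod_list diagonal_commute) (auto simp del: upt_Suc)

lemma dinv_commute: "free.qbr 1 (dinv n i) (dinv n j) \<in> N"
proof (rule qbr_one_sym)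
  show "free.qbr 1 (dinv n j) (dinv n i) \<in> N"
    unfolding dinv_def[of n i]
    by (intro qbr_prod_list qbr_one_sym[OF diagonal_dinv]) (auto simp del: upt_Suc)
qed

lemma det: "prod_list (map (\<lambda>i. fX i i) [1..<n+2]) \<approx> 1"
proof -
  have "(\<Sum>\<sigma> | \<sigma> permutes {1..n+1}.
      scal ((- q) ^ perm_length (n+1) \<sigma>) * prod_list (map (\<lambda>i. fX i (\<sigma> i)) [1..<n+2])) - 1
      \<in> O_SL_rels n q"
    unfolding O_SL_rels_def by blast
  with O_rels have "(\<Sum>\<sigma> | \<sigma> permutes {1..n+1}.
      scal ((- q) ^ perm_length (n+1) \<sigma>) * prod_list (map (\<lambda>i. fX i (\<sigma> i)) [1..<n+2])) - 1 \<in> N"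
    by (rule subsetD)
  from diff_mem[OF this det_triangular[OF scalar_ideal_axioms lower, of n q]]
  show ?thesis by (simp add: cong_def del: upt_Suc)
qed

lemma diagonal_prod_split:
  assumes "j \<in> set ls" "distinct ls" "set ls \<subseteq> {1..n+1}"
  shows "prod_list (map (\<lambda>l. fX l l) ls)
    \<approx> fX j j * prod_list (map (\<lambda>l. fX l l) (filter (\<lambda>l. l \<noteq> j) ls))"
  using assms
proof (induction ls)
  case (Cons l ls)
  show ?case
  proof (cases "l = j")
    case True
    with Cons have "filter (\<lambda>l. l \<noteq> j) ls = ls" by (auto simp: filter_id_conv)
    with True show ?thesis by (simp add: cong_refl)
  next
    case False
    let ?r = "prod_list (map (\<lambda>l. fX l l) (filter (\<lambda>l. l \<noteq> j) ls))"
    have "fX l l * prod_list (map (\<lambda>l. fX l l) ls) \<approx> fX l l * (fX j j * ?r)"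
      using Cons False by (intro cong_mult cong_refl) auto
    also have "fX l l * (fX j j * ?r) = (fX l l * fX j j) * ?r"
      by (simp add: mult.assoc)
    also have "\<dots> \<approx> (fX j j * fX l l) * ?r"
    proof (rule cong_mult[OF _ cong_refl])
      show "fX l l * fX j j \<approx> fX j j * fX l l"
        using Cons diagonal_commute[of l j] by (auto simp: cong_def free.qbr_def free.scale_one)
    qed
    finally show ?thesis using False by (simp add: mult.assoc)
  qed
qed simp

lemma diagonal_inverse:
  assumes "j \<in> {1..n+1}"
  shows "fX j j * dinv n j \<approx> 1" "dinv n j * fX j j \<approx> 1"
proof -
  have "fX j j * dinv n j \<approx> prod_list (map (\<lambda>l. fX l l) [1..<n+2])"
    unfolding dinv_def using assms by (intro cong_sym[OF diagonal_prod_split]) auto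
  then show 1: "fX j j * dinv n j \<approx> 1" using cong_trans det by blast
  have "fX j j * dinv n j \<approx> dinv n j * fX j j"
    using diagonal_dinv[OF assms, of j] by (simp add: cong_def free.qbr_def free.scale_one)
  then show "dinv n j * fX j j \<approx> 1" using 1 cong_sym cong_trans by blast
qed

section \<open>Conjugation by diagonal entries\<close>

lemma diagonal_weight:
  assumes "i \<in> {1..n+1}" "j \<in> {1..n+1}" "l \<in> {1..n+1}" "i < j"
  shows "free.qbr (weight l i j) (fX l l) (fX i j) \<in> N"
proof -
  consider "l < i" | "l = i" | "i < l" "l < j" | "l = j" | "j < l" using assms(4) by linarith
  then show ?thesis
  proof cases
    case 1
    with assms show ?thesis
      using exchange_lower[of l l i j] by (simp add: weight_def)
  next
    case 2
    with assms show ?thesis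
      using row[of i i j] by (simp add: weight_def)
  next
    case 3
    with assms show ?thesis
      using qbr_one_sym[OF commute[of i j l l]] by (simp add: weight_def)
  next
    case 4
    with assms show ?thesis
      using qbr_swap[OF column[of i j j] q0] by (simp add: weight_def)
  next
    case 5
    with assms show ?thesis
      using qbr_one_sym[OF exchange_lower[of i j l l]] by (simp add: weight_def)
  qed
qed

lemma weight_nonzero: "weight l i j \<noteq> 0"
  using q0 by (simp add: weight_def)

lemma dinv_weight:
  assumes "i \<in> {1..n+1}" "j \<in> {1..n+1}" "l \<in> {1..n+1}" "i < j"
  shows "dinv n l * fX i j \<approx> free.scale (inverse (weight l i j)) (fX i j * dinv n l)"
proof -
  let ?w = "weight l i j"
  let ?D = "dinv n l"
  \<comment> \<open>Inserting \<open>fX l l * ?D\<close>, which is 1 modulo \<open>N\<close>,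
    reduces the claim to the known weight of \<open>fX l l\<close>.\<close>
  have "?D * fX i j \<approx> ?D * fX i j * (fX l l * ?D)"
    using cong_mult[OF cong_refl cong_sym[OF diagonal_inverse(1)[OF assms(3)]], of "?D * fX i j"]
    by simp
  also have "?D * fX i j * (fX l l * ?D) = ?D * (fX i j * fX l l) * ?D"
    by (simp add: mult.assoc)
  also have "\<dots> \<approx> ?D * free.scale (inverse ?w) (fX l l * fX i j) * ?D"
    using qbr_swap[OF diagonal_weight[OF assms] weight_nonzero]
    by (intro cong_mult cong_refl) (simp add: qbr_cong)
  also have "\<dots> = free.scale (inverse ?w) ((?D * fX l l) * (fX i j * ?D))"
    by (simp add: free.scale_expand mult.assoc)
  also have "\<dots> \<approx> free.scale (inverse ?w) (1 * (fX i j * ?D))"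
    using assms by (intro cong_scale cong_mult cong_refl diagonal_inverse)
  finally show ?thesis by simp
qed

section \<open>The generators X_ij X_jj^-1 and their relations\<close>

definition Y :: "nat \<Rightarrow> nat \<Rightarrow> (nat \<times> nat, 'k) free_alg"
  where "Y i j = fX i j * dinv n j"

lemma Y_mult:
  assumes "i \<in> {1..n+1}" "j \<in> {1..n+1}" "l \<in> {1..n+1}" "m \<in> {1..n+1}" "l < m"
  shows "Y i j * Y l m \<approx> free.scale (inverse (weight j l m)) (fX i j * fX l m * (dinv n j * dinv n m))"
proof -
  have "Y i j * Y l m = fX i j * (dinv n j * fX l m) * dinv n m"
    by (simp add: Y_def mult.assoc)
  also have "\<dots> \<approx> fX i j * free.scale (inverse (weight j l m)) (fX l m * dinv n j) * dinv n m"
    using assms by (intro cong_mult cong_refl dinv_weight)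
  finally show ?thesis by (simp add: free.scale_expand mult.assoc)
qed

text \<open>Both orders of the product are brought to the same tail
  \<open>dinv n j * dinv n m\<close>, so that only the entries remain to be compared.\<close>

lemma Y_mult_swapped:
  assumes "i \<in> {1..n+1}" "j \<in> {1..n+1}" "l \<in> {1..n+1}" "m \<in> {1..n+1}" "i < j"
  shows "Y l m * Y i j \<approx> free.scale (inverse (weight m i j)) (fX l m * fX i j * (dinv n j * dinv n m))"
proof -
  have "dinv n m * dinv n j \<approx> dinv n j * dinv n m"
    using dinv_commute by (simp add: cong_def free.qbr_def free.scale_one)
  then have "free.scale (inverse (weight m i j)) (fX l m * fX i j * (dinv n m * dinv n j))
      \<approx> free.scale (inverse (weight m i j)) (fX l m * fX i j * (dinv n j * dinv n m))"
    by (rule cong_scale[OF cong_mult[OF cong_refl]])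
  with Y_mult[OF assms(3,4,1,2,5)] show ?thesis by (rule cong_trans)
qed

text \<open>Equal weights mean that both products acquire the same scalar when the inverses are
  moved to the right, so the relation between the entries carries over with the same
  \<open>c\<close>.\<close>

lemma Y_qbr:
  assumes ij: "i \<in> {1..n+1}" "j \<in> {1..n+1}" "l \<in> {1..n+1}" "m \<in> {1..n+1}" "i < j" "l < m"
    and w: "weight j l m = weight m i j" and X: "free.qbr c (fX i j) (fX l m) \<in> N"
  shows "free.qbr c (Y i j) (Y l m) \<in> N"
proof -
  let ?w = "inverse (weight m i j)"
  let ?D = "dinv n j * dinv n m"
  have "free.qbr c (Y i j) (Y l m) \<approx>
      free.scale ?w (fX i j * fX l m * ?D) - free.scale c (free.scale ?w (fX l m * fX i j * ?D))"
    unfolding free.qbr_def using Y_mult[OF ij(1-4,6)] Y_mult_swapped[OF ij(1-5)]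
    by (intro cong_diff cong_scale) (simp_all add: w)
  also have "\<dots> = free.scale ?w (free.qbr c (fX i j) (fX l m) * ?D)"
    by (simp add: free.qbr_def free.scale_expand left_diff_distrib mult.commute)
  finally show ?thesis using X by (simp add: cong_mem ideal_intros)
qed

text \<open>The weight \<open>q\<close> of \<open>fX j m\<close> under \<open>fX j j\<close> turns
  the commutator of the exchange relation into a q-commutator, and the factor \<open>fX j j\<close>
  of the correction term is cancelled by \<open>dinv n j\<close>.\<close>

lemma Y_step:
  assumes ij: "i \<in> {1..n+1}" "j \<in> {1..n+1}" "m \<in> {1..n+1}" "i < j" "j < m"
  shows "free.qbr q (Y j m) (Y i j) \<approx> free.scale (- qhat) (Y i m)"
proof -
  let ?D = "dinv n j * dinv n m"
  have w: "weight m i j = 1" "weight j j m = q"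
    using assms by (simp_all add: weight_def)
  have "free.qbr q (Y j m) (Y i j) \<approx> free.scale 1 (fX j m * fX i j * ?D) -
      free.scale q (free.scale (inverse q) (fX i j * fX j m * ?D))"
    unfolding free.qbr_def
    using Y_mult[of i j j m] Y_mult_swapped[of i j j m] ij w
    by (intro cong_diff cong_scale) simp_all
  also have "\<dots> = - ((fX i j * fX j m - fX j m * fX i j) * ?D)"
    using q0 by (simp add: free.scale_scale free.scale_one left_diff_distrib)
  also have "\<dots> \<approx> - (free.scale qhat (fX i m * fX j j) * ?D)"
  proof -
    have "(fX i j * fX j m - fX j m * fX i j) \<approx> free.scale qhat (fX i m * fX j j)"
      using exchange[of i j j m] ij by (simp add: cong_def)
    from cong_diff[OF cong_refl cong_mult[OF this cong_refl], of 0 ?D] show ?thesis by simp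
  qed
  also have "- (free.scale qhat (fX i m * fX j j) * ?D) =
      free.scale (- qhat) (fX i m * ((fX j j * dinv n j) * dinv n m))"
    by (simp add: free.scale_left free.scale_minus mult.assoc)
  also have "\<dots> \<approx> free.scale (- qhat) (fX i m * (1 * dinv n m))"
    using ij by (intro cong_scale cong_mult cong_refl diagonal_inverse)
  finally show ?thesis by (simp add: Y_def)
qed

lemma Y_far:
  assumes "i \<in> {1..n}" "j \<in> {1..n}" "i + 2 \<le> j"
  shows "free.qbr 1 (Y i (i+1)) (Y j (j+1)) \<in> N"
proof (rule Y_qbr)
  show "free.qbr 1 (fX i (i+1)) (fX j (j+1)) \<in> N"
    using assms by (intro exchange_lower) auto
qed (use assms in \<open>auto simp: weight_def\<close>)

text \<open>By \<open>Y_step\<close> the inner bracket is a multiple of \<open>Y i (i+2)\<close>,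
  which q-commutes with one generator by the row relation and with the other by the column relation;
  \<open>qbr_qbr_serre\<close> translates this.\<close>

lemma Y_serre:
  assumes "i \<in> {1..n}" "i + 1 \<in> {1..n}"
  shows "free.serre (q + inverse q) (Y i (i+1)) (Y (i+1) (i+2)) \<in> N"
    and "free.serre (q + inverse q) (Y (i+1) (i+2)) (Y i (i+1)) \<in> N"
proof -
  let ?a = "Y i (i+1)" and ?b = "Y (i+1) (i+2)" and ?c = "Y i (i+2)"
  have br: "free.scale (- qhat) ?c \<approx> free.qbr q ?b ?a"
    using assms by (intro cong_sym[OF Y_step]) auto
  have "free.qbr q ?a ?c \<in> N"
    using assms by (intro Y_qbr row) (auto simp: weight_def)
  then have 1: "free.qbr q ?a (free.qbr q ?b ?a) \<in> N"
    by (rule qbr_mem_cong[OF qbr_scale_right cong_refl br])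
  have "free.qbr q ?c ?b \<in> N"
    using assms by (intro Y_qbr column) (auto simp: weight_def)
  then have 2: "free.qbr q (free.qbr q ?b ?a) ?b \<in> N"
    by (rule qbr_mem_cong[OF qbr_scale_left br cong_refl])
  show "free.serre (q + inverse q) ?a ?b \<in> N" "free.serre (q + inverse q) ?b ?a \<in> N"
    using 1 2 scale_mem_cancel[of "- q"] q0 by (simp_all add: free.qbr_qbr_serre)
qed

definition sub_ideal :: "(nat, 'k) free_alg set"
  where "sub_ideal = {p. sub_O p \<in> N}"

lemma sub_ideal: "scalar_ideal scal sub_ideal"
  by unfold_locales (auto simp: sub_ideal_def sub_O_def free.lift_simps intro: ideal_intros)

lemma sub_O_gen: "i \<in> {1..n} \<Longrightarrow> sub_O (gen i) = free.scale (- inverse qhat) (Y i (i+1))"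
  by (simp add: sub_O_def free.lift_gen Y_def)

lemma serre_scale:
  "free.serre c (free.scale e p) (free.scale e r) = free.scale (e * e * e) (free.serre c p r)"
  for p r :: "('x, 'k) free_alg"
  by (simp add: free.serre_alt free.scale_left free.scale_right free.scale_scale free.scale_distrib mult_ac)

lemma J_sub_O:
  assumes "p \<in> J"
  shows "sub_O p \<in> N"
proof -
  interpret S: scalar_ideal scal sub_ideal by (rule sub_ideal)
  let ?e = "- inverse qhat"
  have serre: "sub_O (free.serre (q + inverse q) (gen i) (gen j)) \<in> N"
    if "i \<in> {1..n}" "j \<in> {1..n}" "\<bar>int i - int j\<bar> = 1" for i j
  proof -
    have "free.serre (q + inverse q) (Y i (i+1)) (Y j (j+1)) \<in> N"
    proof (cases "i < j")
      case True
      then have "j = i + 1" using that by auto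
      then show ?thesis using Y_serre(1)[of i] that by simp
    next
      case False
      then have "i = j + 1" using that by auto
      then show ?thesis using Y_serre(2)[of j] that by simp
    qed
    then have "free.serre (q + inverse q) (sub_O (gen i)) (sub_O (gen j)) \<in> N"
      using that by (simp add: sub_O_gen serre_scale scale_mem)
    then show ?thesis by (simp add: sub_O_def free.lift_serre)
  qed
  have far: "sub_O (gen i * gen j - gen j * gen i) \<in> N"
    if "i \<in> {1..n}" "j \<in> {1..n}" "\<bar>int i - int j\<bar> \<ge> 2" for i j
  proof -
    have "free.qbr 1 (Y i (i+1)) (Y j (j+1)) \<in> N"
    proof (cases "i < j")
      case True
      then show ?thesis using Y_far[of i j] that by simp
    next
      case False
      then show ?thesis using qbr_one_sym[OF Y_far[of j i]] that by simp
    qed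
    then have "free.qbr 1 (sub_O (gen i)) (sub_O (gen j)) \<in> N"
      using that by (simp add: sub_O_gen qbr_scale_left qbr_scale_right)
    then show ?thesis by (simp add: sub_O_def free.lift_simps free.qbr_def free.scale_one)
  qed
  have outer: "sub_O (gen i) \<in> N" if "i \<notin> {1..n}" for i
    using that by (auto simp: sub_O_def free.lift_gen zero_mem)
  have "serre_relators n q \<subseteq> sub_ideal"
    unfolding serre_relators_def sub_ideal_def using serre far outer by blast
  from S.ideal_gen_subset[OF this] assms show ?thesis
    by (auto simp: J_def sub_ideal_def)
qed

text \<open>Each step of the root vector recursion contributes two factors
  \<open>- inverse qhat\<close> and, by \<open>Y_step\<close>, one factor \<open>- qhat\<close>, so
  the scalar is the same for all roots. Hence every \<open>Y i j\<close> comes from the free algebra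
  modulo \<open>N\<close>.\<close>

lemma Y_sub_O:
  assumes "1 \<le> i" "i < j" "j \<le> n + 1"
  shows "sub_O (y i j) \<approx> Y i j"
proof -
  from assms(2) have "Suc i \<le> j" by simp
  then have "sub_O (J.z i j) \<approx> free.scale (- inverse qhat) (Y i j)"
    using assms(3)
  proof (induction rule: dec_induct)
    case base
    then show ?case using assms(1) by (simp add: J.z_simple sub_O_gen cong_refl)
  next
    case (step m)
    then have "sub_O (J.z i (Suc m)) = free.qbr q (sub_O (gen m)) (sub_O (J.z i m))"
      by (simp add: J.z_Suc sub_O_def free.lift_qbr)
    also have "\<dots> \<approx> free.qbr q (free.scale (- inverse qhat) (Y m (Suc m)))
        (free.scale (- inverse qhat) (Y i m))"
      using step assms(1) sub_O_gen[of m] by (intro cong_qbr) (simp_all add: cong_refl)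
    also have "\<dots> = free.scale (inverse qhat * inverse qhat) (free.qbr q (Y m (Suc m)) (Y i m))"
      by (simp add: free.qbr_def free.scale_left free.scale_right free.scale_scale
          free.scale_distrib mult.commute mult.left_commute)
    also have "\<dots> \<approx> free.scale (inverse qhat * inverse qhat) (free.scale (- qhat) (Y i (Suc m)))"
      using step assms(1) by (intro cong_scale Y_step) auto
    also have "\<dots> = free.scale (- inverse qhat) (Y i (Suc m))"
      using qhat_nonzero by (simp add: free.scale_scale mult.assoc)
    finally show ?case .
  qed
  from cong_scale[OF this, of "- qhat"] show ?thesis
    using assms(2) qhat_nonzero
    by (simp add: y_def sub_O_def free.lift_scale free.scale_scale free.scale_one)
qed

end

section \<open>Presented algebras as images of the free algebra\<close>

text \<open>The map is defined on a whole type, so its kernel is a \<open>scalar_ideal\<close>; this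
  links algebras with carriers to the congruences above.\<close>

locale alg_image = k_algebra A for A :: "('k::field, 'a, 'm) module_scheme" (structure) +
  fixes \<Phi> :: "('x, 'k) free_alg \<Rightarrow> 'a"
  assumes \<Phi>_closed [simp]: "\<Phi> p \<in> carrier A"
    and \<Phi>_add: "\<Phi> (p + r) = \<Phi> p \<oplus> \<Phi> r"
    and \<Phi>_mult: "\<Phi> (p * r) = \<Phi> p \<otimes> \<Phi> r"
    and \<Phi>_one: "\<Phi> 1 = \<one>"
    and \<Phi>_scale: "\<Phi> (free.scale c p) = c \<odot> \<Phi> p"
begin

definition kernel :: "('x, 'k) free_alg set"
  where "kernel = {p. \<Phi> p = \<zero>}"

lemma \<Phi>_zero: "\<Phi> 0 = \<zero>"
  using \<Phi>_add[of 0 0] by simp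

lemma \<Phi>_eq_iff: "\<Phi> p = \<Phi> r \<longleftrightarrow> p - r \<in> kernel"
proof -
  have "\<Phi> p = \<Phi> (p - r) \<oplus> \<Phi> r"
    using \<Phi>_add[of "p - r" r] by simp
  then show ?thesis
    by (auto simp: kernel_def)
qed

lemma kernel_scalar_ideal: "scalar_ideal scal kernel"
  by unfold_locales (auto simp: kernel_def \<Phi>_zero \<Phi>_add \<Phi>_mult)

lemma range_subset_subalgebra:
  assumes B: "k_subalgebra A B" and gens: "\<And>x. \<Phi> (\<tau> (gen x)) \<in> B"
    and \<tau>: "\<tau> = free.lift g"
  shows "\<Phi> (\<tau> p) \<in> B"
proof -
  have "subring B A" using B by (simp add: k_subalgebra_def)
  note B' = subringE(2,3,6,7)[OF this]
  show ?thesis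
    unfolding \<tau>
  proof (induction p rule: free_alg_induct)
    case (gen x p)
    then show ?case using gens[of x] by (simp add: \<tau> free.lift_simps \<Phi>_mult B')
  qed (use B in \<open>auto simp: free.lift_simps \<Phi>_one \<Phi>_add \<Phi>_scale k_subalgebra_def B'\<close>)
qed

lemma range_k_subalgebra:
  assumes \<tau>: "\<tau> = free.lift g"
  shows "k_subalgebra A (range (\<lambda>p. \<Phi> (\<tau> p)))"
  unfolding k_subalgebra_def
proof (intro conjI allI ballI)
  show "subring (range (\<lambda>p. \<Phi> (\<tau> p))) A"
  proof (rule subringI)
    show "\<one> \<in> range (\<lambda>p. \<Phi> (\<tau> p))"
      by (rule range_eqI[of _ _ 1]) (simp add: \<tau> free.lift_one \<Phi>_one)
    fix a b assume "a \<in> range (\<lambda>p. \<Phi> (\<tau> p))" "b \<in> range (\<lambda>p. \<Phi> (\<tau> p))"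
    then obtain p r where ab: "a = \<Phi> (\<tau> p)" "b = \<Phi> (\<tau> r)" by blast
    have "\<Phi> (\<tau> (- p)) \<oplus> a = \<zero>"
      by (simp add: ab \<tau> free.lift_minus \<Phi>_zero flip: \<Phi>_add)
    then have "\<ominus> a = \<Phi> (\<tau> (- p))"
      using ab by (simp add: minus_equality)
    then show "\<ominus> a \<in> range (\<lambda>p. \<Phi> (\<tau> p))" by simp
    show "a \<otimes> b \<in> range (\<lambda>p. \<Phi> (\<tau> p))"
      by (rule range_eqI[of _ _ "p * r"]) (simp add: ab \<tau> free.lift_mult \<Phi>_mult)
    show "a \<oplus> b \<in> range (\<lambda>p. \<Phi> (\<tau> p))"
      by (rule range_eqI[of _ _ "p + r"]) (simp add: ab \<tau> free.lift_add \<Phi>_add)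
  qed auto
  fix c a assume "a \<in> range (\<lambda>p. \<Phi> (\<tau> p))"
  then obtain p where "a = \<Phi> (\<tau> p)" by blast
  then show "c \<odot> a \<in> range (\<lambda>p. \<Phi> (\<tau> p))"
    by (intro range_eqI[of _ _ "free.scale c p"]) (simp add: \<tau> free.lift_scale \<Phi>_scale)
qed

text \<open>The zero allows for letters outside \<open>{1..n}\<close>, the scalar for the factor
  \<open>- inverse qhat\<close> in \<open>sub_O\<close>.\<close>

lemma generated_algebra_carrier:
  assumes \<tau>: "\<tau> = free.lift g"
    and gens: "\<And>x. \<Phi> (\<tau> (gen x)) \<in> insert \<zero> S \<or> (\<exists>c. \<exists>a\<in>S. \<Phi> (\<tau> (gen x)) = c \<odot> a)"
    and S: "S \<subseteq> range (\<lambda>p. \<Phi> (\<tau> p))"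
  shows "carrier (generated_algebra A S) = range (\<lambda>p. \<Phi> (\<tau> p))"
proof -
  have "\<Phi> (\<tau> p) \<in> B" if B: "k_subalgebra A B" "S \<subseteq> B" for p B
  proof (rule range_subset_subalgebra[OF B(1) _ \<tau>])
    fix x
    have "\<zero> \<in> B" using B subringE(2) by (auto simp: k_subalgebra_def)
    then show "\<Phi> (\<tau> (gen x)) \<in> B"
      using gens[of x] B by (auto simp: k_subalgebra_def)
  qed
  then show ?thesis
    using range_k_subalgebra[OF \<tau>] S unfolding generated_algebra_def by auto
qed

end

lemma (in k_algebra) coset_ops:
  assumes I: "ideal I A" and x: "x \<in> carrier A"
  shows "I +> x \<in> carrier (quotient_algebra A I)"
    and "y \<in> carrier A \<Longrightarrow>
      (I +> x) \<oplus>\<^bsub>quotient_algebra A I\<^esub> (I +> y) = I +> (x \<oplus> y)"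
    and "y \<in> carrier A \<Longrightarrow>
      (I +> x) \<otimes>\<^bsub>quotient_algebra A I\<^esub> (I +> y) = I +> (x \<otimes> y)"
    and "c \<odot>\<^bsub>quotient_algebra A I\<^esub> (I +> x) = I +> (c \<odot> x)"
    and "I +> x = I \<longleftrightarrow> x \<in> I"
proof -
  interpret ideal I A by fact
  show "I +> x \<in> carrier (quotient_algebra A I)"
    using assms by (auto simp: A_RCOSETS_def')
  show "(I +> x) \<oplus>\<^bsub>quotient_algebra A I\<^esub> (I +> y) = I +> (x \<oplus> y)" if "y \<in> carrier A"
    using x that by (simp only: quotient_algebra_simps a_rcos_sum)
  show "(I +> x) \<otimes>\<^bsub>quotient_algebra A I\<^esub> (I +> y) = I +> (x \<otimes> y)" if "y \<in> carrier A"
    using x that by (simp only: quotient_algebra_simps rcoset_mult_add)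
  show "c \<odot>\<^bsub>quotient_algebra A I\<^esub> (I +> x) = I +> (c \<odot> x)"
    using assms by (simp only: quotient_smult)
  show "I +> x = I \<longleftrightarrow> x \<in> I"
    using a_rcos_self[OF x] a_coset_join2[OF x a_subgroup] by blast
qed

text \<open>The kernel of the composite is the least ideal that contains the old kernel and
  \<open>G\<close>. For minimality, the image of such an ideal \<open>N\<close> is an ideal of
  \<open>A\<close>, so it contains the generated one; and \<open>N\<close> is recovered from its
  image because it contains the old kernel.\<close>

lemma (in alg_image) quotient:
  fixes G :: "('x, 'k) free_alg set"
  assumes surj: "range \<Phi> = carrier A"
  defines "Q \<equiv> quotient_algebra A (genideal A (\<Phi> ` G))"
    and "\<Psi> \<equiv> \<lambda>p. genideal A (\<Phi> ` G) +> \<Phi> p"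
  shows "alg_image Q \<Psi>" "range \<Psi> = carrier Q"
    and "kernel \<subseteq> alg_image.kernel Q \<Psi>" "G \<subseteq> alg_image.kernel Q \<Psi>"
    and "\<And>N. scalar_ideal scal N \<Longrightarrow> kernel \<subseteq> N \<Longrightarrow> G \<subseteq> N \<Longrightarrow> alg_image.kernel Q \<Psi> \<subseteq> N"
proof -
  let ?I = "genideal A (\<Phi> ` G)"
  have G: "\<Phi> ` G \<subseteq> carrier A" by auto
  have I: "ideal ?I A" by (rule genideal_ideal[OF G])
  note ops = coset_ops[OF I]
  interpret I: ideal ?I A by (rule I)
  interpret Q: k_algebra Q unfolding Q_def by (rule quotient_k_algebra[OF I])
  show image: "alg_image Q \<Psi>"
    by unfold_locales
      (simp_all only: \<Psi>_def Q_def ops \<Phi>_closed \<Phi>_add \<Phi>_mult \<Phi>_one \<Phi>_scale quotient_algebra_simps(3))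
  then interpret Q: alg_image Q \<Psi> .
  have zero: "\<zero>\<^bsub>Q\<^esub> = ?I" unfolding Q_def by (simp only: quotient_algebra_simps)
  have kernel': "p \<in> Q.kernel \<longleftrightarrow> \<Phi> p \<in> ?I" for p
    unfolding Q.kernel_def zero by (simp add: \<Psi>_def ops)
  show "range \<Psi> = carrier Q"
  proof
    show "carrier Q \<subseteq> range \<Psi>"
    proof
      fix X assume "X \<in> carrier Q"
      then obtain x where "x \<in> carrier A" "X = ?I +> x"
        by (auto simp: Q_def A_RCOSETS_def')
      moreover from this(1) surj obtain p where "x = \<Phi> p" by blast
      ultimately show "X \<in> range \<Psi>" unfolding \<Psi>_def by blast
    qed
  qed auto
  show "kernel \<subseteq> Q.kernel"
    by (auto simp: kernel' kernel_def I.zero_closed)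
  show "G \<subseteq> Q.kernel"
    using genideal_self[OF G] by (auto simp: kernel')
  fix N assume N: "scalar_ideal scal N" "kernel \<subseteq> N" "G \<subseteq> N"
  interpret N: scalar_ideal scal N by (rule N(1))
  have "ideal (\<Phi> ` N) A"
  proof (rule idealI)
    show "subgroup (\<Phi> ` N) (add_monoid A)"
    proof
      show "inv\<^bsub>add_monoid A\<^esub> x \<in> \<Phi> ` N" if "x \<in> \<Phi> ` N" for x
      proof -
        from that obtain p where p: "p \<in> N" "x = \<Phi> p" by blast
        have "\<Phi> (- p) \<oplus> x = \<zero>" using p by (simp add: \<Phi>_zero flip: \<Phi>_add)
        then have "\<ominus> x = \<Phi> (- p)" using p by (simp add: minus_equality)
        then show ?thesis using N.minus_mem[OF p(1)] by (simp add: a_inv_def)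
      qed
    next
      fix a b assume "a \<in> \<Phi> ` N" "b \<in> \<Phi> ` N"
      then obtain p r where "p \<in> N" "r \<in> N" "a = \<Phi> p" "b = \<Phi> r" by blast
      then show "a \<otimes>\<^bsub>add_monoid A\<^esub> b \<in> \<Phi> ` N"
        by (intro image_eqI[of _ _ "p + r"]) (simp_all add: \<Phi>_add N.add_mem)
    next
      show "\<one>\<^bsub>add_monoid A\<^esub> \<in> \<Phi> ` N"
        using N.zero_mem \<Phi>_zero by (auto intro: image_eqI[of _ _ 0])
    qed auto
    fix a x assume "a \<in> \<Phi> ` N" "x \<in> carrier A"
    then obtain p r where p: "p \<in> N" "a = \<Phi> p" "x = \<Phi> r" using surj by blast
    show "x \<otimes> a \<in> \<Phi> ` N"
      using p by (intro image_eqI[of _ _ "r * p"]) (simp_all add: \<Phi>_mult N.mult_left_mem)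
    show "a \<otimes> x \<in> \<Phi> ` N"
      using p by (intro image_eqI[of _ _ "p * r"]) (simp_all add: \<Phi>_mult N.mult_right_mem)
  qed (rule ring_axioms)
  then have "?I \<subseteq> \<Phi> ` N"
    using N(3) by (intro genideal_minimal) auto
  show "Q.kernel \<subseteq> N"
  proof
    fix p assume "p \<in> Q.kernel"
    then obtain r where r: "r \<in> N" "\<Phi> p = \<Phi> r"
      using \<open>?I \<subseteq> \<Phi> ` N\<close> kernel' by blast
    then have "p - r \<in> N" using N(2) \<Phi>_eq_iff by blast
    from N.add_mem[OF this r(1)] show "p \<in> N" by simp
  qed
qed

text \<open>A free algebra on a subset of the letters is the image of this idempotent endomorphism,
  so a map on its carrier becomes one on the whole type by composition.\<close>

definition retract :: "'x set \<Rightarrow> ('x, 'k::field) free_alg \<Rightarrow> ('x, 'k) free_alg"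
  where "retract S = free.lift (\<lambda>x. if x \<in> S then gen x else 0)"

lemma retract_closed: "retract S p \<in> carrier (free_algebra S)"
  by (induction p rule: free_alg_induct)
    (auto simp: retract_def free.lift_simps free.scale_def intro!: free_algebra_closed)

lemma retract_word:
  "set xs \<subseteq> S \<Longrightarrow> retract S (Poly_Mapping.single (Word xs) 1) = Poly_Mapping.single (Word xs) 1"
  by (induction xs) (simp_all add: retract_def single_Word_Nil single_Word_Cons free.lift_simps)

lemma retract_id:
  fixes p :: "('x, 'k::field) free_alg"
  assumes "p \<in> carrier (free_algebra S)"
  shows "retract S p = p"
proof -
  have "retract S p = (\<Sum>w\<in>Poly_Mapping.keys p.
      free.scale (Poly_Mapping.lookup p w) (retract S (Poly_Mapping.single w 1)))"
  proof -
    have "retract S (Poly_Mapping.single w 1) =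
        prod_list (map (\<lambda>x. if x \<in> S then gen x else 0) (letters w))" for w :: "'x free_monoid"
      unfolding retract_def free.lift_def using free.linext_word[of _ "letters w"] by simp
    then show ?thesis
      unfolding retract_def free.lift_def by (simp add: free.linext_def free.scale_one)
  qed
  also have "\<dots> = (\<Sum>w\<in>Poly_Mapping.keys p. Poly_Mapping.single w (Poly_Mapping.lookup p w))"
  proof (rule sum.cong[OF refl])
    fix w assume "w \<in> Poly_Mapping.keys p"
    then have "set (letters w) \<subseteq> S" using assms by (auto simp: free_algebra_def)
    then have "retract S (Poly_Mapping.single w 1) = Poly_Mapping.single w (1 :: 'k)"
      using retract_word[of "letters w" S] by simp
    then show "free.scale (Poly_Mapping.lookup p w) (retract S (Poly_Mapping.single w 1)) =
        Poly_Mapping.single w (Poly_Mapping.lookup p w)"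
      by (simp only: single_scale[symmetric])
  qed
  also have "\<dots> = p"
    by (rule poly_mapping_eqI) (simp add: lookup_sum lookup_single when_def in_keys_iff)
  finally show ?thesis .
qed

lemma retract_alg_image: "alg_image (free_algebra S) (retract S)"
proof -
  interpret k_algebra "free_algebra S" by (rule free_algebra_k_algebra)
  show ?thesis
    by unfold_locales
      (simp_all only: retract_closed, simp_all add: retract_def free_algebra_def free.lift_simps free.scale_def)
qed

lemma range_retract: "range (retract S) = carrier (free_algebra S)"
proof
  show "carrier (free_algebra S) \<subseteq> range (retract S)"
    using retract_id[symmetric] by (auto intro: range_eqI)
qed (auto simp: retract_closed)

text \<open>The last clause is the universal property in the form needed later: a representation
  that kills the relators and all letters outside \<open>S\<close> bounds the kernel from
  above.\<close>

lemma presented_alg_image: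
  fixes S :: "'x set" and rels :: "('x, 'k::field) free_alg set"
  assumes rels: "\<forall>r\<in>rels. retract S r = r"
  defines "A \<equiv> presented_algebra S rels"
    and "\<Phi> \<equiv> \<lambda>p. genideal (free_algebra S) rels +>\<^bsub>free_algebra S\<^esub> retract S p"
  shows "alg_image A \<Phi>" "range \<Phi> = carrier A" "rels \<subseteq> alg_image.kernel A \<Phi>"
    and "x \<in> S \<Longrightarrow> \<Phi> (gen x) = presented_gen S rels x"
    and "\<And>N. scalar_ideal scal N \<Longrightarrow> (\<And>x. x \<notin> S \<Longrightarrow> gen x \<in> N) \<Longrightarrow> rels \<subseteq> N \<Longrightarrow>
      alg_image.kernel A \<Phi> \<subseteq> N"
proof -
  interpret R: alg_image "free_algebra S" "retract S :: ('x, 'k) free_alg \<Rightarrow> _"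
    by (rule retract_alg_image)
  have "retract S ` rels = rels" using rels by force
  note quotient = R.quotient[OF range_retract, where G = rels, unfolded this,
      folded presented_algebra_def, folded A_def \<Phi>_def]
  show "alg_image A \<Phi>" "range \<Phi> = carrier A" "rels \<subseteq> alg_image.kernel A \<Phi>"
    by (fact quotient)+
  show "x \<in> S \<Longrightarrow> \<Phi> (gen x) = presented_gen S rels x"
    by (simp add: \<Phi>_def presented_gen_def retract_def free.lift_gen)
  fix N :: "('x, 'k) free_alg set"
  assume N: "scalar_ideal scal N" "\<And>x. x \<notin> S \<Longrightarrow> gen x \<in> N" "rels \<subseteq> N"
  interpret N: scalar_ideal scal N by (rule N(1))
  have retract: "N.cong (retract S p) p" for p
  proof (induction p rule: free_alg_induct)
    case (gen x p)
    have "N.cong (retract S (gen x)) (gen x)"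
      using N(2)[of x] N.minus_mem[of "gen x"]
      by (auto simp: retract_def free.lift_gen N.cong_def N.zero_mem)
    from N.cong_mult[OF this gen] show ?case by (simp add: retract_def free.lift_simps)
  qed (auto simp: retract_def free.lift_simps intro: N.cong_refl N.cong_add N.cong_scale)
  have "R.kernel \<subseteq> N"
  proof
    fix p assume "p \<in> R.kernel"
    then have "retract S p = 0" unfolding R.kernel_def by (simp add: free_algebra_def)
    then show "p \<in> N" using N.cong_mem[OF retract[of p]] N.zero_mem by simp
  qed
  with quotient(5) N show "alg_image.kernel A \<Phi> \<subseteq> N" by blast
qed

section \<open>The isomorphism\<close>

lemma generated_algebra_simps [simp]:
  "monoid.mult (generated_algebra A S) = monoid.mult A" "one (generated_algebra A S) = one A"
  "zero (generated_algebra A S) = zero A" "add (generated_algebra A S) = add A"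
  "smult (generated_algebra A S) = smult A"
  by (simp_all add: generated_algebra_def)

text \<open>Equality of the kernels makes the value of \<open>\<psi>\<close> independent of the
  chosen preimage, and the same equality gives injectivity.\<close>

lemma iso_of_equal_kernels:
  fixes A :: "('k::field, 'a, 'm) module_scheme" and B :: "('k, 'b, 'l) module_scheme"
    and \<Phi> :: "('x, 'k) free_alg \<Rightarrow> 'a" and \<Theta> :: "('y, 'k) free_alg \<Rightarrow> 'b"
    and \<sigma> :: "('z, 'k) free_alg \<Rightarrow> ('x, 'k) free_alg" and \<tau> :: "('z, 'k) free_alg \<Rightarrow> ('y, 'k) free_alg"
  assumes "alg_image A \<Phi>" "alg_image B \<Theta>"
    and \<sigma>: "\<sigma> = free.lift f" and \<tau>: "\<tau> = free.lift g"
    and kernels: "\<And>p. \<sigma> p \<in> alg_image.kernel A \<Phi> \<longleftrightarrow> \<tau> p \<in> alg_image.kernel B \<Theta>"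
    and A': "carrier (generated_algebra A S) = range (\<lambda>p. \<Phi> (\<sigma> p))"
    and B': "carrier (generated_algebra B T) = range (\<lambda>p. \<Theta> (\<tau> p))"
  shows "\<exists>\<psi>\<in>k_algebra_iso (generated_algebra A S) (generated_algebra B T). \<forall>p. \<psi> (\<Phi> (\<sigma> p)) = \<Theta> (\<tau> p)"
proof -
  interpret A: alg_image A \<Phi> by fact
  interpret B: alg_image B \<Theta> by fact
  have eq: "\<Phi> (\<sigma> p) = \<Phi> (\<sigma> r) \<longleftrightarrow> \<Theta> (\<tau> p) = \<Theta> (\<tau> r)" for p r
    using kernels[of "p - r"] by (simp add: A.\<Phi>_eq_iff B.\<Phi>_eq_iff \<sigma> \<tau> free.lift_diff)
  define \<psi> where "\<psi> X = \<Theta> (\<tau> (SOME p. \<Phi> (\<sigma> p) = X))" for X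
  have \<psi>: "\<psi> (\<Phi> (\<sigma> p)) = \<Theta> (\<tau> p)" for p
  proof -
    have "\<Phi> (\<sigma> (SOME r. \<Phi> (\<sigma> r) = \<Phi> (\<sigma> p))) = \<Phi> (\<sigma> p)"
      by (rule someI) (rule refl)
    then show ?thesis by (simp add: \<psi>_def eq)
  qed
  have ops: "\<Phi> (\<sigma> p) \<otimes>\<^bsub>A\<^esub> \<Phi> (\<sigma> r) = \<Phi> (\<sigma> (p * r))" "\<Phi> (\<sigma> p) \<oplus>\<^bsub>A\<^esub> \<Phi> (\<sigma> r) = \<Phi> (\<sigma> (p + r))"
    "\<one>\<^bsub>A\<^esub> = \<Phi> (\<sigma> 1)" "c \<odot>\<^bsub>A\<^esub> \<Phi> (\<sigma> p) = \<Phi> (\<sigma> (free.scale c p))" for p r c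
    by (simp_all add: \<sigma> free.lift_simps A.\<Phi>_add A.\<Phi>_mult A.\<Phi>_one A.\<Phi>_scale)
  have ops': "\<Theta> (\<tau> (p * r)) = \<Theta> (\<tau> p) \<otimes>\<^bsub>B\<^esub> \<Theta> (\<tau> r)" "\<Theta> (\<tau> (p + r)) = \<Theta> (\<tau> p) \<oplus>\<^bsub>B\<^esub> \<Theta> (\<tau> r)"
    "\<Theta> (\<tau> 1) = \<one>\<^bsub>B\<^esub>" "\<Theta> (\<tau> (free.scale c p)) = c \<odot>\<^bsub>B\<^esub> \<Theta> (\<tau> p)" for p r c
    by (simp_all add: \<tau> free.lift_simps B.\<Phi>_add B.\<Phi>_mult B.\<Phi>_one B.\<Phi>_scale)
  have "bij_betw \<psi> (range (\<lambda>p. \<Phi> (\<sigma> p))) (range (\<lambda>p. \<Theta> (\<tau> p)))"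
    unfolding bij_betw_def by (auto simp: inj_on_def \<psi> eq image_image)
  moreover have "\<psi> \<in> ring_hom (generated_algebra A S) (generated_algebra B T)"
    by (rule ring_hom_memI) (auto simp: A' B' \<psi> ops ops')
  ultimately have "\<psi> \<in> k_algebra_iso (generated_algebra A S) (generated_algebra B T)"
    by (auto simp: k_algebra_iso_def ring_iso_def A' B' \<psi> ops ops')
  with \<psi> show ?thesis by blast
qed

lemma U_rels_retract:
  fixes q :: "'k::field"
  shows "\<forall>r\<in>U_rels n q. retract (U_gens n) r = r"
proof
  fix r assume r: "r \<in> U_rels n q"
  have lattice: "(\<lambda>_. 0) \<in> root_lattice n"
    "l \<in> root_lattice n \<Longrightarrow> m \<in> root_lattice n \<Longrightarrow> (\<lambda>i. l i + m i) \<in> root_lattice n"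
    "i \<in> {1..n} \<Longrightarrow> simple_root i \<in> root_lattice n"
    "i \<in> {1..n} \<Longrightarrow> (\<lambda>t. - simple_root i t) \<in> root_lattice n" for l m i
    by (auto simp: root_lattice_def simple_root_def)
  have gens: "l \<in> root_lattice n \<Longrightarrow> retract (U_gens n) (fK l) = (fK l :: (U_gen, 'k) free_alg)"
    "i \<in> {1..n} \<Longrightarrow> retract (U_gens n) (fE i) = (fE i :: (U_gen, 'k) free_alg)"
    "i \<in> {1..n} \<Longrightarrow> retract (U_gens n) (fF i) = (fF i :: (U_gen, 'k) free_alg)" for l i
    by (simp_all add: retract_def free.lift_gen U_gens_def)
  note retract = free.lift_simps(1-5,7-10)[where \<phi> = "\<lambda>x. if x \<in> U_gens n then gen x else 0",
      folded retract_def]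
  from r show "retract (U_gens n) r = r"
    unfolding U_rels_def
    by (elim UnE CollectE exE conjE insertE emptyE; hypsubst)
      (simp_all only: retract gens lattice split: if_split, simp_all)
qed

lemma O_SL_rels_retract:
  fixes q :: "'k::field"
  shows "\<forall>r\<in>O_SL_rels n q. retract (O_gens n) r = r"
proof
  fix r assume r: "r \<in> O_SL_rels n q"
  have gens: "retract (O_gens n) (fX i j) = (fX i j :: (nat \<times> nat, 'k) free_alg)"
    if "i \<in> {1..n+1}" "j \<in> {1..n+1}" for i j
    using that by (simp add: retract_def free.lift_gen O_gens_def)
  note retract = free.lift_simps(1-5,7-11)[where \<phi> = "\<lambda>x. if x \<in> O_gens n then gen x else 0",
      folded retract_def]
  have sum: "retract (O_gens n) (sum f M) = (\<Sum>x\<in>M. retract (O_gens n) (f x))"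
    for M :: "(nat \<Rightarrow> nat) set" and f :: "_ \<Rightarrow> (nat \<times> nat, 'k) free_alg"
    by (induction M rule: infinite_finite_induct) (simp_all add: retract)
  have word: "retract (O_gens n) (prod_list (map (\<lambda>i. fX i (\<sigma> i)) [1..<n+2])) =
      prod_list (map (\<lambda>i. fX i (\<sigma> i) :: (nat \<times> nat, 'k) free_alg) [1..<n+2])"
    if "\<sigma> permutes {1..n+1}" for \<sigma>
  proof -
    have "map (\<lambda>i. retract (O_gens n) (fX i (\<sigma> i) :: (nat \<times> nat, 'k) free_alg)) [1..<n+2] =
        map (\<lambda>i. fX i (\<sigma> i)) [1..<n+2]"
    proof (rule map_cong[OF refl])
      fix i assume "i \<in> set [1..<n+2]"
      then have "i \<in> {1..n+1}" by auto
      then show "retract (O_gens n) (fX i (\<sigma> i)) = (fX i (\<sigma> i) :: (nat \<times> nat, 'k) free_alg)"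
        using permutes_in_image[OF that, of i] by (intro gens) blast+
    qed
    then show ?thesis by (simp only: retract map_map o_def)
  qed
  have det: "retract (O_gens n) ((\<Sum>\<sigma> | \<sigma> permutes {1..n+1}.
      scal ((- q) ^ perm_length (n+1) \<sigma>) * prod_list (map (\<lambda>i. fX i (\<sigma> i)) [1..<n+2])) - 1) =
      (\<Sum>\<sigma> | \<sigma> permutes {1..n+1}.
      scal ((- q) ^ perm_length (n+1) \<sigma>) * prod_list (map (\<lambda>i. fX i (\<sigma> i)) [1..<n+2])) - 1"
  proof -
    have "(\<Sum>\<sigma> | \<sigma> permutes {1..n+1}. retract (O_gens n)
        (scal ((- q) ^ perm_length (n+1) \<sigma>) * prod_list (map (\<lambda>i. fX i (\<sigma> i)) [1..<n+2]))) =
        (\<Sum>\<sigma> | \<sigma> permutes {1..n+1}.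
        scal ((- q) ^ perm_length (n+1) \<sigma>) * prod_list (map (\<lambda>i. fX i (\<sigma> i)) [1..<n+2]))"
    proof (rule sum.cong[OF refl])
      fix \<sigma> assume "\<sigma> \<in> {\<sigma>. \<sigma> permutes {1..n+1}}"
      then have "\<sigma> permutes {1..n+1}" by simp
      from word[OF this] show "retract (O_gens n)
        (scal ((- q) ^ perm_length (n+1) \<sigma>) * prod_list (map (\<lambda>i. fX i (\<sigma> i)) [1..<n+2])) =
        scal ((- q) ^ perm_length (n+1) \<sigma>) * prod_list (map (\<lambda>i. fX i (\<sigma> i)) [1..<n+2])"
        by (simp only: retract)
    qed
    then show ?thesis by (simp only: retract sum)
  qed
  from r show "retract (O_gens n) r = r"
    unfolding O_SL_rels_def
    by (elim UnE CollectE exE conjE insertE emptyE; hypsubst)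
      ((simp only: retract gens; fail) | rule det)+
qed

context quantum_sl
begin

lemma U_plus_image:
  defines "\<Phi> \<equiv> \<lambda>p. genideal (free_algebra (U_gens n)) (U_rels n q) +>\<^bsub>free_algebra (U_gens n)\<^esub>
    retract (U_gens n) p"
  shows "alg_image (U_alg n q) \<Phi>"
    and "carrier (U_plus n q) = range (\<lambda>p. \<Phi> (sub_U p))"
    and "\<And>i. i \<in> {1..n} \<Longrightarrow> \<Phi> (sub_U (gen i)) = E_U n q i"
    and "\<And>p. sub_U p \<in> alg_image.kernel (U_alg n q) \<Phi> \<longleftrightarrow> p \<in> J"
proof -
  note image = presented_alg_image[OF U_rels_retract[of n q],
      folded \<Phi>_def U_alg_def]
  show "alg_image (U_alg n q) \<Phi>" by (rule image)
  then interpret U: alg_image "U_alg n q" \<Phi> .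
  interpret K: scalar_ideal scal U.kernel by (rule U.kernel_scalar_ideal)
  show E: "\<Phi> (sub_U (gen i)) = E_U n q i" if "i \<in> {1..n}" for i
  proof -
    have "E i \<in> U_gens n" using that by (simp add: U_gens_def)
    from image(4)[OF this] show ?thesis using that by (simp add: \<Phi>_def sub_U_def free.lift_gen E_U_def)
  qed
  show "carrier (U_plus n q) = range (\<lambda>p. \<Phi> (sub_U p))"
    unfolding U_plus_def
  proof (rule U.generated_algebra_carrier[OF sub_U_def])
    fix i
    show "\<Phi> (sub_U (gen i)) \<in> insert \<zero>\<^bsub>U_alg n q\<^esub> (E_U n q ` {1..n})
        \<or> (\<exists>c. \<exists>a\<in>E_U n q ` {1..n}. \<Phi> (sub_U (gen i)) = c \<odot>\<^bsub>U_alg n q\<^esub> a)"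
    proof (cases "i \<in> {1..n}")
      case False
      then have "sub_U (gen i) = 0" by (auto simp: sub_U_def free.lift_gen)
      then show ?thesis by (simp add: U.\<Phi>_zero)
    qed (use E in auto)
    show "E_U n q ` {1..n} \<subseteq> range (\<lambda>p. \<Phi> (sub_U p))"
    proof
      fix a assume "a \<in> E_U n q ` {1..n}"
      then obtain i where "i \<in> {1..n}" "a = E_U n q i" by blast
      with E[of i] show "a \<in> range (\<lambda>p. \<Phi> (sub_U p))" by blast
    qed
  qed
  have "U.kernel \<subseteq> annihilator rep_U"
  proof (rule image(5)[OF annihilator_scalar_ideal[OF preserves_J_rep_U] _ U_rels_annihilator])
    show "gen x \<in> annihilator rep_U" if "x \<notin> U_gens n" for x
      using that by (intro annihilator_I(1)) (simp add: op.lift_gen rep_U_def)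
  qed
  moreover have "sub_U p \<in> U.kernel" if "p \<in> J" for p
  proof -
    have "scalar_ideal scal {p. sub_U p \<in> U.kernel}"
      by unfold_locales (auto simp: sub_U_def free.lift_simps intro: K.ideal_intros)
    then interpret S: scalar_ideal scal "{p. sub_U p \<in> U.kernel}" .
    have "sub_U r \<in> U.kernel" if "r \<in> serre_relators n q" for r
    proof -
      have gen: "sub_U (gen i) = fE i" if "i \<in> {1..n}" for i
        using that by (simp add: sub_U_def free.lift_gen)
      have serre: "sub_U (free.serre (q + inverse q) (gen i) (gen j)) \<in> U.kernel"
        if "i \<in> {1..n}" "j \<in> {1..n}" "\<bar>int i - int j\<bar> = 1" for i j
      proof -
        have "free.serre (q + inverse q) (fE i) (fE j) \<in> U_rels n q"
          unfolding U_rels_def free.serre_def using that by blast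
        with image(3) have "free.serre (q + inverse q) (sub_U (gen i)) (sub_U (gen j)) \<in> U.kernel"
          using that by (auto simp: gen)
        then show ?thesis by (simp add: sub_U_def free.lift_serre)
      qed
      have far: "sub_U (gen i * gen j - gen j * gen i) \<in> U.kernel"
        if "i \<in> {1..n}" "j \<in> {1..n}" "\<bar>int i - int j\<bar> \<ge> 2" for i j
      proof -
        have "fE i * fE j - fE j * fE i \<in> U_rels n q"
          unfolding U_rels_def using that by blast
        with image(3) have "sub_U (gen i) * sub_U (gen j) - sub_U (gen j) * sub_U (gen i) \<in> U.kernel"
          using that by (auto simp: gen)
        then show ?thesis by (simp add: sub_U_def free.lift_simps)
      qed
      have outer: "sub_U (gen i) \<in> U.kernel" if "i \<notin> {1..n}" for i
        using that by (auto simp: sub_U_def free.lift_gen K.zero_mem)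
      from that serre far outer show ?thesis
        unfolding serre_relators_def by blast
    qed
    then show ?thesis
      using S.ideal_gen_subset[of "serre_relators n q"] that by (auto simp: J_def)
  qed
  ultimately show "sub_U p \<in> U.kernel \<longleftrightarrow> p \<in> J" for p
    using sub_U_annihilator by blast
qed

lemma O_N'_image:
  obtains \<Phi> where "alg_image (O_B n q) \<Phi>"
    and "carrier (O_N' n q) = range (\<lambda>p. \<Phi> (sub_O p))"
    and "\<And>i. i \<in> {1..n} \<Longrightarrow> \<Phi> (sub_O (gen i)) = (- inverse (q - inverse q)) \<odot>\<^bsub>O_B n q\<^esub>
      (X_B n q i (i+1) \<otimes>\<^bsub>O_B n q\<^esub> inv\<^bsub>O_B n q\<^esub> (X_B n q (i+1) (i+1)))"
    and "\<And>p. sub_O p \<in> alg_image.kernel (O_B n q) \<Phi> \<longleftrightarrow> p \<in> J"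
proof -
  define \<Theta> :: "(nat \<times> nat, 'k) free_alg \<Rightarrow> _" where
    "\<Theta> p = genideal (free_algebra (O_gens n)) (O_SL_rels n q) +>\<^bsub>free_algebra (O_gens n)\<^esub>
      retract (O_gens n) p" for p
  define G :: "(nat \<times> nat, 'k) free_alg set" where
    "G = {fX i j | i j. i \<in> {1..n+1} \<and> j \<in> {1..n+1} \<and> i > j}"
  define \<Phi> where "\<Phi> p = B_ideal n q +>\<^bsub>O_SL n q\<^esub> \<Theta> p" for p
  note SL = presented_alg_image[OF O_SL_rels_retract[of n q],
      folded \<Theta>_def[abs_def] O_SL_def, folded \<Theta>_def]
  interpret SL: alg_image "O_SL n q" \<Theta> by (rule SL)
  have X: "\<Theta> (fX i j) = X_SL n q i j" if "i \<in> {1..n+1}" "j \<in> {1..n+1}" for i j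
    using that SL(4)[where x = "(i, j)"] by (simp add: X_SL_def O_gens_def)
  have "\<Theta> ` G = {X_SL n q i j | i j. i \<in> {1..n+1} \<and> j \<in> {1..n+1} \<and> i > j}"
  proof (intro equalityI subsetI)
    fix x assume "x \<in> \<Theta> ` G"
    then obtain i j where ij: "i \<in> {1..n+1}" "j \<in> {1..n+1}" "i > j" "x = \<Theta> (fX i j)"
      unfolding G_def by blast
    with X[OF ij(1,2)] show "x \<in> {X_SL n q i j | i j. i \<in> {1..n+1} \<and> j \<in> {1..n+1} \<and> i > j}"
      by blast
  next
    fix x assume "x \<in> {X_SL n q i j | i j. i \<in> {1..n+1} \<and> j \<in> {1..n+1} \<and> i > j}"
    then obtain i j where ij: "i \<in> {1..n+1}" "j \<in> {1..n+1}" "i > j" "x = X_SL n q i j"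
      by blast
    with X[OF ij(1,2)] show "x \<in> \<Theta> ` G"
      unfolding G_def by blast
  qed
  \<comment> \<open>O_q(B^+) is a quotient of a quotient. With its ideal generated by the images of
    \<open>G\<close>, the lemma \<open>quotient\<close> describes the kernel of the composite
    directly in the free algebra.\<close>
  then have B_ideal: "B_ideal n q = genideal (O_SL n q) (\<Theta> ` G)"
    by (simp add: B_ideal_def)
  note quotient = SL.quotient[OF SL(2), where G = G, folded B_ideal O_B_def, folded \<Phi>_def]
  have image: "alg_image (O_B n q) \<Phi>" using quotient(1) by (simp add: \<Phi>_def[abs_def])
  then interpret B: alg_image "O_B n q" \<Phi> .
  interpret K: scalar_ideal scal B.kernel by (rule B.kernel_scalar_ideal)
  have ker: "SL.kernel \<subseteq> B.kernel" "G \<subseteq> B.kernel"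
    and min: "\<And>N. scalar_ideal scal N \<Longrightarrow> SL.kernel \<subseteq> N \<Longrightarrow> G \<subseteq> N \<Longrightarrow> B.kernel \<subseteq> N"
    using quotient(3-5) by (simp_all add: \<Phi>_def[abs_def])
  interpret K: borel_ideal n q B.kernel
  proof
    show "O_SL_rels n q \<subseteq> B.kernel" using SL(3) ker(1) by blast
    show "fX i j \<in> B.kernel" if "i \<in> {1..n+1}" "j \<in> {1..n+1}" "j < i" for i j
      using that ker(2) unfolding G_def by blast
  qed
  have "SL.kernel \<subseteq> annihilator rep_O"
  proof (rule SL(5)[OF annO.scalar_ideal_axioms _ O_rels_annihilator])
    show "gen x \<in> annihilator rep_O" if "x \<notin> O_gens n" for x
      using that by (intro annihilator_I(1)) (auto simp: op.lift_gen rep_O_def split: prod.split)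
  qed
  moreover have "G \<subseteq> annihilator rep_O"
    unfolding G_def using O_lower by blast
  ultimately have ann: "B.kernel \<subseteq> annihilator rep_O"
    by (rule min[OF annO.scalar_ideal_axioms])
  have XB: "\<Phi> (fX i j) = X_B n q i j" if "i \<in> {1..n+1}" "j \<in> {1..n+1}" for i j
    using X[OF that] by (simp add: \<Phi>_def X_B_def)
  have inv: "inv\<^bsub>O_B n q\<^esub> (X_B n q j j) = \<Phi> (dinv n j)" if "j \<in> {1..n+1}" for j
  proof (rule B.inv_char)
    show "X_B n q j j \<otimes>\<^bsub>O_B n q\<^esub> \<Phi> (dinv n j) = \<one>\<^bsub>O_B n q\<^esub>"
      and "\<Phi> (dinv n j) \<otimes>\<^bsub>O_B n q\<^esub> X_B n q j j = \<one>\<^bsub>O_B n q\<^esub>"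
      using K.diagonal_inverse[OF that]
      by (simp_all add: B.\<Phi>_eq_iff K.cong_def flip: XB[OF that that] B.\<Phi>_mult B.\<Phi>_one)
  qed (simp_all flip: XB[OF that that])
  have Y: "\<Phi> (K.Y i j) = X_B n q i j \<otimes>\<^bsub>O_B n q\<^esub> inv\<^bsub>O_B n q\<^esub> (X_B n q j j)"
    if "i \<in> {1..n+1}" "j \<in> {1..n+1}" for i j
    using that by (simp add: K.Y_def B.\<Phi>_mult XB inv del: atLeastAtMost_iff)
  have E: "\<Phi> (sub_O (gen i)) = (- inverse (q - inverse q)) \<odot>\<^bsub>O_B n q\<^esub>
      (X_B n q i (i+1) \<otimes>\<^bsub>O_B n q\<^esub> inv\<^bsub>O_B n q\<^esub> (X_B n q (i+1) (i+1)))" if "i \<in> {1..n}" for i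
    using that by (simp add: K.sub_O_gen B.\<Phi>_scale Y qhat_def)
  have carrier: "carrier (O_N' n q) = range (\<lambda>p. \<Phi> (sub_O p))"
    unfolding O_N'_def
  proof (rule B.generated_algebra_carrier[OF sub_O_def])
    let ?S = "{X_B n q i j \<otimes>\<^bsub>O_B n q\<^esub> inv\<^bsub>O_B n q\<^esub> (X_B n q j j) | i j. 1 \<le> i \<and> i < j \<and> j \<le> n+1}"
    fix i
    show "\<Phi> (sub_O (gen i)) \<in> insert \<zero>\<^bsub>O_B n q\<^esub> ?S
        \<or> (\<exists>c. \<exists>a\<in>?S. \<Phi> (sub_O (gen i)) = c \<odot>\<^bsub>O_B n q\<^esub> a)"
    proof (cases "i \<in> {1..n}")
      case True
      then have "X_B n q i (i+1) \<otimes>\<^bsub>O_B n q\<^esub> inv\<^bsub>O_B n q\<^esub> (X_B n q (i+1) (i+1)) \<in> ?S" by auto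
      with E[OF True] show ?thesis by blast
    next
      case False
      then have "sub_O (gen i) = 0" by (auto simp: sub_O_def free.lift_gen)
      then show ?thesis by (simp add: B.\<Phi>_zero)
    qed
    \<comment> \<open>The subalgebra is generated by the elements for all \<open>i < j\<close>, not
      only for \<open>j = i + 1\<close>; the preimages of the others are the multiples
      \<open>y i j\<close> of root vectors.\<close>
    show "?S \<subseteq> range (\<lambda>p. \<Phi> (sub_O p))"
    proof
      fix a assume "a \<in> ?S"
      then obtain i j where ij: "1 \<le> i" "i < j" "j \<le> n + 1"
        and "a = X_B n q i j \<otimes>\<^bsub>O_B n q\<^esub> inv\<^bsub>O_B n q\<^esub> (X_B n q j j)" by blast
      then have "a = \<Phi> (K.Y i j)" using Y[of i j] by simp
      also have "\<dots> = \<Phi> (sub_O (y i j))"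
        using K.cong_sym[OF K.Y_sub_O[OF ij]] by (simp add: B.\<Phi>_eq_iff K.cong_def)
      finally show "a \<in> range (\<lambda>p. \<Phi> (sub_O p))" by blast
    qed
  qed
  have "sub_O p \<in> B.kernel \<longleftrightarrow> p \<in> J" for p
    using K.J_sub_O sub_O_annihilator ann by blast
  with image carrier E show thesis by (rule that)
qed

end

theorem theorem17:
  fixes n :: nat and q :: "'k::field"
  assumes "q \<noteq> 0" and "\<forall>m>0. q ^ m \<noteq> 1" and "n \<ge> 1"
  shows "\<exists>\<psi> \<in> k_algebra_iso (U_plus n q) (O_N' n q). \<forall>i\<in>{1..n}.
    \<psi> (E_U n q i) = (- inverse (q - inverse q)) \<odot>\<^bsub>O_B n q\<^esub>
      (X_B n q i (i+1) \<otimes>\<^bsub>O_B n q\<^esub> inv\<^bsub>O_B n q\<^esub> (X_B n q (i+1) (i+1)))"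
proof -
  interpret quantum_sl n q
  proof
    show "q \<noteq> 0" by fact
    show "q\<^sup>2 \<noteq> 1" using assms(2) by simp
    show "1 + q\<^sup>2 \<noteq> 0"
    proof
      assume "1 + q\<^sup>2 = 0"
      then have "q\<^sup>2 = - 1" by (simp add: eq_neg_iff_add_eq_0 add.commute)
      then have "(q\<^sup>2)\<^sup>2 = 1" by simp
      then have "q ^ 4 = 1" by (simp flip: power_mult)
      with assms(2) show False by simp
    qed
  qed
  note U = U_plus_image
  obtain \<Phi> where O: "alg_image (O_B n q) \<Phi>"
    "carrier (O_N' n q) = range (\<lambda>p. \<Phi> (sub_O p))"
    "\<And>i. i \<in> {1..n} \<Longrightarrow> \<Phi> (sub_O (gen i)) = (- inverse (q - inverse q)) \<odot>\<^bsub>O_B n q\<^esub>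
      (X_B n q i (i+1) \<otimes>\<^bsub>O_B n q\<^esub> inv\<^bsub>O_B n q\<^esub> (X_B n q (i+1) (i+1)))"
    "\<And>p. sub_O p \<in> alg_image.kernel (O_B n q) \<Phi> \<longleftrightarrow> p \<in> J"
    using O_N'_image by blast
  obtain \<psi> where \<psi>: "\<psi> \<in> k_algebra_iso (U_plus n q) (O_N' n q)"
    "\<And>p. \<psi> (genideal (free_algebra (U_gens n)) (U_rels n q) +>\<^bsub>free_algebra (U_gens n)\<^esub>
      retract (U_gens n) (sub_U p)) = \<Phi> (sub_O p)"
    using iso_of_equal_kernels[OF U(1) O(1) sub_U_def sub_O_def _ U(2)[unfolded U_plus_def]
        O(2)[unfolded O_N'_def], folded U_plus_def O_N'_def] U(4) O(4) by blast
  show ?thesis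
  proof (rule bexI[OF _ \<psi>(1)], rule ballI)
    fix i assume i: "i \<in> {1..n}"
    then show "\<psi> (E_U n q i) = (- inverse (q - inverse q)) \<odot>\<^bsub>O_B n q\<^esub>
      (X_B n q i (i+1) \<otimes>\<^bsub>O_B n q\<^esub> inv\<^bsub>O_B n q\<^esub> (X_B n q (i+1) (i+1)))"
      using \<psi>(2)[of "gen i"] by (simp only: U(3) O(3))
  qed
qed

end
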